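(* Let $\mathcal{B}$ be a unital $\mathrm{C}^*$-algebra and let $(\mathcal{A},E)$ be a $\mathcal{B}$-valued probability space. Let $\eta:\mathcal{B}\to\mathcal{B}$ be a linear map such that $\eta-\mathrm{id}$ is completely positive. Assume that $X, V\in\mathcal{A}$ are freely independent over $\mathcal{B}$, that $X$ is self-adjoint with $\mathcal{B}$-valued law $\mu$ (with respect to $E$), and that $V$ satisfies $$V b_1 V^* b_2 V = V b_1\,\eta(b_2)\quad\text{for all } b_1,b_2\in\mathcal{B},\qquad\qquad E[V b V^*]=b\quad\text{for all } b\in\mathcal{B}.$$ Consider the map $\tilde{E}:\mathcal{A}\to\mathcal{B}$, $\tilde{E}[T]=E[VTV^*]$ (which is a conditional expectation). Let $\nu$ be the $\mathcal{B}$-valued law of $V^*XV$ with respect to $\tilde{E}$. Then $\nu=\mu^{\boxplus\eta}$, i.e. there is $\delta>0$ such that for every $n\ge 1$ one has $R_\nu^{(n)}(z)=\eta^{(n)}\big(R_\mu^{(n)}(z)\big)$ for all $z\in M_n(\mathcal{B})$ with $\|z\|<\delta$.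
   Context: **$\mathcal{B}$-valued probability space.** A pair $(\mathcal{A},E)$ where $\mathcal{A}$ is a unital $\mathrm{C}^*$-algebra, $\mathcal{B}\subseteq\mathcal{A}$ is a unital inclusion of $\mathrm{C}^*$-algebras, and $E:\mathcal{A}\to\mathcal{B}$ is a conditional expectation: $E|_{\mathcal{B}}=\mathrm{id}$, $E[b_1ab_2]=b_1E[a]b_2$ for $a\in\mathcal{A}$, $b_1,b_2\in\mathcal{B}$, and $E$ is completely positive. For a linear map $\phi$ between algebras, $\phi^{(n)}$ denotes its entrywise application to $n\times n$ matrices. For $a\in\mathcal{A}$, $a^{(n)}=a\otimes I_n\in M_n(\mathcal{A})$. **Free independence.** Unital subalgebras $\mathcal{A}_1,\dots,\mathcal{A}_N\subseteq\mathcal{A}$ containing $\mathcal{B}$ are freely independent over $\mathcal{B}$ if $E[a_1\cdots a_k]=0$ whenever $k\ge1$, $a_j\in\mathcal{A}_{i(j)}$, $E[a_j]=0$ for all $j$, and $i(j)\ne i(j+1)$ for all $j<k$. Here $X$ and $V$ ($V$ not necessarily self-adjoint) are freely independent over $\mathcal{B}$ if the unital $*$-subalgebra generated by $\mathcal{B}$ and $X$ and the unital $*$-subalgebra generated by $\mathcal{B}$ and $V$ are freely independent over $\mathcal{B}$. **Laws.** $\mathcal{B}\langle x\rangle$ is the universal unital $*$-algebra generated by $\mathcal{B}$ and a self-adjoint indeterminate $x$. The $\mathcal{B}$-valued law of a self-adjoint $Y\in\mathcal{A}$ with respect to a conditional expectation $E:\mathcal{A}\to\mathcal{B}$ is the map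 $\mathcal{B}\langle x\rangle\to\mathcal{B}$, $f\mapsto E[f(Y)]$. **Cauchy transform and $R$-transform.** If $\mu$ is the law of a self-adjoint $Y$, put $\tilde G_\mu^{(n)}(z)=E^{(n)}[z(1-Y^{(n)}z)^{-1}]$ for $z\in M_n(\mathcal{B})$ with $\|z\|<1/\|Y\|$; for invertible such $z$ this is $G_\mu^{(n)}(z^{-1})$ where $G_\mu^{(n)}(w)=E^{(n)}[(w-Y^{(n)})^{-1}]$. It is known that $\tilde G_\mu^{(n)}$ is invertible near $0$, with inverse defined on a ball around $0$ in $M_n(\mathcal{B})$ of radius independent of $n$. The $R$-transform $R_\mu^{(n)}$ is the analytic function on a ball around $0$ in $M_n(\mathcal{B})$ (radius independent of $n$) with $R_\mu^{(n)}(z)=(G_\mu^{(n)})^{-1}(z)-z^{-1}$ for invertible $z$, where $(G_\mu^{(n)})^{-1}(z)=\big((\tilde G_\mu^{(n)})^{-1}(z)\big)^{-1}$; equivalently $G_\mu^{(n)}(z^{-1}+R_\mu^{(n)}(z))=z$ for invertible $z$ near $0$. **Convolution powers.** For $\mathcal{B}$-valued laws $\mu,\nu$ and $\eta:\mathcal{B}\to\mathcal{B}$ completely positive, $\nu=\mu^{\boxplus\eta}$ means that for some $\delta>0$, $R_\nu^{(n)}=\eta^{(n)}\circ R_\mu^{(n)}$ on $\{z\in M_n(\mathcal{B}):\|z\|<\delta\}$ for all $n\ge1$. (The law $\nu$ is then uniquely determined by $\mu$ and $\eta$.) *)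

theory Defs
  imports Complex_Main "Jordan_Normal_Form.Matrix"
begin

section \<open>Unital C*-algebras\<close>

class unital_cstar_algebra = real_normed_algebra_1 + banach +
  fixes scaleC :: "complex \<Rightarrow> 'a \<Rightarrow> 'a"  (infixr \<open>*\<^sub>C\<close> 75)
    and adj :: "'a \<Rightarrow> 'a"
  assumes scaleC_add_right: "c *\<^sub>C (x + y) = c *\<^sub>C x + c *\<^sub>C y"
    and scaleC_add_left: "(c + d) *\<^sub>C x = c *\<^sub>C x + d *\<^sub>C x"
    and scaleC_scaleC: "c *\<^sub>C d *\<^sub>C x = (c * d) *\<^sub>C x"
    and scaleC_of_real: "complex_of_real r *\<^sub>C x = r *\<^sub>R x"
    and norm_scaleC: "norm (c *\<^sub>C x) = cmod c * norm x"
    and scaleC_mult_left: "(c *\<^sub>C x) * y = c *\<^sub>C (x * y)"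
    and scaleC_mult_right: "x * (c *\<^sub>C y) = c *\<^sub>C (x * y)"
    and adj_add: "adj (x + y) = adj x + adj y"
    and adj_scaleC: "adj (c *\<^sub>C x) = cnj c *\<^sub>C adj x"
    and adj_mult: "adj (x * y) = adj y * adj x"
    and adj_adj: "adj (adj x) = x"
    and cstar_identity: "norm (adj x * x) = (norm x)\<^sup>2"

definition unital_star_subalgebra :: "'a::unital_cstar_algebra set \<Rightarrow> bool" where
  "unital_star_subalgebra C \<longleftrightarrow>
     1 \<in> C \<and> (\<forall>x\<in>C. \<forall>y\<in>C. x + y \<in> C \<and> x * y \<in> C) \<and>
     (\<forall>x\<in>C. \<forall>c. c *\<^sub>C x \<in> C) \<and> (\<forall>x\<in>C. adj x \<in> C)"

definition unital_cstar_subalgebra :: "'a::unital_cstar_algebra set \<Rightarrow> bool" where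
  "unital_cstar_subalgebra B \<longleftrightarrow> unital_star_subalgebra B \<and> closed B"

text \<open>Linear maps between subspaces are represented by total functions on the ambient
  algebra whose values outside the subspace are irrelevant.\<close>

definition linear_map_on ::
  "'a::unital_cstar_algebra set \<Rightarrow> 'a set \<Rightarrow> ('a \<Rightarrow> 'a) \<Rightarrow> bool" where
  "linear_map_on C D \<phi> \<longleftrightarrow>
     (\<forall>x\<in>C. \<phi> x \<in> D) \<and> (\<forall>x\<in>C. \<forall>y\<in>C. \<phi> (x + y) = \<phi> x + \<phi> y) \<and>
     (\<forall>x\<in>C. \<forall>c. \<phi> (c *\<^sub>C x) = c *\<^sub>C \<phi> x)"


section \<open>Matrices over a C*-algebra\<close>

definition mats :: "'a set \<Rightarrow> nat \<Rightarrow> 'a mat set" where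
  "mats C n = {M \<in> carrier_mat n n. elements_mat M \<subseteq> C}"

definition mat_adj :: "'a::unital_cstar_algebra mat \<Rightarrow> 'a mat" where
  "mat_adj M = map_mat adj (transpose_mat M)"

text \<open>The C*-norm of \<open>M\<^sub>n(A)\<close> is the operator norm for the (faithful) action on the
  Hilbert \<open>A\<close>-module \<open>A\<^sup>n\<close>, whose norm comes from the \<open>A\<close>-valued inner product
  \<open>\<langle>v, w\<rangle> = \<Sum>\<^sub>i v\<^sub>i\<^sup>* w\<^sub>i\<close>. It restricts to the C*-norm of \<open>M\<^sub>n(B)\<close> for each
  C*-subalgebra \<open>B\<close>.\<close>

definition module_norm :: "'a::unital_cstar_algebra vec \<Rightarrow> real" where
  "module_norm v = sqrt (norm (\<Sum>i<dim_vec v. adj (v $ i) * v $ i))"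

definition mat_norm :: "'a::unital_cstar_algebra mat \<Rightarrow> real" where
  "mat_norm M = Sup {module_norm (M *\<^sub>v v) |v. v \<in> carrier_vec (dim_col M) \<and> module_norm v \<le> 1}"

definition mat_ball :: "'a::unital_cstar_algebra set \<Rightarrow> nat \<Rightarrow> real \<Rightarrow> 'a mat set" where
  "mat_ball B n r = {z \<in> mats B n. mat_norm z < r}"

definition mat_inv :: "'a::unital_cstar_algebra mat \<Rightarrow> 'a mat" where
  "mat_inv M = (THE N. inverts_mat M N \<and> inverts_mat N M)"

text \<open>\<open>amplify n a\<close> is \<open>a\<^sup>(\<^sup>n\<^sup>) = a \<otimes> I\<^sub>n\<close>; the amplification \<open>\<phi>\<^sup>(\<^sup>n\<^sup>)\<close> of a map is \<^term>\<open>map_mat \<phi>\<close>.\<close>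

definition amplify :: "nat \<Rightarrow> 'a::unital_cstar_algebra \<Rightarrow> 'a mat" where
  "amplify n a = a \<cdot>\<^sub>m 1\<^sub>m n"

definition positive_mat :: "'a::unital_cstar_algebra set \<Rightarrow> nat \<Rightarrow> 'a mat \<Rightarrow> bool" where
  "positive_mat C n P \<longleftrightarrow> (\<exists>N\<in>mats C n. P = mat_adj N * N)"

definition completely_positive ::
  "'a::unital_cstar_algebra set \<Rightarrow> 'a set \<Rightarrow> ('a \<Rightarrow> 'a) \<Rightarrow> bool" where
  "completely_positive C D \<phi> \<longleftrightarrow> linear_map_on C D \<phi> \<and>
     (\<forall>n\<ge>1. \<forall>P. positive_mat C n P \<longrightarrow> positive_mat D n (map_mat \<phi> P))"

text \<open>Analyticity on an open subset \<open>U\<close> of \<open>M\<^sub>n(B)\<close>: complex Frechet differentiability at each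
  point of \<open>U\<close>, the derivative \<open>D\<close> being a bounded complex-linear map.\<close>

definition analytic_on_mats ::
  "'a::unital_cstar_algebra set \<Rightarrow> nat \<Rightarrow> 'a mat set \<Rightarrow> ('a mat \<Rightarrow> 'a mat) \<Rightarrow> bool" where
  "analytic_on_mats B n U f \<longleftrightarrow> (\<forall>z\<in>U. f z \<in> mats B n) \<and>
     (\<forall>z\<in>U. \<exists>D C.
        (\<forall>h\<in>mats B n. D h \<in> mats B n \<and> mat_norm (D h) \<le> C * mat_norm h) \<and>
        (\<forall>h\<in>mats B n. \<forall>k\<in>mats B n. D (h + k) = D h + D k) \<and>
        (\<forall>h\<in>mats B n. \<forall>c. D (map_mat (scaleC c) h) = map_mat (scaleC c) (D h)) \<and>
        (\<forall>e>0. \<exists>d>0. \<forall>h\<in>mats B n. mat_norm h < d \<longrightarrow> z + h \<in> U \<longrightarrow>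
            mat_norm (f (z + h) - f z - D h) \<le> e * mat_norm h))"


section \<open>Operator-valued probability spaces and freeness\<close>

definition conditional_expectation ::
  "'a::unital_cstar_algebra set \<Rightarrow> ('a \<Rightarrow> 'a) \<Rightarrow> bool" where
  "conditional_expectation B E \<longleftrightarrow> (\<forall>b\<in>B. E b = b) \<and>
     (\<forall>a. \<forall>b1\<in>B. \<forall>b2\<in>B. E (b1 * a * b2) = b1 * E a * b2) \<and>
     completely_positive UNIV B E"

definition valued_probability_space ::
  "'a::unital_cstar_algebra set \<Rightarrow> ('a \<Rightarrow> 'a) \<Rightarrow> bool" where
  "valued_probability_space B E \<longleftrightarrow> unital_cstar_subalgebra B \<and> conditional_expectation B E"

definition star_algebra_generated ::
  "'a::unital_cstar_algebra set \<Rightarrow> 'a \<Rightarrow> 'a set" where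
  "star_algebra_generated B a = unital_star_subalgebra hull (insert a B)"

definition freely_independent ::
  "('a::unital_cstar_algebra \<Rightarrow> 'a) \<Rightarrow> 'a set list \<Rightarrow> bool" where
  "freely_independent E As \<longleftrightarrow>
     (\<forall>k\<ge>1. \<forall>a :: nat \<Rightarrow> 'a. \<forall>i :: nat \<Rightarrow> nat.
        (\<forall>j<k. i j < length As \<and> a j \<in> As ! i j \<and> E (a j) = 0) \<longrightarrow>
        (\<forall>j. Suc j < k \<longrightarrow> i j \<noteq> i (Suc j)) \<longrightarrow>
        E (prod_list (map a [0..<k])) = 0)"


section \<open>The universal algebra \<open>B\<langle>x\<rangle>\<close> and laws\<close>

text \<open>Elements of \<open>B\<langle>x\<rangle>\<close> are classes of formal *-algebra expressions with coefficients in \<open>B\<close>,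
  modulo the congruence generated by the axioms of unital *-algebras, the relations that hold
  in \<open>B\<close>, and \<open>x\<^sup>* = x\<close>.\<close>

datatype 'a nc_expr =
    Coeff 'a
  | Indet
  | Add "'a nc_expr" "'a nc_expr"
  | Mult "'a nc_expr" "'a nc_expr"
  | Scale complex "'a nc_expr"
  | Star "'a nc_expr"

definition nc_exprs :: "'a set \<Rightarrow> 'a nc_expr set" where
  "nc_exprs B = {p. set_nc_expr p \<subseteq> B}"

inductive nc_eq ::
  "'a::unital_cstar_algebra set \<Rightarrow> 'a nc_expr \<Rightarrow> 'a nc_expr \<Rightarrow> bool" for B where
  refl: "p \<in> nc_exprs B \<Longrightarrow> nc_eq B p p"
| sym: "nc_eq B p q \<Longrightarrow> nc_eq B q p"
| trans: "nc_eq B p q \<Longrightarrow> nc_eq B q r \<Longrightarrow> nc_eq B p r"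
| cong_add: "nc_eq B p p' \<Longrightarrow> nc_eq B q q' \<Longrightarrow> nc_eq B (Add p q) (Add p' q')"
| cong_mult: "nc_eq B p p' \<Longrightarrow> nc_eq B q q' \<Longrightarrow> nc_eq B (Mult p q) (Mult p' q')"
| cong_scale: "nc_eq B p p' \<Longrightarrow> nc_eq B (Scale c p) (Scale c p')"
| cong_star: "nc_eq B p p' \<Longrightarrow> nc_eq B (Star p) (Star p')"
| add_assoc: "p \<in> nc_exprs B \<Longrightarrow> q \<in> nc_exprs B \<Longrightarrow> r \<in> nc_exprs B \<Longrightarrow>
    nc_eq B (Add (Add p q) r) (Add p (Add q r))"
| add_commute: "p \<in> nc_exprs B \<Longrightarrow> q \<in> nc_exprs B \<Longrightarrow> nc_eq B (Add p q) (Add q p)"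
| add_zero: "p \<in> nc_exprs B \<Longrightarrow> nc_eq B (Add (Coeff 0) p) p"
| add_inverse: "p \<in> nc_exprs B \<Longrightarrow> nc_eq B (Add p (Scale (-1) p)) (Coeff 0)"
| scale_add_right: "p \<in> nc_exprs B \<Longrightarrow> q \<in> nc_exprs B \<Longrightarrow>
    nc_eq B (Scale c (Add p q)) (Add (Scale c p) (Scale c q))"
| scale_add_left: "p \<in> nc_exprs B \<Longrightarrow> nc_eq B (Scale (c + d) p) (Add (Scale c p) (Scale d p))"
| scale_scale: "p \<in> nc_exprs B \<Longrightarrow> nc_eq B (Scale c (Scale d p)) (Scale (c * d) p)"
| scale_one: "p \<in> nc_exprs B \<Longrightarrow> nc_eq B (Scale 1 p) p"
| mult_assoc: "p \<in> nc_exprs B \<Longrightarrow> q \<in> nc_exprs B \<Longrightarrow> r \<in> nc_exprs B \<Longrightarrow>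
    nc_eq B (Mult (Mult p q) r) (Mult p (Mult q r))"
| mult_one_left: "p \<in> nc_exprs B \<Longrightarrow> nc_eq B (Mult (Coeff 1) p) p"
| mult_one_right: "p \<in> nc_exprs B \<Longrightarrow> nc_eq B (Mult p (Coeff 1)) p"
| distrib_left: "p \<in> nc_exprs B \<Longrightarrow> q \<in> nc_exprs B \<Longrightarrow> r \<in> nc_exprs B \<Longrightarrow>
    nc_eq B (Mult p (Add q r)) (Add (Mult p q) (Mult p r))"
| distrib_right: "p \<in> nc_exprs B \<Longrightarrow> q \<in> nc_exprs B \<Longrightarrow> r \<in> nc_exprs B \<Longrightarrow>
    nc_eq B (Mult (Add p q) r) (Add (Mult p r) (Mult q r))"
| mult_scale_left: "p \<in> nc_exprs B \<Longrightarrow> q \<in> nc_exprs B \<Longrightarrow>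
    nc_eq B (Mult (Scale c p) q) (Scale c (Mult p q))"
| mult_scale_right: "p \<in> nc_exprs B \<Longrightarrow> q \<in> nc_exprs B \<Longrightarrow>
    nc_eq B (Mult p (Scale c q)) (Scale c (Mult p q))"
| star_add: "p \<in> nc_exprs B \<Longrightarrow> q \<in> nc_exprs B \<Longrightarrow>
    nc_eq B (Star (Add p q)) (Add (Star p) (Star q))"
| star_scale: "p \<in> nc_exprs B \<Longrightarrow> nc_eq B (Star (Scale c p)) (Scale (cnj c) (Star p))"
| star_mult: "p \<in> nc_exprs B \<Longrightarrow> q \<in> nc_exprs B \<Longrightarrow>
    nc_eq B (Star (Mult p q)) (Mult (Star q) (Star p))"
| star_star: "p \<in> nc_exprs B \<Longrightarrow> nc_eq B (Star (Star p)) p"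
| coeff_add: "b \<in> B \<Longrightarrow> c \<in> B \<Longrightarrow> nc_eq B (Add (Coeff b) (Coeff c)) (Coeff (b + c))"
| coeff_mult: "b \<in> B \<Longrightarrow> c \<in> B \<Longrightarrow> nc_eq B (Mult (Coeff b) (Coeff c)) (Coeff (b * c))"
| coeff_scale: "b \<in> B \<Longrightarrow> nc_eq B (Scale t (Coeff b)) (Coeff (t *\<^sub>C b))"
| coeff_star: "b \<in> B \<Longrightarrow> nc_eq B (Star (Coeff b)) (Coeff (adj b))"
| indet_star: "nc_eq B (Star Indet) Indet"

definition nc_polys :: "'a::unital_cstar_algebra set \<Rightarrow> 'a nc_expr set set" where
  "nc_polys B = nc_exprs B // {(p, q). nc_eq B p q}"

primrec nc_eval :: "'a::unital_cstar_algebra \<Rightarrow> 'a nc_expr \<Rightarrow> 'a" where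
  "nc_eval Y (Coeff b) = b"
| "nc_eval Y Indet = Y"
| "nc_eval Y (Add p q) = nc_eval Y p + nc_eval Y q"
| "nc_eval Y (Mult p q) = nc_eval Y p * nc_eval Y q"
| "nc_eval Y (Scale c p) = c *\<^sub>C nc_eval Y p"
| "nc_eval Y (Star p) = adj (nc_eval Y p)"

text \<open>For self-adjoint \<open>Y\<close> evaluation at \<open>Y\<close> is constant on each class \<open>f\<close>, so that
  \<^term>\<open>the_elem (nc_eval Y ` f)\<close> is \<open>f(Y)\<close>.\<close>

definition law :: "'a::unital_cstar_algebra set \<Rightarrow> ('a \<Rightarrow> 'a) \<Rightarrow> 'a \<Rightarrow> ('a nc_expr set \<Rightarrow> 'a)" where
  "law B E Y = (\<lambda>f\<in>nc_polys B. E (the_elem (nc_eval Y ` f)))"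


section \<open>Cauchy transform, R-transform and convolution powers\<close>

text \<open>The domain \<open>\<parallel>z\<parallel> < 1/\<parallel>Y\<parallel>\<close> of the Cauchy transform is expressed below by \<open>\<parallel>z\<parallel> < \<epsilon>\<close> with
  \<open>\<epsilon> \<parallel>Y\<parallel> \<le> 1\<close>, which also covers \<open>Y = 0\<close>.\<close>

definition cauchy_tilde ::
  "('a::unital_cstar_algebra \<Rightarrow> 'a) \<Rightarrow> 'a \<Rightarrow> nat \<Rightarrow> 'a mat \<Rightarrow> 'a mat" where
  "cauchy_tilde E Y n z = map_mat E (z * mat_inv (1\<^sub>m n - amplify n Y * z))"

text \<open>\<open>K n\<close> is, for every \<open>n\<close>, the inverse near 0 of \<^term>\<open>cauchy_tilde E Y n\<close>, defined on the ball
  of radius \<open>\<rho>\<close>. Injectivity determines these inverses uniquely near 0.\<close>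

definition cauchy_tilde_inverse ::
  "'a::unital_cstar_algebra set \<Rightarrow> ('a \<Rightarrow> 'a) \<Rightarrow> 'a \<Rightarrow> real \<Rightarrow> (nat \<Rightarrow> 'a mat \<Rightarrow> 'a mat) \<Rightarrow> bool" where
  "cauchy_tilde_inverse B E Y \<rho> K \<longleftrightarrow> 0 < \<rho> \<and>
     (\<exists>\<epsilon>>0. \<epsilon> * norm Y \<le> 1 \<and>
       (\<forall>n\<ge>1. inj_on (cauchy_tilde E Y n) (mat_ball B n \<epsilon>) \<and>
          (\<forall>z\<in>mat_ball B n \<rho>. K n z \<in> mat_ball B n \<epsilon> \<and> cauchy_tilde E Y n (K n z) = z)))"

text \<open>The transforms depend on a law only, not on the realization \<open>(E, Y)\<close> of it, and the
  R-transform is unique as a germ at 0, uniformly in \<open>n\<close>.\<close>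

definition is_R_transform ::
  "'a::unital_cstar_algebra set \<Rightarrow> ('a nc_expr set \<Rightarrow> 'a) \<Rightarrow> (nat \<Rightarrow> 'a mat \<Rightarrow> 'a mat) \<Rightarrow> bool" where
  "is_R_transform B \<mu> R \<longleftrightarrow>
     (\<exists>E Y \<rho> K. conditional_expectation B E \<and> adj Y = Y \<and> law B E Y = \<mu> \<and>
        cauchy_tilde_inverse B E Y \<rho> K \<and>
        (\<forall>n\<ge>1. analytic_on_mats B n (mat_ball B n \<rho>) (R n) \<and>
          (\<forall>z\<in>mat_ball B n \<rho>. invertible_mat z \<longrightarrow>
             invertible_mat (K n z) \<and> R n z = mat_inv (K n z) - mat_inv z)))"

definition R_transform ::
  "'a::unital_cstar_algebra set \<Rightarrow> ('a nc_expr set \<Rightarrow> 'a) \<Rightarrow> nat \<Rightarrow> 'a mat \<Rightarrow> 'a mat" where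
  "R_transform B \<mu> = (SOME R. is_R_transform B \<mu> R)"

definition is_convolution_power ::
  "'a::unital_cstar_algebra set \<Rightarrow> ('a \<Rightarrow> 'a) \<Rightarrow> ('a nc_expr set \<Rightarrow> 'a) \<Rightarrow> ('a nc_expr set \<Rightarrow> 'a) \<Rightarrow> bool"
  where
  "is_convolution_power B \<eta> \<mu> \<nu> \<longleftrightarrow>
     (\<exists>\<delta>>0. \<forall>n\<ge>1. \<forall>z\<in>mats B n. mat_norm z < \<delta> \<longrightarrow>
        R_transform B \<nu> n z = map_mat \<eta> (R_transform B \<mu> n z))"

end

theory Submission
  imports Defs "HOL-Complex_Analysis.Conformal_Mappings"
begin

text \<open>
  Write \<open>r = R\<^sub>\<mu>(z)\<close>, \<open>k = z (1 + \<eta>(r) z)\<^sup>-\<^sup>1\<close>, \<open>T = V k V\<^sup>*\<close> and \<open>S = V z V\<^sup>*\<close>. The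
  transform whose inverse defines \<open>R\<^sub>\<nu>\<close> takes the value \<open>E[T (1 - X T)\<^sup>-\<^sup>1]\<close> at \<open>k\<close>, and one has to show
  that this is \<open>z\<close>.
  The relation for \<open>V\<close> gives \<open>S = T + T r S\<close>, i.e. formally \<open>S\<^sup>-\<^sup>1 = T\<^sup>-\<^sup>1 - r\<close>, and for \<open>X\<close> there is
  a centered \<open>a\<close> with \<open>(z\<^sup>-\<^sup>1 + r - X)\<^sup>-\<^sup>1 = z + z a z\<close>. With the centered element \<open>s = S - z\<close>,
  \<open>T (1 - X T)\<^sup>-\<^sup>1 = (z + s) (1 - a s)\<^sup>-\<^sup>1 (1 + a z)\<close>, and by freeness only the term \<open>z\<close> of its
  expansion has nonzero expectation. No inverse of \<open>z\<close> is involved.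

  The \<open>R\<close>-transform is determined by its values at invertible \<open>z\<close> through the identity theorem
  along \<open>s \<mapsto> z + s1\<close>. Complete boundedness of \<open>E\<close> and \<open>\<eta>\<close>, which makes all radii independent of the
  matrix size, comes from the Schwarz inequality for completely positive maps.
\<close>

text \<open>The formula for \<open>k\<close> is forced: if the R-transform of \<nu> is \<eta>
  applied to that of \<mu>, the inverse transform of \<nu> at \<open>z\<close> has to be the inverse
  of z^{-1} + \<eta>(r), and \<open>k\<close> is this element written without z^{-1}. Evaluating the
  transform of \<nu> at \<open>k\<close> then settles the matter, since near 0 that transform is
  injective. One obstacle is that freeness speaks of words in the algebras generated by
  \<open>B\<close> and \<open>X\<close> or \<open>V\<close>, whereas \<open>a\<close> is a limit of
  matrices over such an algebra. Entries of matrix products are sums of words, which an induction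
  absorbs, and \<open>a\<close> is approximated by partial sums from which their expectations are
  subtracted. Another obstacle is that the R-transform is an arbitrary choice among functions that
  may come from different realizations of the law. Any two candidates have to be compared on a ball
  whose radius serves all matrix sizes; equality of laws enters through partial sums of geometric
  series, whose expectations are moments.\<close>

unbundle no vec_syntax
no_notation inner (infix "\<bullet>" 70)
hide_type (open) Finite_Cartesian_Product.vec
hide_const (open) Finite_Cartesian_Product.vec Finite_Cartesian_Product.row Finite_Cartesian_Product.mat

section \<open>Positivity in C*-algebras\<close>

text \<open>The iteration \<open>y \<mapsto> (x + y\<^sup>2) / 2\<close> is dominated by its scalar counterpart for \<open>x = 1\<close>,
  which increases to a limit even though it is not a contraction up to \<open>1\<close>.\<close>

lemma ex_root_one_minus:
  fixes x :: "'m::{real_normed_algebra_1,banach}"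
  assumes x: "norm x \<le> 1"
  obtains y where "(1 - y) * (1 - y) = 1 - x"
    and "\<And>S. closed S \<Longrightarrow> 0 \<in> S \<Longrightarrow> (\<And>y. y \<in> S \<Longrightarrow> (1/2) *\<^sub>R (x + y * y) \<in> S) \<Longrightarrow> y \<in> S"
proof -
  define f where "f = (\<lambda>k. ((\<lambda>y. (1/2) *\<^sub>R (x + y * y)) ^^ k) 0)"
  define t :: "nat \<Rightarrow> real" where "t = (\<lambda>k. ((\<lambda>s. (1 + s * s) / 2) ^^ k) 0)"
  have f0: "f 0 = 0" and fS: "\<And>k. f (Suc k) = (1/2) *\<^sub>R (x + f k * f k)" by (auto simp: f_def)
  have t0: "t 0 = 0" and tS: "\<And>k. t (Suc k) = (1 + t k * t k) / 2" by (auto simp: t_def)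
  have tb: "0 \<le> t k \<and> t k \<le> 1" for k
  proof (induction k)
    case (Suc k)
    then have "t k * t k \<le> 1 * 1" by (intro mult_mono) auto
    with Suc show ?case by (auto simp: tS)
  qed (simp add: t0)
  have tmono: "t k \<le> t (Suc k)" for k
    using sum_squares_ge_zero[of "t k - 1" 0] by (simp add: tS algebra_simps)
  have fb: "norm (f k) \<le> t k" for k
  proof (induction k)
    case (Suc k)
    have "norm (x + f k * f k) \<le> norm x + norm (f k) * norm (f k)"
      by (intro norm_triangle_mono norm_mult_ineq order_refl)
    also have "\<dots> \<le> 1 + t k * t k" using x Suc tb[of k] by (intro add_mono mult_mono) auto
    finally show ?case by (simp add: fS tS)
  qed (simp add: f0 t0)
  have step: "norm (f (Suc k) - f k) \<le> t (Suc k) - t k" for k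
  proof (induction k)
    case (Suc k)
    let ?d = "f (Suc k) - f k"
    have eq: "f (Suc (Suc k)) - f (Suc k) = (1/2) *\<^sub>R (f (Suc k) * ?d + ?d * f k)"
    proof -
      have "f (Suc (Suc k)) - f (Suc k) = (1/2) *\<^sub>R (f (Suc k) * f (Suc k) - f k * f k)"
        by (simp add: fS[of "Suc k"] fS[of k] scaleR_right_diff_distrib[symmetric] del: scaleR_right_diff_distrib)
      also have "f (Suc k) * f (Suc k) - f k * f k = f (Suc k) * ?d + ?d * f k"
        by (simp add: algebra_simps)
      finally show ?thesis .
    qed
    have "norm (f (Suc k) * ?d + ?d * f k) \<le> norm (f (Suc k)) * norm ?d + norm ?d * norm (f k)"
      by (intro norm_triangle_mono norm_mult_ineq)
    also have "\<dots> \<le> t (Suc k) * (t (Suc k) - t k) + (t (Suc k) - t k) * t k"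
      using Suc fb tb tmono[of k] by (intro add_mono mult_mono) auto
    also have "\<dots> = 2 * (t (Suc (Suc k)) - t (Suc k))"
      by (simp add: tS[of "Suc k"] tS[of k] field_simps)
    finally show ?case unfolding eq by simp
  qed (use x in \<open>simp add: f0 t0 fS tS\<close>)
  have dist: "norm (f n - f m) \<le> t n - t m" if "m \<le> n" for m n
    using that
  proof (induction n rule: dec_induct)
    case (step n)
    have "norm (f (Suc n) - f m) \<le> norm (f (Suc n) - f n) + norm (f n - f m)"
      using norm_triangle_ineq[of "f (Suc n) - f n" "f n - f m"] by simp
    with step \<open>norm (f (Suc n) - f n) \<le> t (Suc n) - t n\<close> show ?case by linarith
  qed simp
  have "convergent t"
    using Bseq_mono_convergent[of t] tmono tb
    by (metis BseqI' abs_of_nonneg lift_Suc_mono_le real_norm_def)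
  then have ct: "Cauchy t" by (rule convergent_Cauchy)
  have "Cauchy f"
  proof (rule metric_CauchyI)
    fix e :: real assume "0 < e"
    with ct obtain M where M: "\<And>m n. m \<ge> M \<Longrightarrow> n \<ge> M \<Longrightarrow> dist (t m) (t n) < e"
      by (metis metric_CauchyD)
    have "dist (f m) (f n) < e" if "m \<ge> M" "n \<ge> M" for m n
    proof (cases "m \<le> n")
      case True
      with dist[OF this] M[OF that] show ?thesis by (simp add: dist_norm norm_minus_commute abs_if split: if_splits)
    next
      case False
      then have "n \<le> m" by simp
      with dist[OF this] M[OF that] show ?thesis by (simp add: dist_norm abs_if split: if_splits)
    qed
    then show "\<exists>M. \<forall>m\<ge>M. \<forall>n\<ge>M. dist (f m) (f n) < e" by blast
  qed
  then obtain y where y: "f \<longlonglongrightarrow> y" using Cauchy_convergent convergent_def by blast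
  have "(\<lambda>k. (1/2) *\<^sub>R (x + f k * f k)) \<longlonglongrightarrow> (1/2) *\<^sub>R (x + y * y)"
    by (intro tendsto_intros y)
  then have "(\<lambda>k. f (Suc k)) \<longlonglongrightarrow> (1/2) *\<^sub>R (x + y * y)" by (simp add: fS)
  with LIMSEQ_Suc[OF y] have yeq: "y = (1/2) *\<^sub>R (x + y * y)" by (rule LIMSEQ_unique)
  have "y + y = x + y * y"
    by (subst (1 2) yeq) (simp flip: scaleR_add_left)
  then have 1: "(1 - y) * (1 - y) = 1 - x" by (simp add: algebra_simps)
  \<comment> \<open>This clause serves as an induction principle for \<open>y\<close>: a closed
    property that holds at 0 and survives one iteration holds for the limit.\<close>
  have 2: "y \<in> S" if S: "closed S" "0 \<in> S" "\<And>y. y \<in> S \<Longrightarrow> (1/2) *\<^sub>R (x + y * y) \<in> S" for S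
  proof -
    have "f k \<in> S" for k by (induction k) (auto simp: f0 fS S)
    with S(1) y show ?thesis by (metis closed_sequentially)
  qed
  show thesis using that 1 2 by blast
qed

section \<open>Arithmetic of the involution and of complex scalars\<close>

lemma adj_zero [simp]: "adj (0::'a::unital_cstar_algebra) = 0"
  using adj_add[of "0::'a" 0] by simp

lemma adj_minus [simp]: "adj (- x) = - adj (x::'a::unital_cstar_algebra)"
  using adj_add[of x "-x"] by (simp add: eq_neg_iff_add_eq_0 add.commute)

lemma adj_diff: "adj (x - y) = adj x - adj (y::'a::unital_cstar_algebra)"
  using adj_add[of x "-y"] by simp

lemma adj_one [simp]: "adj (1::'a::unital_cstar_algebra) = 1"
proof -
  have "adj (1::'a) = 1 * adj 1" by simp
  also have "\<dots> = adj (adj 1) * adj 1" by (metis adj_adj adj_mult mult.right_neutral)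
  also have "\<dots> = adj (1 * adj 1)" by (metis adj_mult)
  also have "\<dots> = 1" by (simp add: adj_adj)
  finally show ?thesis .
qed

lemma adj_scaleR [simp]: "adj (r *\<^sub>R x) = r *\<^sub>R adj (x::'a::unital_cstar_algebra)"
  by (metis adj_scaleC scaleC_of_real complex_cnj_complex_of_real)

lemma adj_sum: "adj (\<Sum>i\<in>I. f i) = (\<Sum>i\<in>I. adj (f i :: 'a::unital_cstar_algebra))"
  by (induction I rule: infinite_finite_induct) (auto simp: adj_add)

lemma norm_adj [simp]: "norm (adj x) = norm (x::'a::unital_cstar_algebra)"
proof -
  have le: "norm y \<le> norm (adj y)" for y :: 'a
  proof (cases "y = 0")
    case False
    have "norm y * norm y \<le> norm (adj y) * norm y"
      using cstar_identity[of y] norm_mult_ineq[of "adj y" y] by (simp add: power2_eq_square)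
    then show ?thesis using False by simp
  qed simp
  show ?thesis using le[of x] le[of "adj x"] by (simp add: adj_adj)
qed

lemma bounded_linear_adj: "bounded_linear (adj :: 'a::unital_cstar_algebra \<Rightarrow> 'a)"
  by (rule bounded_linear_intro[where K=1]) (auto simp: adj_add)

lemmas continuous_on_adj [continuous_intros] = bounded_linear.continuous_on[OF bounded_linear_adj]

lemma scaleC_zero [simp]: "c *\<^sub>C (0::'a::unital_cstar_algebra) = 0"
  by (metis norm_eq_zero norm_scaleC mult_zero_right norm_zero)

lemma scaleC_one [simp]: "1 *\<^sub>C (x::'a::unital_cstar_algebra) = x"
  using scaleC_of_real[of 1 x] by simp

lemma scaleC_minus: "c *\<^sub>C (- x) = - (c *\<^sub>C (x::'a::unital_cstar_algebra))"
  using scaleC_add_right[of c x "-x"] by (simp add: eq_neg_iff_add_eq_0 add.commute)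

lemma scaleC_diff: "c *\<^sub>C (x - y) = c *\<^sub>C x - c *\<^sub>C (y::'a::unital_cstar_algebra)"
  using scaleC_add_right[of c x "-y"] by (simp add: scaleC_minus)

lemma scaleC_minus_left: "(- c) *\<^sub>C x = - (c *\<^sub>C (x::'a::unital_cstar_algebra))"
  using scaleC_add_left[of c "-c" x] scaleC_of_real[of 0 x] by (simp add: eq_neg_iff_add_eq_0 add.commute)

lemma scaleC_sum: "c *\<^sub>C (\<Sum>i\<in>I. f i) = (\<Sum>i\<in>I. c *\<^sub>C (f i :: 'a::unital_cstar_algebra))"
  by (induction I rule: infinite_finite_induct) (auto simp: scaleC_add_right)

text \<open>Positivity without spectra: for self-adjoint \<open>x\<close>, ||t - x|| \<le> t says
  that the spectrum lies in [0, 2t]. In this form sums and multiples are immediate, and x / t = 1 -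
  w with ||w|| \<le> 1 has a square root by iteration. That squares and elements
  \<open>adj a * a\<close> are positive takes work.\<close>

definition pos :: "'a::unital_cstar_algebra \<Rightarrow> bool" where
  "pos x \<longleftrightarrow> adj x = x \<and> (\<exists>t. norm (t *\<^sub>R 1 - x) \<le> t)"

lemma pos_add: "pos x \<Longrightarrow> pos y \<Longrightarrow> pos (x + y)"
proof -
  assume "pos x" "pos y"
  then obtain s t where *: "adj x = x" "adj y = y" "norm (s *\<^sub>R 1 - x) \<le> s" "norm (t *\<^sub>R 1 - y) \<le> t"
    by (auto simp: pos_def)
  have "norm ((s + t) *\<^sub>R 1 - (x + y)) \<le> s + t"
    using norm_triangle_ineq[of "s *\<^sub>R 1 - x" "t *\<^sub>R 1 - y"] * by (simp add: algebra_simps)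
  with * show "pos (x + y)" by (auto simp: pos_def adj_add)
qed

lemma pos_scaleR: "pos x \<Longrightarrow> 0 \<le> r \<Longrightarrow> pos (r *\<^sub>R x)"
proof -
  assume "pos x" "0 \<le> r"
  then obtain s where *: "adj x = x" "norm (s *\<^sub>R 1 - x) \<le> s" by (auto simp: pos_def)
  have "norm ((r * s) *\<^sub>R 1 - r *\<^sub>R x) = r * norm (s *\<^sub>R 1 - x)"
    using \<open>0 \<le> r\<close> by (metis abs_of_nonneg norm_scaleR scaleR_right_diff_distrib scaleR_scaleR)
  also have "\<dots> \<le> r * s" using * \<open>0 \<le> r\<close> by (simp add: mult_left_mono)
  finally show ?thesis using * by (auto simp: pos_def)
qed

lemma pos_zero [simp]: "pos 0"
  unfolding pos_def by (intro conjI exI[of _ 0]) simp_all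

lemma pos_sum: "(\<And>i. i \<in> I \<Longrightarrow> pos (f i)) \<Longrightarrow> pos (\<Sum>i\<in>I. f i)"
proof (induction I rule: infinite_finite_induct)
  case (insert i I)
  then show ?case by (simp add: pos_add)
qed (simp_all add: pos_zero)

text \<open>The root is sqrt t (1 - y), where \<open>y\<close> comes from the iteration for w = 1 -
  x / t. Commutation with whatever commutes with \<open>x\<close> makes sums of squares of two roots
  tractable later; the last clause keeps the root inside a closed subalgebra containing
  \<open>x\<close>.\<close>

lemma pos_sqrt:
  fixes x :: "'a::unital_cstar_algebra"
  assumes "pos x"
  obtains h where "adj h = h" "h * h = x" "pos h" "\<And>c. c * x = x * c \<Longrightarrow> c * h = h * c"
    "\<And>S. closed S \<Longrightarrow> 1 \<in> S \<Longrightarrow> x \<in> S \<Longrightarrow> (\<And>a b. a \<in> S \<Longrightarrow> b \<in> S \<Longrightarrow> a + b \<in> S \<and> a * b \<in> S) \<Longrightarrow>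
       (\<And>a r. a \<in> S \<Longrightarrow> r *\<^sub>R a \<in> S) \<Longrightarrow> h \<in> S"
proof -
  from assms obtain t where sa: "adj x = x" and t: "norm (t *\<^sub>R 1 - x) \<le> t" by (auto simp: pos_def)
  from t have "0 \<le> t" using norm_ge_zero order_trans by blast
  show thesis
  proof (cases "t = 0")
    case True
    with t have "x = 0" by simp
    show thesis by (rule that[of 0]) (auto simp: \<open>x = 0\<close> pos_def intro: exI[of _ 0])
  next
    case False
    with \<open>0 \<le> t\<close> have "t > 0" by simp
    define w where "w = 1 - (1/t) *\<^sub>R x"
    have wt: "w = (1/t) *\<^sub>R (t *\<^sub>R 1 - x)" using \<open>t > 0\<close> by (simp add: w_def algebra_simps)
    have "norm w \<le> 1" unfolding wt using t \<open>t > 0\<close> by simp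
    then obtain y where y: "(1 - y) * (1 - y) = 1 - w"
      and S: "\<And>S. closed S \<Longrightarrow> 0 \<in> S \<Longrightarrow> (\<And>y. y \<in> S \<Longrightarrow> (1/2) *\<^sub>R (w + y * y) \<in> S) \<Longrightarrow> y \<in> S"
      using ex_root_one_minus[of w] by blast
    have saw: "adj w = w" by (simp add: w_def adj_diff sa)
    have say: "y \<in> {y. adj y = y}"
      by (rule S) (auto intro!: closed_Collect_eq continuous_intros simp: adj_add saw adj_mult)
    have ny: "y \<in> {y. norm y \<le> 1}"
    proof (rule S)
      fix y :: 'a assume "y \<in> {y. norm y \<le> 1}"
      then have "norm (w + y * y) \<le> 1 + 1 * 1"
        using \<open>norm w \<le> 1\<close>
        by (intro norm_triangle_mono order_trans[OF norm_mult_ineq] mult_mono) auto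
      then show "(1/2) *\<^sub>R (w + y * y) \<in> {y::'a. norm y \<le> 1}" by simp
    qed (auto intro!: closed_Collect_le continuous_intros)
    have comm: "c * y = y * c" if "c * x = x * c" for c
    proof -
      have cw: "c * w = w * c" by (simp add: w_def algebra_simps that)
      have "y \<in> {y. c * y = y * c}"
      proof (rule S)
        fix y assume y: "y \<in> {y. c * y = y * c}"
        then have cy: "c * y = y * c" by simp
        have "c * (y * y) = (c * y) * y" by (simp only: mult.assoc)
        also have "\<dots> = y * (c * y)" unfolding cy by (simp only: mult.assoc cy)
        also have "\<dots> = y * y * c" by (simp only: cy mult.assoc)
        finally have "c * (y * y) = y * y * c" .
        then show "(1/2) *\<^sub>R (w + y * y) \<in> {y. c * y = y * c}" by (simp add: ring_distribs cw)
      qed (auto intro!: closed_Collect_eq continuous_intros)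
      then show ?thesis by simp
    qed
    show thesis
    proof (rule that[of "sqrt t *\<^sub>R (1 - y)"])
      show "adj (sqrt t *\<^sub>R (1 - y)) = sqrt t *\<^sub>R (1 - y)" using say by (simp add: adj_diff)
      have "norm (sqrt t *\<^sub>R 1 - sqrt t *\<^sub>R (1 - y)) \<le> sqrt t"
        using ny \<open>t > 0\<close> by (simp add: algebra_simps)
      with say show "pos (sqrt t *\<^sub>R (1 - y))" unfolding pos_def
        by (auto simp: adj_diff)
      have "sqrt t *\<^sub>R (1 - y) * sqrt t *\<^sub>R (1 - y) = t *\<^sub>R ((1 - y) * (1 - y))"
        using \<open>t > 0\<close> by simp
      also have "\<dots> = x" unfolding y w_def using \<open>t > 0\<close> by simp
      finally show "sqrt t *\<^sub>R (1 - y) * sqrt t *\<^sub>R (1 - y) = x" .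
      show "c * sqrt t *\<^sub>R (1 - y) = sqrt t *\<^sub>R (1 - y) * c" if "c * x = x * c" for c
        using comm[OF that] by (simp add: algebra_simps)
      fix T assume T: "closed T" "1 \<in> T" "x \<in> T" "\<And>a b. a \<in> T \<Longrightarrow> b \<in> T \<Longrightarrow> a + b \<in> T \<and> a * b \<in> T"
        "\<And>a r. a \<in> T \<Longrightarrow> r *\<^sub>R a \<in> T"
      have diff: "a - b \<in> T" if "a \<in> T" "b \<in> T" for a b
        using T(4)[OF that(1) T(5)[OF that(2), of "-1"]] by simp
      have "w \<in> T" unfolding w_def using T diff by blast
      have "y \<in> T" by (rule S) (use T diff[OF T(2) T(2)] \<open>w \<in> T\<close> in auto)
      then show "sqrt t *\<^sub>R (1 - y) \<in> T" using T diff by blast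
    qed
  qed
qed

lemma pos_sqrt_commute:
  fixes x :: "'a::unital_cstar_algebra"
  assumes "pos x"
  obtains h where "adj h = h" "h * h = x" "pos h" "\<And>c. c * x = x * c \<Longrightarrow> c * h = h * c"
  by (rule pos_sqrt[OF assms]) blast

text \<open>For commuting self-adjoint \<open>h\<close> and \<open>k\<close> the element \<open>u = h + i k\<close> satisfies
  \<open>u\<^sup>*u = h\<^sup>2 + k\<^sup>2\<close>, and \<open>k\<close> is the imaginary part of \<open>u\<close>.\<close>

lemma norm_square_le_sum_squares:
  fixes h k :: "'a::unital_cstar_algebra"
  assumes "adj h = h" "adj k = k" "h * k = k * h"
  shows "norm (k * k) \<le> norm (h * h + k * k)"
proof -
  define u where "u = h + \<i> *\<^sub>C k"
  have au: "adj u = h - \<i> *\<^sub>C k" by (simp add: u_def adj_add adj_scaleC assms scaleC_minus_left)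
  have ww: "\<i> *\<^sub>C k * \<i> *\<^sub>C k = - (k * k)"
    by (simp add: scaleC_mult_left scaleC_mult_right scaleC_scaleC scaleC_minus_left)
  have hw: "h * \<i> *\<^sub>C k = \<i> *\<^sub>C k * h"
    by (simp add: scaleC_mult_left scaleC_mult_right assms(3))
  have *: "(h - w) * (h + w) = h * h - w * w" if "h * w = w * h" for w
    using that by (simp add: algebra_simps)
  have "adj u * u = (h - \<i> *\<^sub>C k) * (h + \<i> *\<^sub>C k)" unfolding au by (simp add: u_def)
  also have "\<dots> = h * h + k * k"
    using *[OF hw] ww by simp
  finally have n: "norm (h * h + k * k) = (norm u)\<^sup>2" using cstar_identity[of u] by simp
  have "u - adj u = (2 * \<i>) *\<^sub>C k" using scaleC_add_left[of \<i> \<i> k] unfolding au by (simp add: u_def)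
  then have "2 * norm k = norm (u - adj u)" by (simp add: norm_scaleC norm_mult)
  also have "\<dots> \<le> 2 * norm u" using norm_triangle_ineq4[of u "adj u"] by simp
  finally have "norm k \<le> norm u" by simp
  then have "(norm k)\<^sup>2 \<le> (norm u)\<^sup>2" by simp
  with n norm_mult_ineq[of k k] show ?thesis by (simp add: power2_eq_square)
qed

text \<open>The difference of \<open>t\<close> and t - h^2 is h^2, so t - h^2 satisfies
  \<open>pos\<close> by definition. Its root \<open>k\<close> commutes with \<open>h\<close>, and
  ||k^2|| \<le> ||h^2 + k^2|| = ||t 1||.\<close>

lemma norm_diff_square_le:
  fixes h :: "'a::unital_cstar_algebra"
  assumes h: "adj h = h" and t: "norm (h * h) \<le> t"
  shows "norm (t *\<^sub>R 1 - h * h) \<le> t"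
proof -
  have "norm (t *\<^sub>R 1 - (t *\<^sub>R 1 - h * h)) \<le> t" using t by simp
  then have "pos (t *\<^sub>R 1 - h * h)" unfolding pos_def by (intro conjI exI[of _ t]) (simp_all add: adj_diff adj_mult h)
  then obtain k where k: "adj k = k" "k * k = t *\<^sub>R 1 - h * h" "pos k"
    "\<And>c. c * (t *\<^sub>R 1 - h * h) = (t *\<^sub>R 1 - h * h) * c \<Longrightarrow> c * k = k * c" by (rule pos_sqrt_commute) blast
  have "h * k = k * h" by (rule k(4)) (simp add: algebra_simps)
  from norm_square_le_sum_squares[OF h k(1) this]
  have "norm (k * k) \<le> norm (t *\<^sub>R (1::'a))" by (simp add: k(2))
  moreover have "t \<ge> 0" using t norm_ge_zero order_trans by blast
  ultimately show ?thesis by (simp add: k(2))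
qed

lemma pos_square: "adj h = h \<Longrightarrow> pos (h * h)"
  unfolding pos_def using norm_diff_square_le[of h "norm (h * h)"] by (auto simp: adj_mult)

lemma pos_diff_scaleR_one:
  assumes "pos x" "norm x \<le> t"
  shows "pos (t *\<^sub>R 1 - x)"
  unfolding pos_def
proof (intro conjI exI[of _ t])
  show "adj (t *\<^sub>R 1 - x) = t *\<^sub>R 1 - x" using assms by (simp add: pos_def adj_diff)
  show "norm (t *\<^sub>R 1 - (t *\<^sub>R 1 - x)) \<le> t" using assms by simp
qed

text \<open>||y|| - x is the sum of the positive elements ||y|| - y and y - x. Its root
  \<open>k\<close> commutes with the root \<open>h\<close> of \<open>x\<close>, and h^2 + k^2 =
  ||y||.\<close>

lemma norm_mono_pos:
  assumes "pos x" "pos (y - x)"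
  shows "norm x \<le> norm y"
proof -
  have "pos y" using pos_add[OF assms] by simp
  from pos_add[OF pos_diff_scaleR_one[OF this order_refl] assms(2)]
  have "pos (norm y *\<^sub>R 1 - x)" by simp
  then obtain k where k: "adj k = k" "k * k = norm y *\<^sub>R 1 - x" "pos k"
     "\<And>c. c * (norm y *\<^sub>R 1 - x) = (norm y *\<^sub>R 1 - x) * c \<Longrightarrow> c * k = k * c"
    by (rule pos_sqrt_commute) blast
  obtain h where h: "adj h = h" "h * h = x" by (rule pos_sqrt[OF assms(1)]) blast
  have "h * k = k * h" by (rule k(4)) (simp add: algebra_simps flip: h(2))
  then have "k * h = h * k" by simp
  from norm_square_le_sum_squares[OF k(1) h(1) this] show ?thesis by (simp add: h k)
qed

lemma norm_le_norm_add_pos: "pos x \<Longrightarrow> pos y \<Longrightarrow> norm x \<le> norm (x + y)"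
  by (rule norm_mono_pos) auto

text \<open>Kaplansky's lemma: with \<open>p = -c\<^sup>*c\<close> and \<open>q = cc\<^sup>*\<close>, both positive, \<open>c (t + p) = (t - q) c\<close>.
  For \<open>t = \<parallel>p\<parallel> = \<parallel>q\<parallel>\<close> this gives \<open>\<parallel>p (t + p)\<parallel> \<le> t\<^sup>2\<close>, while \<open>2 p\<^sup>2 \<le> p (t + p)\<close>.\<close>

lemma eq_0_if_pos_minus_adj_mult:
  fixes c :: "'a::unital_cstar_algebra"
  assumes p: "pos (- (adj c * c))"
  shows "c = 0"
proof -
  define p where "p = - (adj c * c)"
  define q where "q = c * adj c"
  define t where "t = norm p"
  have pp: "pos p" using p by (simp add: p_def)
  \<comment> \<open>Real and imaginary part of \<open>c\<close>. The mixed terms cancel in a^2 +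
    b^2, so that \<open>q\<close> is 2 (a^2 + b^2) plus the positive element
    \<open>p\<close>.\<close>
  define a b where "a = (1/2) *\<^sub>R (c + adj c)" and "b = (\<i>/2) *\<^sub>C (adj c - c)"
  have sa: "adj a = a" "adj b = b"
    by (simp_all add: a_def b_def adj_add adj_adj adj_scaleC adj_diff add.commute scaleC_minus_left scaleC_diff)
  have aa: "a * a = (1/4) *\<^sub>R (c * c + c * adj c + adj c * c + adj c * adj c)"
    by (simp add: a_def algebra_simps)
  have bb: "b * b = (1/4) *\<^sub>R (- (c * c) + c * adj c + adj c * c - adj c * adj c)"
  proof -
    have "b * b = ((\<i>/2) * (\<i>/2)) *\<^sub>C ((adj c - c) * (adj c - c))"
      by (simp add: b_def scaleC_mult_left scaleC_mult_right scaleC_scaleC)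
    also have "(\<i>/2) * (\<i>/2) = complex_of_real (-1/4)" by simp
    finally show ?thesis unfolding scaleC_of_real by (simp add: algebra_simps)
  qed
  have "adj c * c + c * adj c = 2 *\<^sub>R (a * a + b * b)"
    unfolding aa bb by (simp add: algebra_simps flip: scaleR_add_left)
  then have "q = 2 *\<^sub>R (a * a + b * b) + p" by (simp add: p_def q_def algebra_simps)
  moreover have "pos (2 *\<^sub>R (a * a + b * b))" by (intro pos_scaleR pos_add pos_square sa) simp
  ultimately have pq: "pos q" using pp pos_add by metis
  have tn: "t = (norm c)\<^sup>2" "norm q = t"
    using cstar_identity[of c] cstar_identity[of "adj c"] by (simp_all add: t_def p_def q_def adj_adj)
  obtain g where g: "adj g = g" "g * g = q" by (rule pos_sqrt[OF pq]) blast
  have tq: "norm (t *\<^sub>R 1 - q) \<le> t" using norm_diff_square_le[OF g(1), of t] tn by (simp add: g)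
  have "p * (t *\<^sub>R 1 + p) = - (adj c * ((t *\<^sub>R 1 - q) * c))"
    by (simp add: p_def q_def algebra_simps)
  then have "norm (p * (t *\<^sub>R 1 + p)) \<le> norm (adj c) * norm ((t *\<^sub>R 1 - q) * c)"
    by (metis norm_minus_cancel norm_mult_ineq)
  also have "\<dots> \<le> norm (adj c) * (norm (t *\<^sub>R 1 - q) * norm c)"
    by (intro mult_left_mono norm_mult_ineq) simp
  also have "\<dots> \<le> norm (adj c) * (t * norm c)" using tq by (intro mult_left_mono mult_right_mono) auto
  also have "\<dots> = t * t" by (simp add: tn power2_eq_square)
  finally have up: "norm (p * (t *\<^sub>R 1 + p)) \<le> t * t" .
  obtain h where h: "adj h = h" "h * h = p" by (rule pos_sqrt[OF pp]) blast
  have sap: "adj p = p" by (simp add: p_def adj_mult adj_adj)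
  have "pos (t *\<^sub>R 1 - p)" using pos_diff_scaleR_one[OF pp] by (simp add: t_def)
  then obtain k where k: "adj k = k" "k * k = t *\<^sub>R 1 - p" "pos k"
     "\<And>c. c * (t *\<^sub>R 1 - p) = (t *\<^sub>R 1 - p) * c \<Longrightarrow> c * k = k * c" by (rule pos_sqrt_commute) blast
  have hk: "h * k = k * h" by (rule k(4)) (simp add: algebra_simps flip: h(2))
  \<comment> \<open>As \<open>h\<close> and \<open>k\<close> commute, (h k)^2 = p (t - p), which is
    p (t + p) - 2 p^2.\<close>
  have "pos ((h * k) * (h * k))" by (rule pos_square) (simp add: adj_mult h k hk)
  moreover have "(h * k) * (h * k) = p * (t *\<^sub>R 1 - p)"
    by (metis hk mult.assoc h(2) k(2))
  ultimately have "pos (p * (t *\<^sub>R 1 - p))" by simp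
  then have "pos (p * (t *\<^sub>R 1 + p) - 2 *\<^sub>R (p * p))" by (simp add: algebra_simps scaleR_2)
  moreover have "pos (2 *\<^sub>R (p * p))" by (intro pos_scaleR pos_square sap) simp
  ultimately have "norm (2 *\<^sub>R (p * p)) \<le> norm (p * (t *\<^sub>R 1 + p))" by (intro norm_mono_pos)
  with up have "2 * norm (p * p) \<le> t * t" by simp
  moreover have "norm (p * p) = t * t" using cstar_identity[of p] by (simp add: sap t_def power2_eq_square)
  ultimately have "t * t \<le> 0" by simp
  then have "t = 0" by (metis mult_le_0_iff order_antisym)
  then show ?thesis by (simp add: tn)
qed

text \<open>With \<open>m = |x| - x\<close> for \<open>x = a\<^sup>*a\<close> one has \<open>(a m)\<^sup>*(a m) = m x m = -|x| m\<^sup>2\<close>, hence \<open>a m = 0\<close>.\<close>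

lemma pos_adj_mult: "pos (adj a * (a::'a::unital_cstar_algebra))"
proof -
  define x where "x = adj a * a"
  have sx: "adj x = x" by (simp add: x_def adj_mult adj_adj)
  obtain y where y: "adj y = y" "y * y = x * x" "pos y"
    and yc: "\<And>c. c * (x * x) = x * x * c \<Longrightarrow> c * y = y * c"
    by (rule pos_sqrt_commute[OF pos_square[OF sx]]) blast
  have xy: "x * y = y * x" by (rule yc) (simp add: mult.assoc)
  obtain k where k: "adj k = k" "k * k = y" "pos k" and kc: "\<And>c. c * y = y * c \<Longrightarrow> c * k = k * c"
    by (rule pos_sqrt_commute[OF y(3)]) blast
  define m where "m = y - x"
  have sm: "adj m = m" by (simp add: m_def adj_diff y sx)
  have "m * y = y * m" by (simp add: m_def algebra_simps xy)
  then have mk: "m * k = k * m" by (rule kc)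
  have xm: "x * m = - (m * y)" by (simp add: m_def algebra_simps xy y(2))
  have "adj (a * m) * (a * m) = m * (x * m)" by (simp add: adj_mult sm x_def mult.assoc)
  also have "\<dots> = - ((m * k) * (m * k))"
    unfolding xm by (metis k(2) mk mult.assoc mult_minus_right)
  finally have "- (adj (a * m) * (a * m)) = (m * k) * (m * k)" by simp
  moreover have "pos ((m * k) * (m * k))" by (rule pos_square) (simp add: adj_mult sm k mk)
  ultimately have "a * m = 0" by (intro eq_0_if_pos_minus_adj_mult) simp
  then have x0: "x * m = 0" by (simp add: x_def mult.assoc)
  have "m * m = m * y - m * x" by (simp add: m_def algebra_simps)
  also have "m * x = x * m" by (simp add: m_def algebra_simps xy)
  finally have "m * m = 0" using x0 xm by simp
  with cstar_identity[of m] have "m = 0" by (simp add: sm)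
  then show ?thesis using y(3) by (simp add: m_def x_def)
qed

section \<open>The Hilbert module \<open>A\<^sup>n\<close> and the operator norm of matrices\<close>

definition vinner :: "'a::unital_cstar_algebra vec \<Rightarrow> 'a vec \<Rightarrow> 'a" where
  "vinner v w = (\<Sum>i<dim_vec w. adj (v $ i) * w $ i)"

lemma vinner_self_pos: "pos (vinner v v)"
  unfolding vinner_def by (intro pos_sum pos_adj_mult)

lemma adj_vinner: "dim_vec v = dim_vec w \<Longrightarrow> adj (vinner v w) = vinner w v"
  by (simp add: vinner_def adj_sum adj_mult adj_adj)

lemma module_norm_vinner: "module_norm v = sqrt (norm (vinner v v))"
  by (simp add: module_norm_def vinner_def)

lemma module_norm_nonneg [simp]: "0 \<le> module_norm v"
  by (simp add: module_norm_vinner)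

lemma module_norm_power2: "(module_norm v)\<^sup>2 = norm (vinner v v)"
  by (simp add: module_norm_vinner)

lemma norm_index_le_module_norm:
  assumes "i < dim_vec v"
  shows "norm (v $ i) \<le> module_norm v"
proof -
  have "vinner v v = adj (v $ i) * v $ i + (\<Sum>j\<in>{..<dim_vec v} - {i}. adj (v $ j) * v $ j)"
    using assms by (simp add: vinner_def sum.remove)
  moreover have "pos (adj (v $ i) * v $ i)" "pos (\<Sum>j\<in>{..<dim_vec v} - {i}. adj (v $ j) * v $ j)"
    by (intro pos_sum pos_adj_mult)+
  ultimately have "norm (adj (v $ i) * v $ i) \<le> norm (vinner v v)"
    using norm_le_norm_add_pos by metis
  then have "(norm (v $ i))\<^sup>2 \<le> (module_norm v)\<^sup>2" by (simp add: cstar_identity module_norm_power2)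
  then show ?thesis by (rule power2_le_imp_le) simp
qed

lemma module_norm_le_sum: "module_norm v \<le> (\<Sum>i<dim_vec v. norm (v $ i))"
proof (rule power2_le_imp_le)
  have "(module_norm v)\<^sup>2 \<le> (\<Sum>i<dim_vec v. norm (adj (v $ i) * v $ i))"
    unfolding module_norm_power2 vinner_def by (rule norm_sum)
  also have "\<dots> = (\<Sum>i<dim_vec v. norm (v $ i) * norm (v $ i))"
    by (simp add: cstar_identity power2_eq_square)
  also have "\<dots> \<le> (\<Sum>i<dim_vec v. norm (v $ i) * (\<Sum>j<dim_vec v. norm (v $ j)))"
    by (intro sum_mono mult_left_mono member_le_sum) auto
  finally show "(module_norm v)\<^sup>2 \<le> (\<Sum>i<dim_vec v. norm (v $ i))\<^sup>2"
    by (simp add: power2_eq_square sum_distrib_right)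
qed (simp add: sum_nonneg)

lemma module_norm_eq_0:
  assumes "module_norm v = 0"
  shows "v = 0\<^sub>v (dim_vec v)"
proof (rule eq_vecI)
  fix i assume "i < dim_vec (0\<^sub>v (dim_vec v))"
  then have i: "i < dim_vec v" by simp
  from norm_index_le_module_norm[OF this] assms i show "v $ i = 0\<^sub>v (dim_vec v) $ i" by simp
qed simp

lemma module_norm_zero [simp]: "module_norm (0\<^sub>v n) = 0"
  by (simp add: module_norm_def)

text \<open>With a root \<open>k\<close> of t - p the difference is
  \<open>adj (k * b) * (k * b)\<close>. This replaces the functional-calculus estimate p \<le> t
  inside a conjugation.\<close>

lemma pos_conj_diff:
  fixes p b :: "'a::unital_cstar_algebra"
  assumes "pos p" "norm p \<le> t"
  shows "pos (t *\<^sub>R (adj b * b) - adj b * p * b)"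
proof -
  obtain k where k: "adj k = k" "k * k = t *\<^sub>R 1 - p"
    by (rule pos_sqrt[OF pos_diff_scaleR_one[OF assms]]) blast
  have "adj (k * b) * (k * b) = adj b * (k * k) * b" by (simp add: adj_mult k(1) mult.assoc)
  also have "\<dots> = t *\<^sub>R (adj b * b) - adj b * p * b" by (simp add: k(2) algebra_simps)
  finally show ?thesis using pos_adj_mult[of "k * b"] by simp
qed

text \<open>Expand the positive element \<open>vinner u u\<close> for u = w - v b with b = x / c,
  where x is the inner product of \<open>v\<close> and \<open>w\<close> and c = ||v||^2. The factor
  \<open>vinner v v\<close> in the middle of the last term is not central;
  \<open>pos_conj_diff\<close> exchanges it for the scalar \<open>c\<close>.\<close>

lemma vinner_cauchy_schwarz:
  fixes v w :: "'a::unital_cstar_algebra vec"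
  assumes d: "dim_vec v = dim_vec w"
  shows "norm (vinner v w) \<le> module_norm v * module_norm w"
proof (cases "module_norm v = 0")
  case True
  then have "v = 0\<^sub>v (dim_vec w)" using module_norm_eq_0 d by metis
  then have "vinner v w = 0"
    by (simp add: vinner_def)
  with True show ?thesis by simp
next
  case False
  define c where "c = norm (vinner v v)"
  have c: "c > 0" using False by (auto simp: c_def module_norm_vinner)
  define x where "x = vinner v w"
  define b where "b = (1/c) *\<^sub>R x"
  define u where "u = vec (dim_vec w) (\<lambda>i. w $ i - v $ i * b)"
  have "vinner u u = (\<Sum>i<dim_vec w. adj (w $ i) * w $ i - adj (w $ i) * v $ i * b
      - adj b * (adj (v $ i) * w $ i) + adj b * (adj (v $ i) * v $ i) * b)"
    unfolding vinner_def u_def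
    by (auto intro!: sum.cong simp: adj_diff adj_mult algebra_simps)
  also have "\<dots> = vinner w w - vinner w v * b - adj b * x + adj b * vinner v v * b"
    by (simp add: vinner_def d x_def sum.distrib sum_subtractf sum_distrib_left sum_distrib_right)
  also have "vinner w v = adj x" by (simp add: x_def adj_vinner d)
  finally have "vinner u u = vinner w w - (2 / c) *\<^sub>R (adj x * x) + adj b * vinner v v * b"
    by (simp add: b_def algebra_simps flip: scaleR_add_left)
  moreover have "pos (c *\<^sub>R (adj b * b) - adj b * vinner v v * b)"
    by (rule pos_conj_diff[OF vinner_self_pos]) (simp add: c_def)
  ultimately have "pos (vinner w w - (2 / c) *\<^sub>R (adj x * x) + c *\<^sub>R (adj b * b))"
    using pos_add[OF vinner_self_pos[of u]] by force
  also have "c *\<^sub>R (adj b * b) = (1 / c) *\<^sub>R (adj x * x)" using c by (simp add: b_def)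
  also have "(2 / c) *\<^sub>R (adj x * x) = (1 / c) *\<^sub>R (adj x * x) + (1 / c) *\<^sub>R (adj x * x)"
    by (simp flip: scaleR_add_left)
  finally have "pos (vinner w w - (1 / c) *\<^sub>R (adj x * x))" by simp
  moreover have "pos ((1 / c) *\<^sub>R (adj x * x))" using c by (intro pos_scaleR pos_adj_mult) simp
  ultimately have "norm ((1 / c) *\<^sub>R (adj x * x)) \<le> norm (vinner w w)" by (intro norm_mono_pos)
  then have "(norm x)\<^sup>2 / c \<le> norm (vinner w w)" using c by (simp add: cstar_identity)
  then have "(norm x)\<^sup>2 \<le> c * norm (vinner w w)" using c by (simp add: field_simps)
  also have "\<dots> = (module_norm v * module_norm w)\<^sup>2"
    by (simp add: c_def module_norm_power2 power_mult_distrib)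
  finally show ?thesis unfolding x_def by (rule power2_le_imp_le) simp
qed

lemma module_norm_add_le:
  assumes d: "dim_vec v = dim_vec w"
  shows "module_norm (v + w) \<le> module_norm v + module_norm w"
proof (rule power2_le_imp_le)
  have "vinner (v + w) (v + w) = vinner v v + vinner v w + vinner w v + vinner w w"
    by (simp add: vinner_def d adj_add algebra_simps sum.distrib)
  then have "(module_norm (v + w))\<^sup>2 \<le> norm (vinner v v) + norm (vinner v w) + norm (vinner w v) + norm (vinner w w)"
    unfolding module_norm_power2 by (auto intro!: norm_triangle_mono)
  also have "\<dots> \<le> (module_norm v)\<^sup>2 + module_norm v * module_norm w + module_norm w * module_norm v + (module_norm w)\<^sup>2"
    using vinner_cauchy_schwarz[OF d] vinner_cauchy_schwarz[OF d[symmetric]]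
    unfolding module_norm_power2 by linarith
  finally show "(module_norm (v + w))\<^sup>2 \<le> (module_norm v + module_norm w)\<^sup>2"
    by (simp add: power2_eq_square algebra_simps)
qed simp

lemma module_norm_scaleR: "module_norm (map_vec ((*\<^sub>R) r) v) = \<bar>r\<bar> * module_norm v"
proof -
  have "vinner (map_vec ((*\<^sub>R) r) v) (map_vec ((*\<^sub>R) r) v) = (r * r) *\<^sub>R vinner v v"
    by (simp add: vinner_def scaleR_sum_right)
  then show ?thesis by (simp add: module_norm_vinner real_sqrt_mult)
qed

lemma module_norm_scaleC: "module_norm (map_vec (scaleC c) v) = cmod c * module_norm v"
proof -
  have "vinner (map_vec (scaleC c) v) (map_vec (scaleC c) v) = (c * cnj c) *\<^sub>C vinner v v"
    by (simp add: vinner_def scaleC_sum adj_scaleC scaleC_mult_left scaleC_mult_right scaleC_scaleC)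
  then show ?thesis by (simp add: module_norm_vinner norm_scaleC norm_mult real_sqrt_mult)
qed

lemma mult_mat_vec_scaleR:
  assumes "v \<in> carrier_vec (dim_col M)"
  shows "M *\<^sub>v map_vec ((*\<^sub>R) r) v = map_vec ((*\<^sub>R) r) (M *\<^sub>v (v :: 'a::unital_cstar_algebra vec))"
  using assms by (intro eq_vecI) (auto simp: scalar_prod_def scaleR_sum_right)

text \<open>A crude bound by the entries. It makes the supremum in \<open>mat_norm\<close> finite
  and lets entrywise convergence control the norm at a fixed size.\<close>

lemma module_norm_mult_mat_vec_le_sum:
  fixes M :: "'a::unital_cstar_algebra mat"
  assumes v: "v \<in> carrier_vec (dim_col M)"
  shows "module_norm (M *\<^sub>v v) \<le> (\<Sum>i<dim_row M. \<Sum>j<dim_col M. norm (M $$ (i,j))) * module_norm v"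
proof -
  have "module_norm (M *\<^sub>v v) \<le> (\<Sum>i<dim_row M. norm ((M *\<^sub>v v) $ i))"
    using module_norm_le_sum[of "M *\<^sub>v v"] by simp
  also have "\<dots> \<le> (\<Sum>i<dim_row M. \<Sum>j<dim_col M. norm (M $$ (i,j)) * module_norm v)"
  proof (rule sum_mono)
    fix i assume i: "i \<in> {..<dim_row M}"
    then have "(M *\<^sub>v v) $ i = (\<Sum>j<dim_col M. M $$ (i,j) * v $ j)"
      using v by (auto simp: scalar_prod_def lessThan_atLeast0)
    then have "norm ((M *\<^sub>v v) $ i) \<le> (\<Sum>j<dim_col M. norm (M $$ (i,j) * v $ j))" by (simp add: norm_sum)
    also have "\<dots> \<le> (\<Sum>j<dim_col M. norm (M $$ (i,j)) * module_norm v)"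
      using v norm_index_le_module_norm[of _ v]
      by (intro sum_mono order_trans[OF norm_mult_ineq] mult_left_mono) auto
    finally show "norm ((M *\<^sub>v v) $ i) \<le> (\<Sum>j<dim_col M. norm (M $$ (i,j)) * module_norm v)" .
  qed
  finally show ?thesis by (simp add: sum_distrib_right)
qed

lemma mat_norm_le:
  fixes M :: "'a::unital_cstar_algebra mat"
  assumes "\<And>v. v \<in> carrier_vec (dim_col M) \<Longrightarrow> module_norm (M *\<^sub>v v) \<le> K * module_norm v" "0 \<le> K"
  shows "mat_norm M \<le> K"
  unfolding mat_norm_def
proof (rule cSup_least)
  show "{module_norm (M *\<^sub>v v) |v. v \<in> carrier_vec (dim_col M) \<and> module_norm v \<le> 1} \<noteq> {}"
    using zero_carrier_vec[of "dim_col M"] module_norm_zero[of "dim_col M", where 'a='a]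
    by (metis (mono_tags, lifting) empty_iff mem_Collect_eq zero_le_one)
  fix x assume "x \<in> {module_norm (M *\<^sub>v v) |v. v \<in> carrier_vec (dim_col M) \<and> module_norm v \<le> 1}"
  then obtain v where v: "x = module_norm (M *\<^sub>v v)" "v \<in> carrier_vec (dim_col M)" "module_norm v \<le> 1" by auto
  have "x \<le> K * module_norm v" using assms(1)[OF v(2)] v by simp
  also have "\<dots> \<le> K * 1" using assms v by (intro mult_left_mono) auto
  finally show "x \<le> K" by simp
qed

lemma bdd_above_mat_norm:
  fixes M :: "'a::unital_cstar_algebra mat"
  shows "bdd_above {module_norm (M *\<^sub>v v) |v. v \<in> carrier_vec (dim_col M) \<and> module_norm v \<le> 1}"
proof -
  let ?K = "\<Sum>i<dim_row M. \<Sum>j<dim_col M. norm (M $$ (i,j))"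
  have "module_norm (M *\<^sub>v v) \<le> ?K" if v: "v \<in> carrier_vec (dim_col M)" "module_norm v \<le> 1" for v
  proof -
    have "module_norm (M *\<^sub>v v) \<le> ?K * module_norm v" by (rule module_norm_mult_mat_vec_le_sum[OF v(1)])
    also have "\<dots> \<le> ?K * 1" using v by (intro mult_left_mono sum_nonneg) auto
    finally show ?thesis by simp
  qed
  then show ?thesis by (intro bdd_aboveI[of _ ?K]) auto
qed

lemma module_norm_mult_mat_vec_le:
  fixes M :: "'a::unital_cstar_algebra mat"
  assumes v: "v \<in> carrier_vec (dim_col M)"
  shows "module_norm (M *\<^sub>v v) \<le> mat_norm M * module_norm v"
proof (cases "module_norm v = 0")
  case True
  with module_norm_mult_mat_vec_le_sum[OF v] show ?thesis by simp
next
  case False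
  let ?r = "1 / module_norm v"
  let ?u = "map_vec ((*\<^sub>R) ?r) v"
  have "module_norm ?u \<le> 1" using False by (simp add: module_norm_scaleR)
  moreover have "?u \<in> carrier_vec (dim_col M)" using v by simp
  ultimately have "module_norm (M *\<^sub>v ?u) \<le> mat_norm M"
    unfolding mat_norm_def by (intro cSup_upper bdd_above_mat_norm) blast
  then have "module_norm (M *\<^sub>v v) / module_norm v \<le> mat_norm M"
    by (simp add: mult_mat_vec_scaleR[OF v] module_norm_scaleR)
  moreover have "module_norm v > 0" using False module_norm_nonneg[of v] by linarith
  ultimately show ?thesis by (simp add: field_simps)
qed

lemma mat_norm_nonneg [simp]: "0 \<le> mat_norm M"
proof -
  have "module_norm (M *\<^sub>v 0\<^sub>v (dim_col M)) \<le> mat_norm M"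
    unfolding mat_norm_def
    by (intro cSup_upper bdd_above_mat_norm CollectI exI[of _ "0\<^sub>v (dim_col M)"]) simp
  then show ?thesis using module_norm_nonneg order_trans by blast
qed

lemma mat_norm_le_sum: "mat_norm M \<le> (\<Sum>i<dim_row M. \<Sum>j<dim_col M. norm (M $$ (i,j)))"
  by (intro mat_norm_le module_norm_mult_mat_vec_le_sum sum_nonneg) auto

lemma norm_index_le_mat_norm:
  fixes M :: "'a::unital_cstar_algebra mat"
  assumes "i < dim_row M" "j < dim_col M"
  shows "norm (M $$ (i,j)) \<le> mat_norm M"
proof -
  let ?u = "unit_vec (dim_col M) j :: 'a vec"
  have "vinner ?u ?u = (\<Sum>i<dim_col M. if i = j then 1 else 0)"
    unfolding vinner_def using assms by (intro sum.cong) auto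
  then have u1: "module_norm ?u = 1" using assms by (simp add: module_norm_vinner)
  have "M *\<^sub>v ?u = col M j" using assms by (intro eq_vecI) auto
  then have "norm (M $$ (i,j)) = norm ((M *\<^sub>v ?u) $ i)" using assms by simp
  also have "\<dots> \<le> module_norm (M *\<^sub>v ?u)" using assms by (intro norm_index_le_module_norm) simp
  also have "\<dots> \<le> mat_norm M" using module_norm_mult_mat_vec_le[of ?u M] u1 by simp
  finally show ?thesis .
qed

lemma mat_norm_zero [simp]: "mat_norm (0\<^sub>m n m :: 'a::unital_cstar_algebra mat) = 0"
  by (intro antisym order_trans[OF mat_norm_le_sum]) simp_all

lemma mat_norm_eq_0:
  fixes M :: "'a::unital_cstar_algebra mat"
  assumes "mat_norm M = 0"
  shows "M = 0\<^sub>m (dim_row M) (dim_col M)"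
proof (rule eq_matI)
  fix i j assume "i < dim_row (0\<^sub>m (dim_row M) (dim_col M))" "j < dim_col (0\<^sub>m (dim_row M) (dim_col M))"
  then show "M $$ (i,j) = 0\<^sub>m (dim_row M) (dim_col M) $$ (i,j)"
    using norm_index_le_mat_norm[of i M j] assms by simp
qed simp_all

lemma mat_norm_one:
  assumes "n \<ge> 1"
  shows "mat_norm (1\<^sub>m n :: 'a::unital_cstar_algebra mat) = 1"
proof (rule antisym)
  show "mat_norm (1\<^sub>m n :: 'a mat) \<le> 1" by (rule mat_norm_le) simp_all
  show "1 \<le> mat_norm (1\<^sub>m n :: 'a mat)"
    using norm_index_le_mat_norm[of 0 "1\<^sub>m n :: 'a mat" 0] assms by simp
qed

lemma mat_norm_add:
  fixes M N :: "'a::unital_cstar_algebra mat"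
  assumes "M \<in> carrier_mat n m" "N \<in> carrier_mat n m"
  shows "mat_norm (M + N) \<le> mat_norm M + mat_norm N"
proof (rule mat_norm_le)
  fix v :: "'a vec" assume "v \<in> carrier_vec (dim_col (M + N))"
  with assms have v: "v \<in> carrier_vec m" "v \<in> carrier_vec (dim_col M)" "v \<in> carrier_vec (dim_col N)" by auto
  have "module_norm ((M + N) *\<^sub>v v) = module_norm (M *\<^sub>v v + N *\<^sub>v v)"
    using add_mult_distrib_mat_vec[OF assms v(1)] by simp
  also have "\<dots> \<le> module_norm (M *\<^sub>v v) + module_norm (N *\<^sub>v v)"
    using assms by (intro module_norm_add_le) auto
  also have "\<dots> \<le> mat_norm M * module_norm v + mat_norm N * module_norm v"
    using v by (intro add_mono module_norm_mult_mat_vec_le) auto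
  finally show "module_norm ((M + N) *\<^sub>v v) \<le> (mat_norm M + mat_norm N) * module_norm v"
    by (simp add: algebra_simps)
qed simp

lemma mat_norm_mult:
  fixes M N :: "'a::unital_cstar_algebra mat"
  assumes "M \<in> carrier_mat n m" "N \<in> carrier_mat m l"
  shows "mat_norm (M * N) \<le> mat_norm M * mat_norm N"
proof (rule mat_norm_le)
  fix v :: "'a vec" assume "v \<in> carrier_vec (dim_col (M * N))"
  with assms have v: "v \<in> carrier_vec l" by auto
  have dims: "dim_row N = dim_col M" "v \<in> carrier_vec (dim_col N)" using assms v by simp_all
  have Nv: "N *\<^sub>v v \<in> carrier_vec (dim_col M)" by (rule carrier_vecI) (simp add: dims)
  have "module_norm ((M * N) *\<^sub>v v) = module_norm (M *\<^sub>v (N *\<^sub>v v))"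
    using assoc_mult_mat_vec[OF assms v] by simp
  also have "\<dots> \<le> mat_norm M * module_norm (N *\<^sub>v v)"
    by (rule module_norm_mult_mat_vec_le[OF Nv])
  also have "\<dots> \<le> mat_norm M * (mat_norm N * module_norm v)"
    by (intro mult_left_mono module_norm_mult_mat_vec_le dims) simp
  finally show "module_norm ((M * N) *\<^sub>v v) \<le> mat_norm M * mat_norm N * module_norm v" by simp
qed simp

lemma mat_norm_map_scaleC_le:
  "mat_norm (map_mat (scaleC c) M) \<le> cmod c * mat_norm (M :: 'a::unital_cstar_algebra mat)"
proof (rule mat_norm_le)
  fix v :: "'a vec" assume "v \<in> carrier_vec (dim_col (map_mat (scaleC c) M))"
  then have v: "v \<in> carrier_vec (dim_col M)" by simp
  have "map_mat (scaleC c) M *\<^sub>v v = map_vec (scaleC c) (M *\<^sub>v v)"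
    using v by (intro eq_vecI) (auto simp: scalar_prod_def scaleC_sum scaleC_mult_left)
  then show "module_norm (map_mat (scaleC c) M *\<^sub>v v) \<le> cmod c * mat_norm M * module_norm v"
    using module_norm_mult_mat_vec_le[OF v] by (simp add: module_norm_scaleC mult.assoc mult_left_mono)
qed simp

lemma map_mat_scaleC_of_real: "map_mat (scaleC (complex_of_real r)) M = map_mat ((*\<^sub>R) r) (M :: 'a::unital_cstar_algebra mat)"
  by (intro eq_matI) (auto simp: scaleC_of_real)

lemma mat_norm_map_scaleR: "mat_norm (map_mat ((*\<^sub>R) r) M) = \<bar>r\<bar> * mat_norm (M :: 'a::unital_cstar_algebra mat)"
proof (rule antisym)
  have le: "mat_norm (map_mat ((*\<^sub>R) r) M) \<le> \<bar>r\<bar> * mat_norm M" for r and M :: "'a mat"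
    using mat_norm_map_scaleC_le[of "complex_of_real r" M] by (simp add: map_mat_scaleC_of_real)
  then show "mat_norm (map_mat ((*\<^sub>R) r) M) \<le> \<bar>r\<bar> * mat_norm M" .
  show "\<bar>r\<bar> * mat_norm M \<le> mat_norm (map_mat ((*\<^sub>R) r) M)"
  proof (cases "r = 0")
    case False
    have "map_mat ((*\<^sub>R) (1/r)) (map_mat ((*\<^sub>R) r) M) = M" using False by (intro eq_matI) auto
    with le[of "1/r" "map_mat ((*\<^sub>R) r) M"] have "mat_norm M \<le> \<bar>1/r\<bar> * mat_norm (map_mat ((*\<^sub>R) r) M)" by simp
    then show ?thesis using False by (simp add: field_simps)
  qed simp
qed

lemma mat_norm_uminus: "mat_norm (- M) = mat_norm (M :: 'a::unital_cstar_algebra mat)"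
proof -
  have "- M = map_mat ((*\<^sub>R) (-1)) M" by (intro eq_matI) auto
  then show ?thesis using mat_norm_map_scaleR[of "-1" M] by simp
qed

section \<open>Adjoint matrices and diagonal amplifications\<close>

lemma mat_adj_dim [simp]: "dim_row (mat_adj M) = dim_col M" "dim_col (mat_adj M) = dim_row M"
  by (simp_all add: mat_adj_def)

lemma mat_adj_carrier: "M \<in> carrier_mat n m \<Longrightarrow> mat_adj M \<in> carrier_mat m n"
  by (auto simp: mat_adj_def)

lemma mat_adj_index [simp]: "i < dim_col M \<Longrightarrow> j < dim_row M \<Longrightarrow> mat_adj M $$ (i,j) = adj (M $$ (j,i))"
  by (simp add: mat_adj_def)

lemma mat_adj_mat_adj [simp]: "mat_adj (mat_adj M) = M"
  by (intro eq_matI) (auto simp: adj_adj)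

lemma vinner_mat_adj:
  fixes M :: "'a::unital_cstar_algebra mat"
  assumes "v \<in> carrier_vec (dim_row M)" "w \<in> carrier_vec (dim_col M)"
  shows "vinner v (M *\<^sub>v w) = vinner (mat_adj M *\<^sub>v v) w"
proof -
  have dv: "dim_vec v = dim_row M" "dim_vec w = dim_col M" using assms by auto
  have "vinner v (M *\<^sub>v w) = (\<Sum>i<dim_row M. \<Sum>j<dim_col M. adj (v $ i) * M $$ (i,j) * w $ j)"
    by (simp add: vinner_def scalar_prod_def lessThan_atLeast0 sum_distrib_left mult.assoc dv)
  also have "\<dots> = (\<Sum>j<dim_col M. \<Sum>i<dim_row M. adj (v $ i) * M $$ (i,j) * w $ j)"
    by (rule sum.swap)
  also have "\<dots> = (\<Sum>j<dim_col M. adj ((mat_adj M *\<^sub>v v) $ j) * w $ j)"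
  proof (rule sum.cong)
    fix j assume j: "j \<in> {..<dim_col M}"
    have "(mat_adj M *\<^sub>v v) $ j = (\<Sum>i<dim_row M. adj (M $$ (i,j)) * v $ i)"
      using j by (simp add: scalar_prod_def lessThan_atLeast0 dv)
    then show "(\<Sum>i<dim_row M. adj (v $ i) * M $$ (i,j) * w $ j) = adj ((mat_adj M *\<^sub>v v) $ j) * w $ j"
      by (simp add: adj_sum adj_mult adj_adj sum_distrib_right)
  qed simp
  also have "\<dots> = vinner (mat_adj M *\<^sub>v v) w"
    by (simp add: vinner_def dv)
  finally show ?thesis .
qed

lemma mat_norm_mat_adj_le: "mat_norm (mat_adj M) \<le> mat_norm (M :: 'a::unital_cstar_algebra mat)"
proof (rule mat_norm_le)
  fix v :: "'a vec" assume "v \<in> carrier_vec (dim_col (mat_adj M))"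
  then have v: "v \<in> carrier_vec (dim_row M)" by simp
  let ?w = "mat_adj M *\<^sub>v v"
  have w: "?w \<in> carrier_vec (dim_col M)" by (rule carrier_vecI) simp
  have "(module_norm ?w)\<^sup>2 = norm (vinner v (M *\<^sub>v ?w))"
    unfolding vinner_mat_adj[OF v w] by (rule module_norm_power2)
  also have "\<dots> \<le> module_norm v * module_norm (M *\<^sub>v ?w)"
    using v by (intro vinner_cauchy_schwarz) simp
  also have "\<dots> \<le> module_norm v * (mat_norm M * module_norm ?w)"
    by (intro mult_left_mono module_norm_mult_mat_vec_le w) simp
  finally have *: "module_norm ?w * module_norm ?w \<le> (mat_norm M * module_norm v) * module_norm ?w"
    by (simp add: power2_eq_square mult_ac)
  show "module_norm ?w \<le> mat_norm M * module_norm v"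
  proof (cases "module_norm ?w = 0")
    case False
    then have "module_norm ?w > 0" using module_norm_nonneg[of ?w] by linarith
    with * show ?thesis by simp
  qed simp
qed simp

text \<open>The bound by entries would grow with \<open>n\<close>. Instead
  \<open>pos_conj_diff\<close> is applied in each coordinate, with p = \<open>adj a * a\<close> of
  norm ||a||^2, and the resulting positive elements are summed.\<close>

lemma mat_norm_amplify_le: "mat_norm (amplify n a) \<le> norm (a :: 'a::unital_cstar_algebra)"
proof (rule mat_norm_le)
  fix v :: "'a vec" assume "v \<in> carrier_vec (dim_col (amplify n a))"
  then have v: "dim_vec v = n" by (auto simp: amplify_def)
  have av: "(amplify n a *\<^sub>v v) $ i = a * v $ i" if "i < n" for i
  proof -
    have "(amplify n a *\<^sub>v v) $ i = (\<Sum>j=0..<n. a * (if j = i then 1 else 0) * v $ j)"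
      using that v by (simp add: amplify_def scalar_prod_def)
    also have "\<dots> = (\<Sum>j=0..<n. if j = i then a * v $ j else 0)" by (intro sum.cong) auto
    also have "\<dots> = a * v $ i" using that by simp
    finally show ?thesis .
  qed
  have d: "dim_vec (amplify n a *\<^sub>v v) = n" by (simp add: amplify_def)
  have 1: "vinner (amplify n a *\<^sub>v v) (amplify n a *\<^sub>v v) = (\<Sum>i<n. adj (v $ i) * (adj a * a) * v $ i)"
    unfolding vinner_def d by (intro sum.cong) (auto simp: av adj_mult mult.assoc)
  have "pos (\<Sum>i<n. (norm a)\<^sup>2 *\<^sub>R (adj (v $ i) * v $ i) - adj (v $ i) * (adj a * a) * v $ i)"
    by (intro pos_sum pos_conj_diff pos_adj_mult) (simp add: cstar_identity)
  then have "pos ((norm a)\<^sup>2 *\<^sub>R vinner v v - vinner (amplify n a *\<^sub>v v) (amplify n a *\<^sub>v v))"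
    unfolding 1 by (simp add: vinner_def v sum_subtractf scaleR_sum_right)
  from norm_mono_pos[OF vinner_self_pos this]
  have "(module_norm (amplify n a *\<^sub>v v))\<^sup>2 \<le> (norm a * module_norm v)\<^sup>2"
    by (simp add: module_norm_power2 power_mult_distrib)
  then show "module_norm (amplify n a *\<^sub>v v) \<le> norm a * module_norm v"
    by (rule power2_le_imp_le) simp
qed simp

section \<open>Completely positive maps and conditional expectations\<close>

lemma mats_iff:
  "M \<in> mats C n \<longleftrightarrow> M \<in> carrier_mat n n \<and> (\<forall>i<n. \<forall>j<n. M $$ (i,j) \<in> C)"
  by (auto simp: mats_def)

lemma mats_carrier: "M \<in> mats C n \<Longrightarrow> M \<in> carrier_mat n n"
  by (simp add: mats_def)

lemma mats_index: "M \<in> mats C n \<Longrightarrow> i < n \<Longrightarrow> j < n \<Longrightarrow> M $$ (i,j) \<in> C"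
  by (simp add: mats_iff)

context
  fixes C :: "'a::unital_cstar_algebra set"
  assumes C: "unital_star_subalgebra C"
begin

lemma star_subalgebra_one: "1 \<in> C"
  and star_subalgebra_add: "x \<in> C \<Longrightarrow> y \<in> C \<Longrightarrow> x + y \<in> C"
  and star_subalgebra_mult: "x \<in> C \<Longrightarrow> y \<in> C \<Longrightarrow> x * y \<in> C"
  and star_subalgebra_scaleC: "x \<in> C \<Longrightarrow> c *\<^sub>C x \<in> C"
  and star_subalgebra_adj: "x \<in> C \<Longrightarrow> adj x \<in> C"
  using C by (auto simp: unital_star_subalgebra_def)

lemma star_subalgebra_scaleR: "x \<in> C \<Longrightarrow> r *\<^sub>R x \<in> C"
  using star_subalgebra_scaleC[of x "complex_of_real r"] by (simp add: scaleC_of_real)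

lemma star_subalgebra_zero: "0 \<in> C"
  using star_subalgebra_scaleR[OF star_subalgebra_one, of 0] by simp

lemma star_subalgebra_diff: "x \<in> C \<Longrightarrow> y \<in> C \<Longrightarrow> x - y \<in> C"
  using star_subalgebra_add[of x "(-1) *\<^sub>R y"] star_subalgebra_scaleR[of y "-1"] by simp

lemma star_subalgebra_sum: "(\<And>i. i \<in> I \<Longrightarrow> f i \<in> C) \<Longrightarrow> sum f I \<in> C"
  by (induction I rule: infinite_finite_induct) (auto intro: star_subalgebra_add star_subalgebra_zero)

lemma mats_zero: "0\<^sub>m n n \<in> mats C n"
  by (auto simp: mats_iff star_subalgebra_zero)

lemma mats_one: "1\<^sub>m n \<in> mats C n"
  by (auto simp: mats_iff star_subalgebra_zero star_subalgebra_one)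

lemma mats_add: "M \<in> mats C n \<Longrightarrow> N \<in> mats C n \<Longrightarrow> M + N \<in> mats C n"
  by (auto simp: mats_iff star_subalgebra_add)

lemma mats_diff: "M \<in> mats C n \<Longrightarrow> N \<in> mats C n \<Longrightarrow> M - N \<in> mats C n"
  by (auto simp: mats_iff star_subalgebra_diff)

lemma mats_mult:
  assumes "M \<in> mats C n" "N \<in> mats C n"
  shows "M * N \<in> mats C n"
  unfolding mats_iff
proof (intro conjI allI impI)
  note c = mats_carrier[OF assms(1)] mats_carrier[OF assms(2)]
  show "M * N \<in> carrier_mat n n" using c by simp
  fix i j assume "i < n" "j < n"
  then show "(M * N) $$ (i,j) \<in> C"
    using c by (auto simp: scalar_prod_def intro!: star_subalgebra_sum star_subalgebra_mult
        mats_index[OF assms(1)] mats_index[OF assms(2)])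
qed

lemma mats_scaleC: "M \<in> mats C n \<Longrightarrow> map_mat (scaleC c) M \<in> mats C n"
  by (auto simp: mats_iff star_subalgebra_scaleC)

lemma mats_scaleR: "M \<in> mats C n \<Longrightarrow> map_mat ((*\<^sub>R) r) M \<in> mats C n"
  by (auto simp: mats_iff star_subalgebra_scaleR)

lemma mats_adj: "M \<in> mats C n \<Longrightarrow> mat_adj M \<in> mats C n"
  by (auto simp: mats_iff star_subalgebra_adj mat_adj_def)

end

lemma mats_map: "M \<in> mats C n \<Longrightarrow> (\<And>x. x \<in> C \<Longrightarrow> \<phi> x \<in> D) \<Longrightarrow> map_mat \<phi> M \<in> mats D n"
  by (auto simp: mats_iff)

text \<open>Put \<open>p\<close> and \<open>q\<close> into the first block row of a matrix
  \<open>N\<close> of size 2n. The image of \<open>mat_adj N * N\<close> has the four blocks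
  \<open>a\<close>, \<open>b\<close>, \<open>c\<close>, \<open>d\<close> and is again of the form
  \<open>mat_adj M * M\<close>, so it defines an inner product to which the Cauchy-Schwarz
  inequality applies.\<close>

lemma completely_positive_schwarz:
  fixes C :: "'a::unital_cstar_algebra set"
  assumes C: "unital_star_subalgebra C" and \<phi>: "completely_positive C D \<phi>"
    and p: "p \<in> mats C n" and q: "q \<in> mats C n" and n: "n \<ge> 1"
  shows "(mat_norm (map_mat \<phi> (mat_adj p * q)))\<^sup>2
    \<le> mat_norm (map_mat \<phi> (mat_adj p * p)) * mat_norm (map_mat \<phi> (mat_adj q * q))"
proof -
  note pc = mats_carrier[OF p] and qc = mats_carrier[OF q]
  note pa = mat_adj_carrier[OF pc] and qa = mat_adj_carrier[OF qc]
  have z: "0\<^sub>m n n \<in> carrier_mat n n" by simp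
  define N where "N = four_block_mat p q (0\<^sub>m n n) (0\<^sub>m n n)"
  have N: "N \<in> mats C (n + n)"
    using p q pc qc by (auto simp: N_def mats_iff star_subalgebra_zero[OF C])
  have aN: "mat_adj N = four_block_mat (mat_adj p) (0\<^sub>m n n) (mat_adj q) (0\<^sub>m n n)"
    unfolding N_def using pc qc by (intro eq_matI) auto
  have NN: "mat_adj N * N = four_block_mat (mat_adj p * p) (mat_adj p * q) (mat_adj q * p) (mat_adj q * q)"
    unfolding aN unfolding N_def
    by (subst mult_four_block_mat[OF pa z qa z pc qc z z]) (use pa qa pc qc in simp)
  define a b c d where "a = map_mat \<phi> (mat_adj p * p)" and "b = map_mat \<phi> (mat_adj p * q)"
    and "c = map_mat \<phi> (mat_adj q * p)" and "d = map_mat \<phi> (mat_adj q * q)"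
  have cs: "a \<in> carrier_mat n n" "b \<in> carrier_mat n n" "c \<in> carrier_mat n n" "d \<in> carrier_mat n n"
    unfolding a_def b_def c_def d_def using pa qa pc qc by simp_all
  have "positive_mat C (n + n) (mat_adj N * N)" using N by (auto simp: positive_mat_def)
  then have "positive_mat D (n + n) (map_mat \<phi> (mat_adj N * N))"
    using \<phi> n by (auto simp: completely_positive_def)
  moreover have "map_mat \<phi> (mat_adj N * N) = four_block_mat a b c d"
    unfolding NN a_def b_def c_def d_def
    by (rule map_four_block_mat[of _ n n _ n _ n]) (use pa qa pc qc in auto)
  ultimately obtain M where M: "M \<in> carrier_mat (n + n) (n + n)" and MM: "four_block_mat a b c d = mat_adj M * M"
    by (auto simp: positive_mat_def mats_def)
  note Ma = mat_adj_carrier[OF M]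
  have inner: "vinner x (four_block_mat a b c d *\<^sub>v y) = vinner (M *\<^sub>v x) (M *\<^sub>v y)"
    if x: "x \<in> carrier_vec (n + n)" and y: "y \<in> carrier_vec (n + n)" for x y
  proof -
    have My: "M *\<^sub>v y \<in> carrier_vec (dim_col (mat_adj M))" by (rule carrier_vecI) simp
    have x': "x \<in> carrier_vec (dim_row (mat_adj M))" using x M by simp
    have "four_block_mat a b c d *\<^sub>v y = mat_adj M *\<^sub>v (M *\<^sub>v y)"
      unfolding MM by (rule assoc_mult_mat_vec[OF Ma M y])
    then show ?thesis using vinner_mat_adj[OF x' My] by simp
  qed
  let ?z = "0\<^sub>v n :: 'a vec"
  have zc: "?z \<in> carrier_vec n" by simp
  have vapp: "vinner (x @\<^sub>v x') (y @\<^sub>v y') = vinner x y + vinner x' y'"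
    if "x \<in> carrier_vec n" "x' \<in> carrier_vec n" "y \<in> carrier_vec n" "y' \<in> carrier_vec n" for x x' y y' :: "'a vec"
  proof -
    have eq: "vinner v w = map_vec adj v \<bullet> w" if "dim_vec v = dim_vec w" for v w :: "'a vec"
      using that by (simp add: vinner_def scalar_prod_def lessThan_atLeast0)
    have dims: "dim_vec x = n" "dim_vec x' = n" "dim_vec y = n" "dim_vec y' = n" using that by auto
    have "map_vec adj (x @\<^sub>v x') = map_vec adj x @\<^sub>v map_vec adj x'"
      by (intro eq_vecI) (auto simp: dims)
    then show ?thesis using that
      by (simp add: eq dims scalar_prod_append[of _ n _ n])
  qed
  have v0: "vinner v ?z = 0" "vinner ?z v = 0" if "v \<in> carrier_vec n" for v
    using that by (simp_all add: vinner_def)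
  have cv: "A *\<^sub>v v \<in> carrier_vec n" if "A \<in> carrier_mat n n" for A and v :: "'a vec"
    using that by (intro carrier_vecI) simp
  have Az: "A *\<^sub>v ?z = ?z" if "A \<in> carrier_mat n n" for A
    using that by (intro eq_vecI) (auto simp: scalar_prod_def)
  have fb: "four_block_mat a b c d *\<^sub>v (u @\<^sub>v v) = (a *\<^sub>v u + b *\<^sub>v v) @\<^sub>v (c *\<^sub>v u + d *\<^sub>v v)"
    if "u \<in> carrier_vec n" "v \<in> carrier_vec n" for u v
    by (rule four_block_mat_mult_vec[OF cs that])
  have ub: "module_norm (M *\<^sub>v x) \<le> sqrt (mat_norm A) * module_norm v"
    if v: "v \<in> carrier_vec n" and A: "A \<in> carrier_mat n n" and x: "x \<in> carrier_vec (n + n)"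
      and e: "vinner x (four_block_mat a b c d *\<^sub>v x) = vinner v (A *\<^sub>v v)" for v A x
  proof (rule power2_le_imp_le)
    have "(module_norm (M *\<^sub>v x))\<^sup>2 = norm (vinner v (A *\<^sub>v v))"
      unfolding module_norm_power2 e[symmetric] inner[OF x x] ..
    also have "\<dots> \<le> module_norm v * module_norm (A *\<^sub>v v)"
      using v A by (intro vinner_cauchy_schwarz) simp
    also have "\<dots> \<le> module_norm v * (mat_norm A * module_norm v)"
      using v A by (intro mult_left_mono module_norm_mult_mat_vec_le) simp_all
    finally show "(module_norm (M *\<^sub>v x))\<^sup>2 \<le> (sqrt (mat_norm A) * module_norm v)\<^sup>2"
      by (simp add: power_mult_distrib power2_eq_square mult_ac)
  qed simp
  have "mat_norm b \<le> sqrt (mat_norm a) * sqrt (mat_norm d)"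
  proof (rule mat_norm_le)
    fix v :: "'a vec" assume "v \<in> carrier_vec (dim_col b)"
    with cs have v: "v \<in> carrier_vec n" by simp
    \<comment> \<open>Testing against \<open>u\<close> itself turns the off-diagonal block into
      ||u||^2, the inner product of the images under \<open>M\<close> of (u, 0) and (0, v); one
      factor ||u|| is then cancelled.\<close>
    define u where "u = b *\<^sub>v v"
    have u: "u \<in> carrier_vec n" unfolding u_def by (rule cv[OF cs(2)])
    have uz: "u @\<^sub>v ?z \<in> carrier_vec (n + n)" "?z @\<^sub>v v \<in> carrier_vec (n + n)" using u v by simp_all
    have fv: "four_block_mat a b c d *\<^sub>v (?z @\<^sub>v v) = b *\<^sub>v v @\<^sub>v d *\<^sub>v v"
      using fb[OF zc v] cs v cv by (simp add: Az)
    have fu: "four_block_mat a b c d *\<^sub>v (u @\<^sub>v ?z) = a *\<^sub>v u @\<^sub>v c *\<^sub>v u"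
      using fb[OF u zc] cs u cv by (simp add: Az)
    have "(module_norm u)\<^sup>2 = norm (vinner (u @\<^sub>v ?z) (four_block_mat a b c d *\<^sub>v (?z @\<^sub>v v)))"
      unfolding fv module_norm_power2 using u v cs cv by (simp add: vapp v0 u_def)
    also have "\<dots> \<le> module_norm (M *\<^sub>v (u @\<^sub>v ?z)) * module_norm (M *\<^sub>v (?z @\<^sub>v v))"
      unfolding inner[OF uz] by (rule vinner_cauchy_schwarz) simp
    also have "\<dots> \<le> (sqrt (mat_norm a) * module_norm u) * (sqrt (mat_norm d) * module_norm v)"
    proof (rule mult_mono)
      show "module_norm (M *\<^sub>v (u @\<^sub>v ?z)) \<le> sqrt (mat_norm a) * module_norm u"
        by (rule ub[OF u cs(1) uz(1)]) (unfold fu, use u cs cv in \<open>simp add: vapp v0\<close>)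
      show "module_norm (M *\<^sub>v (?z @\<^sub>v v)) \<le> sqrt (mat_norm d) * module_norm v"
        by (rule ub[OF v cs(4) uz(2)]) (unfold fv, use v cs cv in \<open>simp add: vapp v0\<close>)
    qed simp_all
    finally have *: "module_norm u * module_norm u \<le> (sqrt (mat_norm a) * sqrt (mat_norm d) * module_norm v) * module_norm u"
      by (simp add: power2_eq_square mult_ac)
    show "module_norm (b *\<^sub>v v) \<le> sqrt (mat_norm a) * sqrt (mat_norm d) * module_norm v"
    proof (cases "module_norm u = 0")
      case False
      then have "module_norm u > 0" using module_norm_nonneg[of u] by linarith
      with * show ?thesis by (simp add: u_def)
    qed (simp add: u_def)
  qed simp
  then have "(mat_norm b)\<^sup>2 \<le> (sqrt (mat_norm a) * sqrt (mat_norm d))\<^sup>2"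
    by (rule power_mono) simp
  then show ?thesis by (simp add: power_mult_distrib a_def b_def d_def)
qed

lemma completely_positive_pos_adj_mult:
  fixes C :: "'a::unital_cstar_algebra set"
  assumes \<phi>: "completely_positive C D \<phi>" and h: "h \<in> C"
  shows "pos (\<phi> (adj h * h))"
proof -
  have "mat 1 1 (\<lambda>_. h) \<in> mats C 1" using h by (simp add: mats_iff)
  moreover have "mat_adj (mat 1 1 (\<lambda>_. h)) * mat 1 1 (\<lambda>_. h) = mat 1 1 (\<lambda>_. adj h * h)"
    by (intro eq_matI) (auto simp: scalar_prod_def)
  ultimately have "positive_mat C 1 (mat 1 1 (\<lambda>_. adj h * h))" by (metis positive_mat_def)
  then have "positive_mat D 1 (map_mat \<phi> (mat 1 1 (\<lambda>_. adj h * h)))"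
    using \<phi> by (auto simp: completely_positive_def)
  then obtain M where M: "M \<in> carrier_mat 1 1" "map_mat \<phi> (mat 1 1 (\<lambda>_. adj h * h)) = mat_adj M * M"
    by (auto simp: positive_mat_def mats_def)
  have "\<phi> (adj h * h) = map_mat \<phi> (mat 1 1 (\<lambda>_. adj h * h)) $$ (0,0)" by simp
  also have "\<dots> = adj (M $$ (0,0)) * M $$ (0,0)" unfolding M(2) using M(1) by (simp add: scalar_prod_def)
  finally show ?thesis by (simp add: pos_adj_mult)
qed

text \<open>For self-adjoint \<open>y\<close> both ||y|| + y and ||y|| - y are positive and their
  images add up to 2 ||y|| \<phi>(1), which yields the constant 3; real and imaginary parts double
  it. The value is far from sharp: its purpose is finiteness of a supremum that the Schwarz
  inequality then improves.\<close>

lemma completely_positive_bounded: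
  fixes C :: "'a::unital_cstar_algebra set"
  assumes C: "unital_cstar_subalgebra C" and \<phi>: "completely_positive C D \<phi>" and x: "x \<in> C"
  shows "norm (\<phi> x) \<le> 6 * norm (\<phi> 1) * norm x"
proof -
  have CS: "unital_star_subalgebra C" and cl: "closed C" using C by (auto simp: unital_cstar_subalgebra_def)
  have lin: "\<phi> (a + b) = \<phi> a + \<phi> b" if "a \<in> C" "b \<in> C" for a b
    using \<phi> that by (auto simp: completely_positive_def linear_map_on_def)
  have linC: "\<phi> (c *\<^sub>C a) = c *\<^sub>C \<phi> a" if "a \<in> C" for a c
    using \<phi> that by (auto simp: completely_positive_def linear_map_on_def)
  have linR: "\<phi> (r *\<^sub>R a) = r *\<^sub>R \<phi> a" if "a \<in> C" for a r
    using linC[OF that, of "complex_of_real r"] by (simp add: scaleC_of_real)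
  note cc = star_subalgebra_one[OF CS] star_subalgebra_add[OF CS] star_subalgebra_mult[OF CS]
    star_subalgebra_scaleC[OF CS] star_subalgebra_scaleR[OF CS] star_subalgebra_adj[OF CS] star_subalgebra_diff[OF CS]
  \<comment> \<open>Complete positivity concerns squares of elements of \<open>C\<close>, so the
    root of \<open>y\<close> must lie in \<open>C\<close>. Here closedness of \<open>C\<close>
    enters, through the last clause of \<open>pos_sqrt\<close>.\<close>
  have posC: "pos (\<phi> y)" if y: "y \<in> C" "pos y" for y
  proof -
    obtain h where h: "adj h = h" "h * h = y" and
     hS: "\<And>S. closed S \<Longrightarrow> 1 \<in> S \<Longrightarrow> y \<in> S \<Longrightarrow> (\<And>a b. a \<in> S \<Longrightarrow> b \<in> S \<Longrightarrow> a + b \<in> S \<and> a * b \<in> S) \<Longrightarrow>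
       (\<And>a r. a \<in> S \<Longrightarrow> r *\<^sub>R a \<in> S) \<Longrightarrow> h \<in> S"
      by (rule pos_sqrt[OF y(2)]) blast
    have "h \<in> C" by (rule hS) (use cl cc y in auto)
    from completely_positive_pos_adj_mult[OF \<phi> this] show ?thesis by (simp add: h)
  qed
  have sa: "norm (\<phi> y) \<le> 3 * norm (\<phi> 1) * norm y" if y: "y \<in> C" "adj y = y" for y
  proof (cases "y = 0")
    case True
    with linR[OF y(1), of 0] show ?thesis by simp
  next
    case False
    let ?t = "norm y"
    have t: "?t > 0" using False by simp
    have "pos (?t *\<^sub>R 1 + y)" "pos (?t *\<^sub>R 1 - y)"
      unfolding pos_def by (intro conjI exI[of _ ?t]; simp add: adj_add adj_diff y)+
    then have p: "pos (\<phi> (?t *\<^sub>R 1 + y))" "pos (\<phi> (?t *\<^sub>R 1 - y))" using cc y by (auto intro!: posC)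
    have m: "\<phi> (?t *\<^sub>R 1 - y) = ?t *\<^sub>R \<phi> 1 - \<phi> y"
      using lin[of "?t *\<^sub>R 1" "(-1) *\<^sub>R y"] linR[of 1 ?t] linR[of y "-1"]
        cc(5)[OF y(1), of "-1"] cc(1,5) y by simp
    have pl: "\<phi> (?t *\<^sub>R 1 + y) = ?t *\<^sub>R \<phi> 1 + \<phi> y"
      using lin[of "?t *\<^sub>R 1" y] linR[of 1 ?t] cc(1,5) y by simp
    have "norm (?t *\<^sub>R \<phi> 1 + \<phi> y) \<le> norm ((?t *\<^sub>R \<phi> 1 + \<phi> y) + (?t *\<^sub>R \<phi> 1 - \<phi> y))"
      using p unfolding m pl by (rule norm_le_norm_add_pos)
    also have "\<dots> = 2 * ?t * norm (\<phi> 1)" by (simp flip: scaleR_add_left)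
    finally have "norm (?t *\<^sub>R \<phi> 1 + \<phi> y) \<le> 2 * ?t * norm (\<phi> 1)" .
    moreover have "norm (\<phi> y) \<le> norm (?t *\<^sub>R \<phi> 1 + \<phi> y) + norm (?t *\<^sub>R \<phi> 1)"
      using norm_triangle_ineq4[of "?t *\<^sub>R \<phi> 1 + \<phi> y" "?t *\<^sub>R \<phi> 1"] by simp
    ultimately show ?thesis by (simp add: mult_ac)
  qed
  define a b where "a = (1/2) *\<^sub>R (x + adj x)" and "b = (-\<i>/2) *\<^sub>C (x - adj x)"
  have ab: "a \<in> C" "b \<in> C" unfolding a_def b_def using cc x by auto
  have sab: "adj a = a" "adj b = b"
    by (simp_all add: a_def b_def adj_add adj_diff adj_adj adj_scaleC add.commute scaleC_diff scaleC_minus_left)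
  have nab: "norm a \<le> norm x" "norm b \<le> norm x"
    using norm_triangle_ineq[of x "adj x"] norm_triangle_ineq4[of x "adj x"]
    by (simp_all add: a_def b_def norm_scaleC norm_divide)
  have "\<i> *\<^sub>C b = (1/2) *\<^sub>R (x - adj x)"
    using scaleC_of_real[of "1/2" "x - adj x"] by (simp add: b_def scaleC_scaleC)
  then have "a + \<i> *\<^sub>C b = (1/2) *\<^sub>R ((x + adj x) + (x - adj x))"
    by (simp only: a_def scaleR_right_distrib)
  also have "(x + adj x) + (x - adj x) = x + x" by simp
  finally have "x = a + \<i> *\<^sub>C b" by simp
  then have "\<phi> x = \<phi> a + \<i> *\<^sub>C \<phi> b" using lin linC cc ab by metis
  then have "norm (\<phi> x) \<le> norm (\<phi> a) + norm (\<phi> b)"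
    using norm_triangle_ineq[of "\<phi> a" "\<i> *\<^sub>C \<phi> b"] by (simp add: norm_scaleC)
  also have "\<dots> \<le> 3 * norm (\<phi> 1) * norm x + 3 * norm (\<phi> 1) * norm x"
    using sa[OF ab(1) sab(1)] sa[OF ab(2) sab(2)] nab
    by (intro add_mono) (meson mult_left_mono norm_ge_zero order_trans mult_nonneg_nonneg zero_le_numeral)+
  finally show ?thesis by (simp add: mult_ac)
qed

text \<open>The Schwarz inequality for \<open>p = 1\<close> gives \<open>N\<^sup>2 \<le> \<parallel>\<phi>(1)\<parallel> N\<close> for the norm \<open>N\<close> of the amplification,
  whose finiteness is clear from the bound for scalar matrices.\<close>

lemma completely_positive_completely_bounded:
  fixes C :: "'a::unital_cstar_algebra set"
  assumes C: "unital_cstar_subalgebra C" and \<phi>: "completely_positive C D \<phi>" and w: "w \<in> mats C n"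
  shows "mat_norm (map_mat \<phi> w) \<le> norm (\<phi> 1) * mat_norm w"
proof (cases "n = 0")
  case True
  with mats_carrier[OF w] have "map_mat \<phi> w = 0\<^sub>m 0 0" by (intro eq_matI) auto
  then show ?thesis by simp
next
  case False
  then have n: "n \<ge> 1" by simp
  have CS: "unital_star_subalgebra C" using C by (auto simp: unital_cstar_subalgebra_def)
  define S where "S = {mat_norm (map_mat \<phi> w) |w. w \<in> mats C n \<and> mat_norm w \<le> 1}"
  define K where "K = norm (\<phi> 1)"
  have bd: "bdd_above S"
  proof (rule bdd_aboveI)
    fix s assume "s \<in> S"
    then obtain w where w: "s = mat_norm (map_mat \<phi> w)" "w \<in> mats C n" "mat_norm w \<le> 1" by (auto simp: S_def)
    have "s \<le> (\<Sum>i<n. \<Sum>j<n. norm (\<phi> (w $$ (i,j))))"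
      using mat_norm_le_sum[of "map_mat \<phi> w"] mats_carrier[OF w(2)] w by simp
    also have "\<dots> \<le> (\<Sum>i<n. \<Sum>j<n. 6 * K)"
    proof (intro sum_mono)
      fix i j assume "i \<in> {..<n}" "j \<in> {..<n}"
      then have ij: "i < n" "j < n" by auto
      have "norm (\<phi> (w $$ (i,j))) \<le> 6 * norm (\<phi> 1) * norm (w $$ (i,j))"
        by (rule completely_positive_bounded[OF C \<phi>]) (use w ij in \<open>simp add: mats_iff\<close>)
      also have "\<dots> \<le> 6 * norm (\<phi> 1) * 1"
        using norm_index_le_mat_norm[of i w j] mats_carrier[OF w(2)] ij w by (intro mult_left_mono) auto
      finally show "norm (\<phi> (w $$ (i,j))) \<le> 6 * K" by (simp add: K_def)
    qed
    finally show "s \<le> (\<Sum>i<n. \<Sum>j<n. 6 * K)" .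
  qed
  have one: "mat_norm (map_mat \<phi> (1\<^sub>m n)) \<le> K"
  proof -
    have "\<phi> 0 = 0"
      using \<phi> star_subalgebra_zero[OF CS] unfolding completely_positive_def linear_map_on_def
      by (metis add_cancel_right_right)
    then have "map_mat \<phi> (1\<^sub>m n) = amplify n (\<phi> 1)" by (intro eq_matI) (auto simp: amplify_def)
    then show ?thesis using mat_norm_amplify_le by (simp add: K_def)
  qed
  define s where "s = Sup S"
  have s0: "mat_norm (map_mat \<phi> (0\<^sub>m n n)) \<in> S" using mats_zero[OF CS] by (force simp: S_def)
  have s_nonneg: "0 \<le> s" unfolding s_def by (rule order_trans[OF mat_norm_nonneg cSup_upper[OF s0 bd]])
  have le: "(mat_norm (map_mat \<phi> w))\<^sup>2 \<le> K * s" if w: "w \<in> mats C n" "mat_norm w \<le> 1" for w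
  proof -
    have adj1: "mat_adj (1\<^sub>m n :: 'a mat) = 1\<^sub>m n" by (intro eq_matI) auto
    have ww: "mat_adj w * w \<in> mats C n" using mats_mult[OF CS mats_adj[OF CS w(1)] w(1)] .
    have "mat_norm (mat_adj w * w) \<le> mat_norm (mat_adj w) * mat_norm w"
      using w by (intro mat_norm_mult[of _ n n _ n] mat_adj_carrier mats_carrier)
    also have "\<dots> \<le> 1 * 1" using w mat_norm_mat_adj_le[of w] by (intro mult_mono) auto
    finally have "mat_norm (map_mat \<phi> (mat_adj w * w)) \<in> S" using ww by (auto simp: S_def)
    then have s1: "mat_norm (map_mat \<phi> (mat_adj w * w)) \<le> s" unfolding s_def by (rule cSup_upper[OF _ bd])
    have "(mat_norm (map_mat \<phi> w))\<^sup>2 \<le> mat_norm (map_mat \<phi> (1\<^sub>m n)) * mat_norm (map_mat \<phi> (mat_adj w * w))"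
      using completely_positive_schwarz[OF CS \<phi> mats_one[OF CS] w(1) n] mats_carrier[OF w(1)]
      by (simp add: adj1)
    also have "\<dots> \<le> K * s" using one s1 by (intro mult_mono) (auto simp: K_def)
    finally show ?thesis .
  qed
  have "s * s \<le> K * s"
  proof -
    have "s \<le> sqrt (K * s)" unfolding s_def
    proof (rule cSup_least)
      fix x assume "x \<in> S"
      then obtain w where "x = mat_norm (map_mat \<phi> w)" "w \<in> mats C n" "mat_norm w \<le> 1" by (auto simp: S_def)
      with le[of w] show "x \<le> sqrt (K * Sup S)" by (auto intro: real_le_rsqrt simp: s_def)
    qed (use s0 in auto)
    then have "s\<^sup>2 \<le> (sqrt (K * s))\<^sup>2" using s_nonneg by (rule power_mono)
    then show ?thesis using s_nonneg by (simp add: power2_eq_square K_def)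
  qed
  then have sK: "s \<le> K" using s_nonneg by (cases "s = 0") (auto simp: K_def)
  show ?thesis
  proof (cases "mat_norm w = 0")
    case True
    with mat_norm_eq_0[of w] mats_carrier[OF w] have w0: "w = 0\<^sub>m n n" by simp
    have "\<phi> 0 = 0"
      using \<phi> star_subalgebra_zero[OF CS] unfolding completely_positive_def linear_map_on_def
      by (metis add_cancel_right_right)
    then have "map_mat \<phi> w = 0\<^sub>m n n" unfolding w0 by (intro eq_matI) auto
    then show ?thesis by simp
  next
    case False
    let ?t = "mat_norm w"
    have t: "?t > 0" using False mat_norm_nonneg[of w] by linarith
    let ?u = "map_mat ((*\<^sub>R) (1 / ?t)) w"
    have u: "?u \<in> mats C n" by (rule mats_scaleR[OF CS w])
    have lin: "\<phi> (r *\<^sub>R a) = r *\<^sub>R \<phi> a" if "a \<in> C" for a r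
      using \<phi> that unfolding completely_positive_def linear_map_on_def by (metis scaleC_of_real)
    have "map_mat \<phi> ?u = map_mat ((*\<^sub>R) (1 / ?t)) (map_mat \<phi> w)"
      using w by (intro eq_matI) (auto simp: mats_iff lin)
    then have "mat_norm (map_mat \<phi> ?u) = mat_norm (map_mat \<phi> w) / ?t"
      using t by (simp add: mat_norm_map_scaleR)
    moreover have "mat_norm (map_mat \<phi> ?u) \<in> S" using u t by (auto simp: S_def mat_norm_map_scaleR)
    then have "mat_norm (map_mat \<phi> ?u) \<le> s" unfolding s_def by (rule cSup_upper[OF _ bd])
    ultimately have "mat_norm (map_mat \<phi> w) / ?t \<le> K" using sK by simp
    then show ?thesis using t by (simp add: field_simps K_def)
  qed
qed

lemma unital_cstar_subalgebra_UNIV: "unital_cstar_subalgebra UNIV"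
  by (simp add: unital_cstar_subalgebra_def unital_star_subalgebra_def)

text \<open>The Schwarz inequality for matrices of size 1: an element whose square has expectation 0
  stays invisible to \<open>E\<close> after multiplication on the other side.\<close>

lemma conditional_expectation_schwarz_eq_0:
  fixes E :: "'a::unital_cstar_algebra \<Rightarrow> 'a"
  assumes E: "completely_positive UNIV B E"
  shows "E (w * adj w) = 0 \<Longrightarrow> E (w * x) = 0" "E (adj w * w) = 0 \<Longrightarrow> E (x * w) = 0"
proof -
  have US: "unital_star_subalgebra (UNIV :: 'a set)" by (simp add: unital_star_subalgebra_def)
  let ?m = "\<lambda>a. mat 1 1 (\<lambda>_. a) :: 'a mat"
  have mm: "?m a \<in> mats UNIV 1" for a by (simp add: mats_iff)
  have mult: "mat_adj (?m a) * ?m b = ?m (adj a * b)" for a b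
    by (intro eq_matI) (auto simp: scalar_prod_def)
  have z: "map_mat E (?m a) = 0\<^sub>m 1 1" if "E a = 0" for a
    using that by (intro eq_matI) auto
  have key: "E (adj a * b) = 0" if "E (adj a * a) = 0 \<or> E (adj b * b) = 0" for a b
  proof -
    have "(mat_norm (map_mat E (?m (adj a * b))))\<^sup>2 \<le> 0"
      using completely_positive_schwarz[OF US E mm mm order_refl, of a b] that
      unfolding mult by (auto simp only: z mat_norm_zero mult_zero_left mult_zero_right)
    then have "mat_norm (map_mat E (?m (adj a * b))) = 0" by simp
    with norm_index_le_mat_norm[of 0 "map_mat E (?m (adj a * b))" 0] show ?thesis by simp
  qed
  show "E (w * adj w) = 0 \<Longrightarrow> E (w * x) = 0" using key[of "adj w" x] by (simp add: adj_adj)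
  show "E (adj w * w) = 0 \<Longrightarrow> E (x * w) = 0" using key[of "adj x" w] by (simp add: adj_adj)
qed

text \<open>\<open>E[(Vb - bV)(Vb - bV)\<^sup>*] = 0\<close>, so that \<open>V\<close> commutes with \<open>B\<close> as far as \<open>E\<close> can see.\<close>

lemma conditional_expectation_compression:
  fixes B :: "'a::unital_cstar_algebra set"
  assumes E: "conditional_expectation B E" and B: "unital_star_subalgebra B"
    and V: "\<And>b. b \<in> B \<Longrightarrow> E (V * b * adj V) = b"
  shows "conditional_expectation B (\<lambda>T. E (V * T * adj V))"
proof -
  have cp: "completely_positive UNIV B E" using E by (simp add: conditional_expectation_def)
  have lin: "E (x + y) = E x + E y" "E (c *\<^sub>C x) = c *\<^sub>C E x" "E x \<in> B" for x y c
    using cp by (auto simp: completely_positive_def linear_map_on_def)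
  have E0: "E 0 = 0" using lin(1)[of 0 0] by simp
  have diff: "E (x - y) = E x - E y" for x y using lin(1)[of "x - y" y] by simp
  have bi: "E (b1 * a * b2) = b1 * E a * b2" if "b1 \<in> B" "b2 \<in> B" for b1 a b2
    using E that by (auto simp: conditional_expectation_def)
  have bl: "E (b * a) = b * E a" and br: "E (a * b) = E a * b" if "b \<in> B" for b a
    using bi[OF that star_subalgebra_one[OF B]] bi[OF star_subalgebra_one[OF B] that] by simp_all
  have w0: "E ((V * b - b * V) * adj (V * b - b * V)) = 0" if b: "b \<in> B" for b
  proof -
    note ab = star_subalgebra_adj[OF B b]
    \<comment> \<open>Each of the four terms has expectation \<open>b * adj b\<close> up to its
      sign, and the signs cancel.\<close>
    have "(V * b - b * V) * adj (V * b - b * V)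
        = V * (b * adj b) * adj V - (V * b * adj V) * adj b - b * (V * adj b * adj V) + b * ((V * 1 * adj V) * adj b)"
      by (simp add: adj_diff adj_mult algebra_simps)
    then show ?thesis
      using V[OF b] V[OF ab] V[OF star_subalgebra_one[OF B]] V[OF star_subalgebra_mult[OF B b ab]]
      by (simp add: diff lin(1) bl[OF b] br[OF ab])
  qed
  have left: "E (V * b * x) = b * E (V * x)" if b: "b \<in> B" for b x
  proof -
    have "E ((V * b - b * V) * x) = 0"
      by (rule conditional_expectation_schwarz_eq_0(1)[OF cp w0[OF b]])
    then show ?thesis by (simp add: left_diff_distrib diff mult.assoc bl[OF b])
  qed
  have right: "E (x * (b * adj V)) = E (x * adj V) * b" if b: "b \<in> B" for b x
  proof -
    let ?w = "adj (V * adj b - adj b * V)"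
    have "E (adj ?w * ?w) = 0" using w0[OF star_subalgebra_adj[OF B b]] by (simp add: adj_adj)
    from conditional_expectation_schwarz_eq_0(2)[OF cp this]
    have "E (x * (b * adj V - adj V * b)) = 0" by (simp add: adj_diff adj_mult adj_adj)
    then show ?thesis by (simp add: right_diff_distrib diff br[OF b] flip: mult.assoc)
  qed
  have cp': "completely_positive UNIV B (\<lambda>T. E (V * T * adj V))"
    unfolding completely_positive_def
  proof (intro conjI allI impI)
    show "linear_map_on UNIV B (\<lambda>T. E (V * T * adj V))"
      by (auto simp: linear_map_on_def lin algebra_simps scaleC_mult_left scaleC_mult_right)
    fix n :: nat and P :: "'a mat"
    assume n: "1 \<le> n" and "positive_mat UNIV n P"
    then obtain N where N: "N \<in> carrier_mat n n" "P = mat_adj N * N" by (auto simp: positive_mat_def mats_def)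
    \<comment> \<open>Writing the compressed matrix as \<open>mat_adj M * M\<close> shifts the
      factors \<open>V\<close> and \<open>adj V\<close> into the square, so that complete positivity
      of \<open>E\<close> applies.\<close>
    define M where "M = map_mat (\<lambda>x. x * adj V) N"
    have M: "M \<in> carrier_mat n n" using N by (simp add: M_def)
    have "map_mat (\<lambda>T. E (V * T * adj V)) P = map_mat E (mat_adj M * M)"
    proof (rule eq_matI)
      fix i j assume "i < dim_row (map_mat E (mat_adj M * M))" "j < dim_col (map_mat E (mat_adj M * M))"
      then have ij: "i < n" "j < n" using M by auto
      have "P $$ (i,j) = (\<Sum>k=0..<n. adj (N $$ (k,i)) * N $$ (k,j))"
        unfolding N(2) using N(1) ij by (simp add: scalar_prod_def)
      moreover have "(mat_adj M * M) $$ (i,j) = (\<Sum>k=0..<n. V * adj (N $$ (k,i)) * (N $$ (k,j) * adj V))"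
        using N(1) ij by (simp add: M_def scalar_prod_def adj_mult adj_adj)
      ultimately have "V * P $$ (i,j) * adj V = (mat_adj M * M) $$ (i,j)"
        by (simp add: sum_distrib_left sum_distrib_right mult.assoc)
      then show "map_mat (\<lambda>T. E (V * T * adj V)) P $$ (i,j) = map_mat E (mat_adj M * M) $$ (i,j)"
        using ij N M by simp
    qed (use N M in simp_all)
    moreover have "positive_mat UNIV n (mat_adj M * M)" using M by (auto simp: positive_mat_def mats_def)
    ultimately show "positive_mat B n (map_mat (\<lambda>T. E (V * T * adj V)) P)"
      using cp n by (auto simp: completely_positive_def)
  qed
  show ?thesis
    unfolding conditional_expectation_def
  proof (intro conjI ballI allI cp' V)
    fix a b1 b2 assume b: "b1 \<in> B" "b2 \<in> B"
    have "E (V * (b1 * a * b2) * adj V) = E (V * b1 * (a * b2 * adj V))" by (simp add: mult.assoc)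
    also have "\<dots> = b1 * E (V * (a * b2 * adj V))" by (rule left[OF b(1)])
    also have "V * (a * b2 * adj V) = V * a * (b2 * adj V)" by (simp add: mult.assoc)
    also have "E \<dots> = E (V * a * adj V) * b2" by (rule right[OF b(2)])
    finally show "E (V * (b1 * a * b2) * adj V) = b1 * E (V * a * adj V) * b2" by (simp add: mult.assoc)
  qed
qed

section \<open>Bounded families of matrices\<close>

text \<open>Estimates that are uniform in the matrix size become single estimates in the Banach algebra
  of bounded families \<open>(M\<^sub>n)\<^sub>n\<close> with \<open>M\<^sub>n \<in> M\<^sub>n(A)\<close>.\<close>

typedef (overloaded) 'a mat_family =
  "{f :: nat \<Rightarrow> 'a::unital_cstar_algebra mat. (\<forall>n. f n \<in> carrier_mat n n) \<and> (\<exists>K. \<forall>n. mat_norm (f n) \<le> K)}"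
  morphisms fam_at Abs_mat_family
  by (rule exI[of _ "\<lambda>n. 0\<^sub>m n n"]) auto

lemma fam_at_carrier [simp]: "fam_at x n \<in> carrier_mat n n"
  using fam_at[of x] by auto

lemma fam_at_dim [simp]: "dim_row (fam_at x n) = n" "dim_col (fam_at x n) = n"
  by (rule carrier_matD[OF fam_at_carrier])+

lemma fam_at_bounded: "\<exists>K. \<forall>n. mat_norm (fam_at x n) \<le> K"
  using fam_at[of x] by auto

lemma fam_at_Abs:
  assumes "\<And>n. f n \<in> carrier_mat n n" "\<And>n. mat_norm (f n) \<le> K"
  shows "fam_at (Abs_mat_family f) n = f n"
  using assms by (subst Abs_mat_family_inverse) auto

lemma fam_eqI: "(\<And>n. fam_at x n = fam_at y n) \<Longrightarrow> x = y"
  by (metis fam_at_inject ext)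

instantiation mat_family :: (unital_cstar_algebra) real_normed_vector
begin

definition "0 = Abs_mat_family (\<lambda>n. 0\<^sub>m n n)"
definition "x + y = Abs_mat_family (\<lambda>n. fam_at x n + fam_at y n)"
definition "- x = Abs_mat_family (\<lambda>n. - fam_at x n)"
definition "x - y = x + - (y :: 'a mat_family)"
definition "r *\<^sub>R x = Abs_mat_family (\<lambda>n. map_mat ((*\<^sub>R) r) (fam_at x n))"
definition "norm x = Sup (range (\<lambda>n. mat_norm (fam_at x n)))"
definition "dist x y = norm (x - y :: 'a mat_family)"
definition "sgn x = inverse (norm x) *\<^sub>R (x :: 'a mat_family)"
definition "uniformity = (INF e\<in>{0<..}. principal {(x, y). dist x (y :: 'a mat_family) < e})"
definition "open U = (\<forall>x\<in>U. eventually (\<lambda>(x', y). x' = (x :: 'a mat_family) \<longrightarrow> y \<in> U) uniformity)"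

lemma fam_at_zero: "fam_at 0 n = (0\<^sub>m n n :: 'a mat)"
  unfolding zero_mat_family_def by (rule fam_at_Abs[of _ 0]) simp_all

lemma fam_at_add: "fam_at (x + y) n = fam_at x n + (fam_at y n :: 'a mat)"
proof -
  obtain K L where "\<And>n. mat_norm (fam_at x n) \<le> K" "\<And>n. mat_norm (fam_at y n) \<le> L"
    using fam_at_bounded by metis
  then have "mat_norm (fam_at x n + fam_at y n) \<le> K + L" for n
    by (intro order_trans[OF mat_norm_add[OF fam_at_carrier fam_at_carrier]] add_mono)
  then show ?thesis unfolding plus_mat_family_def by (intro fam_at_Abs) simp_all
qed

lemma fam_at_uminus: "fam_at (- x) n = - (fam_at x n :: 'a mat)"
proof -
  obtain K where "\<And>n. mat_norm (fam_at x n) \<le> K" using fam_at_bounded by metis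
  then show ?thesis unfolding uminus_mat_family_def
    by (intro fam_at_Abs) (simp_all add: mat_norm_uminus)
qed

lemma fam_at_diff: "fam_at (x - y) n = fam_at x n - (fam_at y n :: 'a mat)"
  unfolding minus_mat_family_def fam_at_add fam_at_uminus
  by (intro eq_matI) simp_all

lemma fam_at_scaleR: "fam_at (r *\<^sub>R x) n = map_mat ((*\<^sub>R) r) (fam_at x n :: 'a mat)"
proof -
  obtain K where "\<And>n. mat_norm (fam_at x n) \<le> K" using fam_at_bounded by metis
  then have "mat_norm (map_mat ((*\<^sub>R) r) (fam_at x n)) \<le> \<bar>r\<bar> * K" for n
    by (simp add: mat_norm_map_scaleR mult_left_mono)
  then show ?thesis unfolding scaleR_mat_family_def by (intro fam_at_Abs) simp_all
qed

lemma mat_norm_fam_at_le: "mat_norm (fam_at x n) \<le> norm (x :: 'a mat_family)"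
  unfolding norm_mat_family_def using fam_at_bounded[of x]
  by (intro cSup_upper) (auto simp: bdd_above_def)

lemma norm_fam_le: "(\<And>n. mat_norm (fam_at x n) \<le> K) \<Longrightarrow> norm (x :: 'a mat_family) \<le> K"
  unfolding norm_mat_family_def by (rule cSup_least) auto

instance
proof
  fix x y z :: "'a mat_family" and a b :: real
  note simps = fam_at_add fam_at_zero fam_at_uminus fam_at_scaleR
  show "x + y + z = x + (y + z)" by (rule fam_eqI) (auto simp: simps)
  show "x + y = y + x" by (rule fam_eqI) (auto simp: simps intro!: comm_add_mat)
  show "0 + x = x" by (rule fam_eqI) (auto simp: simps)
  show "- x + x = 0" by (rule fam_eqI) (auto simp: simps)
  show "a *\<^sub>R (x + y) = a *\<^sub>R x + a *\<^sub>R y" "(a + b) *\<^sub>R x = a *\<^sub>R x + b *\<^sub>R x"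
    "a *\<^sub>R b *\<^sub>R x = (a * b) *\<^sub>R x" "1 *\<^sub>R x = x"
    by (rule fam_eqI; auto simp: simps algebra_simps)+
  show "norm (x + y) \<le> norm x + norm y"
    by (rule norm_fam_le)
      (auto simp: simps intro!: order_trans[OF mat_norm_add[OF fam_at_carrier fam_at_carrier]] add_mono mat_norm_fam_at_le)
  have le: "norm (a *\<^sub>R x) \<le> \<bar>a\<bar> * norm x" for a and x :: "'a mat_family"
    by (rule norm_fam_le) (auto simp: simps mat_norm_map_scaleR intro!: mult_left_mono mat_norm_fam_at_le)
  have nn: "0 \<le> norm x" for x :: "'a mat_family"
    using mat_norm_fam_at_le[of x 0] mat_norm_nonneg order_trans by blast
  show "norm (a *\<^sub>R x) = \<bar>a\<bar> * norm x"
  proof (cases "a = 0")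
    case True
    then show ?thesis using le[of 0 x] nn[of "0 *\<^sub>R x"] by auto
  next
    case False
    have "(1 / a) *\<^sub>R a *\<^sub>R x = x" using False by (intro fam_eqI) (auto simp: simps)
    with le[of "1/a" "a *\<^sub>R x"] have "norm x \<le> \<bar>1 / a\<bar> * norm (a *\<^sub>R x)" by simp
    then have "\<bar>a\<bar> * norm x \<le> norm (a *\<^sub>R x)" using False by (simp add: field_simps)
    with le[of a x] show ?thesis by simp
  qed
  show "(norm x = 0) = (x = 0)"
  proof
    assume n: "norm x = 0"
    show "x = 0"
    proof (rule fam_eqI)
      fix n
      have "mat_norm (fam_at x n) = 0" using mat_norm_fam_at_le[of x n] n mat_norm_nonneg[of "fam_at x n"] by linarith
      then show "fam_at x n = fam_at 0 n" using mat_norm_eq_0[of "fam_at x n"] by (simp add: fam_at_zero)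
    qed
  next
    assume "x = 0"
    then have "norm x \<le> 0" by (intro norm_fam_le) (simp add: fam_at_zero)
    with nn[of x] show "norm x = 0" by simp
  qed
qed (simp_all add: minus_mat_family_def dist_mat_family_def sgn_mat_family_def
  uniformity_mat_family_def open_mat_family_def)

end

instantiation mat_family :: (unital_cstar_algebra) real_normed_algebra_1
begin

definition "1 = Abs_mat_family (\<lambda>n. 1\<^sub>m n)"
definition "x * y = Abs_mat_family (\<lambda>n. fam_at x n * fam_at y n)"

lemma fam_at_one: "fam_at 1 n = (1\<^sub>m n :: 'a mat)"
proof -
  have "mat_norm (1\<^sub>m n :: 'a mat) \<le> 1" for n
    by (rule mat_norm_le) simp_all
  then show ?thesis unfolding one_mat_family_def by (intro fam_at_Abs) simp_all
qed

lemma fam_at_mult: "fam_at (x * y) n = fam_at x n * (fam_at y n :: 'a mat)"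
proof -
  have "mat_norm (fam_at x n * fam_at y n) \<le> norm x * norm y" for n
    by (intro order_trans[OF mat_norm_mult[OF fam_at_carrier fam_at_carrier]] mult_mono mat_norm_fam_at_le) simp_all
  then show ?thesis unfolding times_mat_family_def
    by (intro fam_at_Abs[where K="norm x * norm y"]) (auto intro: mult_carrier_mat)
qed

instance
proof
  fix x y z :: "'a mat_family" and a b :: real
  note simps = fam_at_add fam_at_zero fam_at_uminus fam_at_scaleR fam_at_mult fam_at_one
  show "x * y * z = x * (y * z)"
    by (rule fam_eqI) (simp add: simps assoc_mult_mat[OF fam_at_carrier fam_at_carrier fam_at_carrier])
  show "(x + y) * z = x * z + y * z"
    by (rule fam_eqI) (simp add: simps add_mult_distrib_mat[OF fam_at_carrier fam_at_carrier fam_at_carrier])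
  show "x * (y + z) = x * y + x * z"
    by (rule fam_eqI) (simp add: simps mult_add_distrib_mat[OF fam_at_carrier fam_at_carrier fam_at_carrier])
  show "1 * x = x" "x * 1 = x"
    by (rule fam_eqI; simp add: simps left_mult_one_mat[OF fam_at_carrier] right_mult_one_mat[OF fam_at_carrier])+
  show "a *\<^sub>R x * y = a *\<^sub>R (x * y)" "x * a *\<^sub>R y = a *\<^sub>R (x * y)"
    by (rule fam_eqI, rule eq_matI; simp add: simps scalar_prod_def scaleR_sum_right)+
  show "norm (x * y) \<le> norm x * norm y"
    by (rule norm_fam_le)
      (auto simp: simps intro!: order_trans[OF mat_norm_mult[OF fam_at_carrier fam_at_carrier]] mult_mono mat_norm_fam_at_le)
  have one: "norm (1::'a mat_family) = 1"
  proof (rule antisym)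
    show "norm (1::'a mat_family) \<le> 1"
      by (rule norm_fam_le, rule mat_norm_le) (simp_all add: fam_at_one)
    \<comment> \<open>Size 1 is used because families include size 0, where the identity matrix has
      norm 0.\<close>
    show "1 \<le> norm (1::'a mat_family)"
      using mat_norm_fam_at_le[of "1::'a mat_family" 1] mat_norm_one[of 1, where 'a='a] by (simp add: fam_at_one)
  qed
  show "norm (1::'a mat_family) = 1" by (rule one)
  show "(0::'a mat_family) \<noteq> 1" using one by (metis norm_zero zero_neq_one)
qed

end

section \<open>Limits of families and completeness\<close>

lemmas fam_at_simps = fam_at_zero fam_at_add fam_at_uminus fam_at_diff fam_at_scaleR fam_at_one fam_at_mult

lemma norm_fam_index_le:
  "i < n \<Longrightarrow> j < n \<Longrightarrow> norm (fam_at x n $$ (i,j)) \<le> norm x"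
  using norm_index_le_mat_norm[of i "fam_at x n" j] mat_norm_fam_at_le[of x n] by simp

lemma norm_fam_index_diff_le:
  "i < n \<Longrightarrow> j < n \<Longrightarrow> norm (fam_at x n $$ (i,j) - fam_at y n $$ (i,j)) \<le> norm (x - y)"
  using norm_fam_index_le[of i n j "x - y"] by (simp add: fam_at_diff)

lemma tendsto_fam_index:
  assumes "X \<longlonglongrightarrow> l" "i < n" "j < n"
  shows "(\<lambda>k. fam_at (X k) n $$ (i,j)) \<longlonglongrightarrow> fam_at l n $$ (i,j)"
proof (rule LIM_zero_cancel, rule Lim_null_comparison)
  show "\<forall>\<^sub>F k in sequentially. norm (fam_at (X k) n $$ (i,j) - fam_at l n $$ (i,j)) \<le> norm (X k - l)"
    using assms norm_fam_index_diff_le by (intro always_eventually allI)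
  show "(\<lambda>k. norm (X k - l)) \<longlonglongrightarrow> 0" using assms(1) by (simp add: LIM_zero tendsto_norm_zero)
qed

text \<open>Lower semicontinuity of the norm: L differs from M m by a matrix whose entries tend to
  0, and for fixed \<open>n\<close> the sum of their norms bounds its norm.\<close>

lemma mat_norm_limit_le:
  fixes M :: "nat \<Rightarrow> 'a::unital_cstar_algebra mat"
  assumes c: "\<And>m. M m \<in> carrier_mat n n" "L \<in> carrier_mat n n"
    and lim: "\<And>i j. i < n \<Longrightarrow> j < n \<Longrightarrow> (\<lambda>m. M m $$ (i,j)) \<longlonglongrightarrow> L $$ (i,j)"
    and le: "\<forall>\<^sub>F m in sequentially. mat_norm (M m) \<le> e"
  shows "mat_norm L \<le> e"
proof -
  have "(\<lambda>m. e + (\<Sum>i<n. \<Sum>j<n. norm (L $$ (i,j) - M m $$ (i,j)))) \<longlonglongrightarrow> e + (\<Sum>i<n. \<Sum>j<n. norm (L $$ (i,j) - L $$ (i,j)))"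
    by (intro tendsto_intros lim) auto
  then have "(\<lambda>m. e + (\<Sum>i<n. \<Sum>j<n. norm (L $$ (i,j) - M m $$ (i,j)))) \<longlonglongrightarrow> e" by simp
  moreover have "\<forall>\<^sub>F m in sequentially. mat_norm L \<le> e + (\<Sum>i<n. \<Sum>j<n. norm (L $$ (i,j) - M m $$ (i,j)))"
    using le
  proof eventually_elim
    case (elim m)
    have "L = M m + (L - M m)" using c(1)[of m] c(2) by (intro eq_matI) auto
    then have "mat_norm L \<le> mat_norm (M m) + mat_norm (L - M m)"
      using mat_norm_add[of "M m" n n "L - M m"] c(1)[of m] c(2) by (metis minus_carrier_mat)
    also have "mat_norm (L - M m) \<le> (\<Sum>i<n. \<Sum>j<n. norm (L $$ (i,j) - M m $$ (i,j)))"
      using mat_norm_le_sum[of "L - M m"] c(1)[of m] c(2) by simp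
    finally show ?case using elim by linarith
  qed
  ultimately show ?thesis by (rule tendsto_lowerbound) simp
qed

instance mat_family :: (unital_cstar_algebra) banach
proof
  fix X :: "nat \<Rightarrow> 'a mat_family"
  assume X: "Cauchy X"
  define l where "l n i j = lim (\<lambda>k. fam_at (X k) n $$ (i,j))" for n i j
  have l: "(\<lambda>k. fam_at (X k) n $$ (i,j)) \<longlonglongrightarrow> l n i j" if "i < n" "j < n" for i j n
  proof -
    have "Cauchy (\<lambda>k. fam_at (X k) n $$ (i,j))"
    proof (rule metric_CauchyI)
      fix e :: real assume "0 < e"
      then obtain N where N: "\<forall>k\<ge>N. \<forall>m\<ge>N. dist (X k) (X m) < e" using X unfolding Cauchy_def by blast
      have "\<forall>k\<ge>N. \<forall>m\<ge>N. dist (fam_at (X k) n $$ (i,j)) (fam_at (X m) n $$ (i,j)) < e"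
        unfolding dist_norm
        by (intro allI impI le_less_trans[OF norm_fam_index_diff_le[OF that]])
          (use N in \<open>simp add: dist_norm\<close>)
      then show "\<exists>N. \<forall>k\<ge>N. \<forall>m\<ge>N. dist (fam_at (X k) n $$ (i,j)) (fam_at (X m) n $$ (i,j)) < e" by blast
    qed
    then show ?thesis unfolding l_def by (simp add: Cauchy_convergent_iff convergent_LIMSEQ_iff)
  qed
  define L where "L n = mat n n (\<lambda>(i,j). l n i j)" for n
  have Lc: "L n \<in> carrier_mat n n" for n by (simp add: L_def)
  have Ld: "dim_row (L n) = n" "dim_col (L n) = n" for n by (simp_all add: L_def)
  \<comment> \<open>The Cauchy estimate is passed to the entrywise limit in the second index only,
    and \<open>e\<close> and \<open>N\<close> do not depend on \<open>n\<close>. This uniformity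
    makes \<open>L\<close> a bounded family and the limit of \<open>X\<close>.\<close>
  have close: "mat_norm (fam_at (X k) n - L n) \<le> e" if N: "\<forall>k\<ge>N. \<forall>m\<ge>N. dist (X k) (X m) < e" "k \<ge> N" for k n N e
  proof (rule mat_norm_limit_le[of "\<lambda>m. fam_at (X k - X m) n" n])
    show "(\<lambda>m. fam_at (X k - X m) n $$ (i,j)) \<longlonglongrightarrow> (fam_at (X k) n - L n) $$ (i,j)" if "i < n" "j < n" for i j
      using that by (auto simp: fam_at_diff L_def Ld intro!: tendsto_intros l)
    have "\<forall>m\<ge>N. mat_norm (fam_at (X k - X m) n) \<le> e"
      using N mat_norm_fam_at_le[of "X k - X _" n] by (metis dist_norm less_imp_le order_trans)
    then show "\<forall>\<^sub>F m in sequentially. mat_norm (fam_at (X k - X m) n) \<le> e"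
      using eventually_sequentially by blast
  qed (auto intro: minus_carrier_mat[OF Lc])
  obtain N where N: "\<forall>k\<ge>N. \<forall>m\<ge>N. dist (X k) (X m) < 1" using X unfolding Cauchy_def by (elim allE[of _ 1]) auto
  have "mat_norm (L n) \<le> norm (X N) + 1" for n
  proof -
    have "L n = fam_at (X N) n + - (fam_at (X N) n - L n)" by (intro eq_matI) (auto simp: Ld)
    also have "mat_norm \<dots> \<le> mat_norm (fam_at (X N) n) + mat_norm (- (fam_at (X N) n - L n))"
      using Lc by (intro mat_norm_add[of _ n n]) (simp_all add: minus_carrier_mat)
    also have "\<dots> \<le> norm (X N) + 1" using close[OF N, of N n] mat_norm_fam_at_le[of "X N" n] by (simp add: mat_norm_uminus)
    finally show ?thesis .
  qed
  then have fL: "fam_at (Abs_mat_family L) n = L n" for n using Lc by (intro fam_at_Abs)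
  have "X \<longlonglongrightarrow> Abs_mat_family L"
  proof (rule metric_LIMSEQ_I)
    fix e :: real assume e: "0 < e"
    then obtain N where N: "\<forall>k\<ge>N. \<forall>m\<ge>N. dist (X k) (X m) < e/2" using X unfolding Cauchy_def by (elim allE[of _ "e/2"]) auto
    have "dist (X k) (Abs_mat_family L) \<le> e/2" if "k \<ge> N" for k
      unfolding dist_norm by (rule norm_fam_le) (unfold fam_at_diff fL, rule close[OF N that])
    then show "\<exists>N. \<forall>k\<ge>N. dist (X k) (Abs_mat_family L) < e" using e by (intro exI[of _ N]) force
  qed
  then show "convergent X" by (auto simp: convergent_def)
qed

text \<open>Isometric embedding of one matrix size, through which statements about families are
  specialised to a single matrix.\<close>

definition fam_single :: "nat \<Rightarrow> 'a::unital_cstar_algebra mat \<Rightarrow> 'a mat_family" where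
  "fam_single n M = Abs_mat_family (\<lambda>m. if m = n then M else 0\<^sub>m m m)"

definition fam_const :: "'a::unital_cstar_algebra \<Rightarrow> 'a mat_family" where
  "fam_const a = Abs_mat_family (\<lambda>n. amplify n a)"

text \<open>Meaningful only where the images are bounded uniformly in the size, which is what
  complete boundedness of the entrywise map provides.\<close>

definition fam_map :: "('a::unital_cstar_algebra \<Rightarrow> 'a) \<Rightarrow> 'a mat_family \<Rightarrow> 'a mat_family" where
  "fam_map \<phi> x = Abs_mat_family (\<lambda>n. map_mat \<phi> (fam_at x n))"

definition fam_entries :: "'a::unital_cstar_algebra set \<Rightarrow> 'a mat_family set" where
  "fam_entries C = {x. \<forall>n. fam_at x n \<in> mats C n}"

lemma fam_at_single:
  assumes "M \<in> carrier_mat n n"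
  shows "fam_at (fam_single n M) m = (if m = n then M else 0\<^sub>m m m)"
  unfolding fam_single_def using assms by (intro fam_at_Abs[where K="mat_norm M"]) auto

lemma norm_fam_single: "M \<in> carrier_mat n n \<Longrightarrow> norm (fam_single n M) = mat_norm M"
  by (intro antisym norm_fam_le order_trans[OF _ mat_norm_fam_at_le[of "fam_single n M" n]])
    (auto simp: fam_at_single)

lemma amplify_carrier [simp]: "amplify n a \<in> carrier_mat n n"
  by (simp add: amplify_def)

lemma amplify_dim [simp]: "dim_row (amplify n a) = n" "dim_col (amplify n a) = n"
  by (simp_all add: amplify_def)

lemma amplify_index: "i < n \<Longrightarrow> j < n \<Longrightarrow> amplify n a $$ (i,j) = (if i = j then a else 0)"
  by (simp add: amplify_def)

lemma fam_at_const: "fam_at (fam_const a) n = amplify n a"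
  unfolding fam_const_def using mat_norm_amplify_le[of _ a] by (intro fam_at_Abs) simp_all

lemma norm_fam_const_le: "norm (fam_const a) \<le> norm a"
  by (rule norm_fam_le) (simp add: fam_at_const mat_norm_amplify_le)

lemma fam_entriesI: "(\<And>n. fam_at x n \<in> mats C n) \<Longrightarrow> x \<in> fam_entries C"
  by (simp add: fam_entries_def)

lemma fam_entriesD: "x \<in> fam_entries C \<Longrightarrow> fam_at x n \<in> mats C n"
  by (simp add: fam_entries_def)

lemma closed_fam_entries:
  assumes "closed C"
  shows "closed (fam_entries C)"
  unfolding closed_sequential_limits
proof (intro allI impI, elim conjE)
  fix X l assume X: "\<forall>k. X k \<in> fam_entries C" "X \<longlonglongrightarrow> l"
  show "l \<in> fam_entries C"
  proof (rule fam_entriesI, unfold mats_iff, intro conjI allI impI)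
    fix n i j :: nat assume ij: "i < n" "j < n"
    have "(\<lambda>k. fam_at (X k) n $$ (i,j)) \<longlonglongrightarrow> fam_at l n $$ (i,j)"
      by (rule tendsto_fam_index[OF X(2) ij])
    then show "fam_at l n $$ (i,j) \<in> C"
      by (rule closed_sequentially[OF assms, rotated])
        (rule mats_index[OF _ ij], use X(1) in \<open>simp add: fam_entries_def\<close>)
  qed simp
qed

context
  fixes C :: "'a::unital_cstar_algebra set"
  assumes C: "unital_star_subalgebra C"
begin

lemma fam_entries_zero: "0 \<in> fam_entries C"
  by (rule fam_entriesI) (simp add: fam_at_simps mats_zero[OF C])

lemma fam_entries_one: "1 \<in> fam_entries C"
  by (rule fam_entriesI) (simp add: fam_at_simps mats_one[OF C])

lemma fam_entries_add: "x \<in> fam_entries C \<Longrightarrow> y \<in> fam_entries C \<Longrightarrow> x + y \<in> fam_entries C"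
  by (rule fam_entriesI) (simp add: fam_at_simps mats_add[OF C] fam_entriesD)

lemma fam_entries_mult: "x \<in> fam_entries C \<Longrightarrow> y \<in> fam_entries C \<Longrightarrow> x * y \<in> fam_entries C"
  by (rule fam_entriesI) (simp add: fam_at_simps mats_mult[OF C] fam_entriesD)

lemma fam_entries_scaleR: "x \<in> fam_entries C \<Longrightarrow> r *\<^sub>R x \<in> fam_entries C"
  by (rule fam_entriesI) (simp add: fam_at_simps mats_scaleR[OF C] fam_entriesD)

lemma fam_entries_diff: "x \<in> fam_entries C \<Longrightarrow> y \<in> fam_entries C \<Longrightarrow> x - y \<in> fam_entries C"
  by (rule fam_entriesI) (simp add: fam_at_simps mats_diff[OF C] fam_entriesD)

lemma fam_entries_const: "a \<in> C \<Longrightarrow> fam_const a \<in> fam_entries C"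
  by (rule fam_entriesI) (auto simp: fam_at_const mats_iff amplify_index star_subalgebra_zero[OF C])

lemma fam_entries_single: "M \<in> mats C n \<Longrightarrow> fam_single n M \<in> fam_entries C"
  by (rule fam_entriesI) (auto simp: fam_at_single mats_carrier mats_zero[OF C])

end

lemma fam_single_add:
  "M \<in> carrier_mat n n \<Longrightarrow> N \<in> carrier_mat n n \<Longrightarrow> fam_single n (M + N) = fam_single n M + fam_single n N"
  by (rule fam_eqI) (auto simp: fam_at_single fam_at_simps)

lemma amplify_mult_index:
  assumes "M \<in> carrier_mat n n" "i < n" "j < n"
  shows "(amplify n a * M) $$ (i,j) = a * M $$ (i,j)" "(M * amplify n a) $$ (i,j) = M $$ (i,j) * a"
proof -
  have d: "dim_row M = n" "dim_col M = n" using assms(1) by auto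
  have "(amplify n a * M) $$ (i,j) = (\<Sum>k=0..<n. (if i = k then a else 0) * M $$ (k,j))"
    using assms d by (simp add: scalar_prod_def amplify_index)
  also have "\<dots> = (\<Sum>k=0..<n. if i = k then a * M $$ (k,j) else 0)" by (intro sum.cong) auto
  finally show "(amplify n a * M) $$ (i,j) = a * M $$ (i,j)" using assms by simp
  have "(M * amplify n a) $$ (i,j) = (\<Sum>k=0..<n. M $$ (i,k) * (if k = j then a else 0))"
    using assms d by (simp add: scalar_prod_def amplify_index)
  also have "\<dots> = (\<Sum>k=0..<n. if k = j then M $$ (i,k) * a else 0)" by (intro sum.cong) auto
  finally show "(M * amplify n a) $$ (i,j) = M $$ (i,j) * a" using assms by simp
qed

lemma fam_const_mult_index:
  assumes "i < n" "j < n"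
  shows "fam_at (fam_const a * x) n $$ (i,j) = a * fam_at x n $$ (i,j)"
    "fam_at (x * fam_const a) n $$ (i,j) = fam_at x n $$ (i,j) * a"
  by (simp_all only: fam_at_mult fam_at_const amplify_mult_index[OF fam_at_carrier assms])

lemma fam_const_mult: "fam_const (a * b) = fam_const a * fam_const b"
  by (rule fam_eqI, rule eq_matI) (simp_all add: fam_const_mult_index fam_at_const amplify_index)

lemma fam_at_const_scaleC:
  assumes "M \<in> carrier_mat n n"
  shows "amplify n (c *\<^sub>C 1) * M = map_mat (scaleC c) M" "M * amplify n (c *\<^sub>C 1) = map_mat (scaleC c) M"
proof -
  have d: "dim_row M = n" "dim_col M = n" using assms by auto
  show "amplify n (c *\<^sub>C 1) * M = map_mat (scaleC c) M"
    by (rule eq_matI) (simp_all add: d amplify_mult_index[OF assms] scaleC_mult_left del: index_mult_mat(1))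
  show "M * amplify n (c *\<^sub>C 1) = map_mat (scaleC c) M"
    by (rule eq_matI) (simp_all add: d amplify_mult_index[OF assms] scaleC_mult_right del: index_mult_mat(1))
qed

text \<open>Families form a real algebra here; multiplication by a complex scalar is represented by
  this central element.\<close>

lemma fam_const_scaleC_central: "fam_const (c *\<^sub>C 1) * x = x * fam_const (c *\<^sub>C 1)"
  by (rule fam_eqI) (simp add: fam_at_simps fam_at_const fam_at_const_scaleC)

lemma fam_single_scaleC:
  "M \<in> carrier_mat n n \<Longrightarrow> fam_single n (map_mat (scaleC c) M) = fam_const (c *\<^sub>C 1) * fam_single n M"
  by (rule fam_eqI) (auto simp: fam_at_simps fam_at_const fam_at_const_scaleC fam_at_single)

lemma fam_at_map:
  assumes "\<And>n. mat_norm (map_mat \<phi> (fam_at x n)) \<le> K"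
  shows "fam_at (fam_map \<phi> x) n = map_mat \<phi> (fam_at x n)"
  unfolding fam_map_def using assms by (intro fam_at_Abs) simp_all

section \<open>The amplified conditional expectation on families\<close>

context
  fixes E :: "'a::unital_cstar_algebra \<Rightarrow> 'a" and B :: "'a set"
  assumes E: "conditional_expectation B E"
begin

lemma cond_exp_linear:
  "E (x + y) = E x + E y" "E (c *\<^sub>C x) = c *\<^sub>C E x" "E x \<in> B" "E 0 = 0" "E (x - y) = E x - E y" "E (r *\<^sub>R x) = r *\<^sub>R E x"
proof -
  have l: "E (x + y) = E x + E y" "E (c *\<^sub>C x) = c *\<^sub>C E x" "E x \<in> B" for x y c
    using E by (auto simp: conditional_expectation_def completely_positive_def linear_map_on_def)
  show "E (x + y) = E x + E y" "E (c *\<^sub>C x) = c *\<^sub>C E x" "E x \<in> B" by (fact l)+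
  show "E 0 = 0" using l(1)[of 0 0] by simp
  show "E (x - y) = E x - E y" using l(1)[of "x - y" y] by simp
  show "E (r *\<^sub>R x) = r *\<^sub>R E x" using l(2)[of "complex_of_real r" x] by (simp add: scaleC_of_real)
qed

lemma cond_exp_sum: "E (\<Sum>i\<in>I. f i) = (\<Sum>i\<in>I. E (f i))"
  by (induction I rule: infinite_finite_induct) (auto simp: cond_exp_linear)

lemma mat_norm_map_cond_exp_le: "mat_norm (map_mat E (fam_at x n)) \<le> norm (E 1) * norm x"
proof -
  have "mat_norm (map_mat E (fam_at x n)) \<le> norm (E 1) * mat_norm (fam_at x n)"
    using E by (intro completely_positive_completely_bounded[OF unital_cstar_subalgebra_UNIV, of B])
      (auto simp: conditional_expectation_def mats_iff)
  also have "\<dots> \<le> norm (E 1) * norm x" by (intro mult_left_mono mat_norm_fam_at_le) simp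
  finally show ?thesis .
qed

lemma fam_at_cond_exp: "fam_at (fam_map E x) n = map_mat E (fam_at x n)"
  by (rule fam_at_map[OF mat_norm_map_cond_exp_le])

lemma bounded_linear_fam_cond_exp: "bounded_linear (fam_map E)"
proof (rule bounded_linear_intro[of _ "norm (E 1)"])
  fix x y :: "'a mat_family" and r :: real
  show "fam_map E (x + y) = fam_map E x + fam_map E y" "fam_map E (r *\<^sub>R x) = r *\<^sub>R fam_map E x"
    by (rule fam_eqI, rule eq_matI; simp add: fam_at_cond_exp fam_at_simps cond_exp_linear)+
  show "norm (fam_map E x) \<le> norm x * norm (E 1)"
    by (subst mult.commute, rule norm_fam_le) (simp add: fam_at_cond_exp mat_norm_map_cond_exp_le)
qed

lemma fam_cond_exp_entries: "fam_map E x \<in> fam_entries B"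
  by (rule fam_entriesI) (auto simp: fam_at_cond_exp mats_iff cond_exp_linear)

lemma fam_cond_exp_bimodule:
  assumes B: "unital_star_subalgebra B" and b: "b \<in> fam_entries B"
  shows "fam_map E (b * x) = b * fam_map E x" "fam_map E (x * b) = fam_map E x * b"
proof -
  have bi: "E (c * a) = c * E a" "E (a * c) = E a * c" if "c \<in> B" for c a
  proof -
    have "E (b1 * a * b2) = b1 * E a * b2" if "b1 \<in> B" "b2 \<in> B" for b1 a b2
      using E that by (auto simp: conditional_expectation_def)
    from this[OF that star_subalgebra_one[OF B], of a] this[OF star_subalgebra_one[OF B] that, of a]
    show "E (c * a) = c * E a" "E (a * c) = E a * c" by simp_all
  qed
  have bB: "fam_at b n $$ (i,j) \<in> B" if "i < n" "j < n" for n i j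
    using b that by (auto simp: fam_entries_def mats_iff)
  show "fam_map E (b * x) = b * fam_map E x"
    by (rule fam_eqI, rule eq_matI)
      (auto simp: fam_at_cond_exp fam_at_simps scalar_prod_def cond_exp_sum bB bi intro!: sum.cong)
  show "fam_map E (x * b) = fam_map E x * b"
    by (rule fam_eqI, rule eq_matI)
      (auto simp: fam_at_cond_exp fam_at_simps scalar_prod_def cond_exp_sum bB bi intro!: sum.cong)
qed

lemma fam_cond_exp_scaleC: "fam_map E (fam_const (c *\<^sub>C 1) * x) = fam_const (c *\<^sub>C 1) * fam_map E x"
  by (rule fam_eqI, rule eq_matI)
    (auto simp: fam_at_cond_exp fam_at_simps fam_at_const fam_at_const_scaleC cond_exp_linear)

end

section \<open>Neumann series\<close>

text \<open>The inverse of 1 - x for ||x|| < 1, kept as a series because membership in closed sets,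
  freeness and equality of laws are all read off from its partial sums.\<close>

definition neumann :: "'m::{real_normed_algebra_1,banach} \<Rightarrow> 'm" where
  "neumann x = (\<Sum>k. x ^ k)"

lemma neumann_eq:
  fixes x :: "'m::{real_normed_algebra_1,banach}"
  assumes "norm x < 1"
  shows "neumann x = 1 + x * neumann x" "neumann x = 1 + neumann x * x"
proof -
  note s = complete_algebra_summable_geometric[OF assms]
  have "neumann x = 1 + (\<Sum>k. x ^ Suc k)"
    unfolding neumann_def using suminf_split_head[OF s] by simp
  moreover have "(\<Sum>k. x ^ Suc k) = x * neumann x"
    unfolding neumann_def using suminf_mult[OF s, of x] by simp
  moreover have "(\<Sum>k. x ^ Suc k) = neumann x * x"
    unfolding neumann_def using suminf_mult2[OF s, of x] by (simp only: power_Suc2)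
  ultimately show "neumann x = 1 + x * neumann x" "neumann x = 1 + neumann x * x" by simp_all
qed

lemma neumann_inverse:
  fixes x :: "'m::{real_normed_algebra_1,banach}"
  assumes "norm x < 1"
  shows "(1 - x) * neumann x = 1" "neumann x * (1 - x) = 1"
  using neumann_eq[OF assms] by (simp_all add: algebra_simps)

lemma neumann_unique:
  fixes x :: "'m::{real_normed_algebra_1,banach}"
  assumes "norm x < 1" "(1 - x) * y = z"
  shows "y = neumann x * z"
  using neumann_inverse(2)[OF assms(1)] assms(2) by (metis mult.assoc mult_1)

lemma norm_neumann_le:
  fixes x :: "'m::{real_normed_algebra_1,banach}"
  assumes "norm x \<le> 1/2"
  shows "norm (neumann x) \<le> 2"
proof -
  have "norm (neumann x) = norm (1 + x * neumann x)"
    by (rule arg_cong[OF neumann_eq(1)]) (use assms in simp)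
  also have "\<dots> \<le> norm (1::'m) + norm x * norm (neumann x)"
    by (rule norm_triangle_mono[OF order_refl norm_mult_ineq])
  also have "\<dots> \<le> 1 + 1/2 * norm (neumann x)" using assms by (intro add_mono mult_right_mono) simp_all
  finally show ?thesis by simp
qed

lemma norm_mult3_ineq: "norm (a * b * c) \<le> norm a * norm b * norm (c::'m::real_normed_algebra)"
  by (rule order_trans[OF norm_mult_ineq mult_right_mono[OF norm_mult_ineq norm_ge_zero]])

text \<open>The push-through identity: (1 - x y) x = x (1 - y x), with the two inverses moved
  across.\<close>

lemma neumann_push:
  fixes x y :: "'m::{real_normed_algebra_1,banach}"
  assumes "norm (x * y) < 1" "norm (y * x) < 1"
  shows "neumann (x * y) * x = x * neumann (y * x)"
proof -
  have "(1 - x * y) * (x * neumann (y * x)) = x * ((1 - y * x) * neumann (y * x))"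
    by (simp add: algebra_simps)
  also have "\<dots> = x" by (simp add: neumann_inverse[OF assms(2)])
  finally show ?thesis by (rule neumann_unique[OF assms(1), symmetric])
qed

lemma neumann_diff:
  fixes x y :: "'m::{real_normed_algebra_1,banach}"
  assumes "norm x < 1" "norm y < 1"
  shows "neumann x - neumann y = neumann x * (x - y) * neumann y"
proof -
  have "neumann x * (x - y) * neumann y = neumann x * ((1 - y) * neumann y) - neumann x * (1 - x) * neumann y"
    by (simp add: algebra_simps)
  then show ?thesis by (simp add: neumann_inverse assms)
qed

lemma norm_neumann_diff_le:
  fixes x y :: "'m::{real_normed_algebra_1,banach}"
  assumes "norm x \<le> 1/2" "norm y \<le> 1/2"
  shows "norm (neumann x - neumann y) \<le> 4 * norm (x - y)"
proof -
  have eq: "neumann x - neumann y = neumann x * (x - y) * neumann y"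
    using assms by (intro neumann_diff) simp_all
  have "norm (neumann x - neumann y) \<le> norm (neumann x) * norm (x - y) * norm (neumann y)"
    unfolding eq by (rule norm_mult3_ineq)
  also have "\<dots> \<le> 2 * norm (x - y) * 2"
    using norm_neumann_le[OF assms(1)] norm_neumann_le[OF assms(2)] by (intro mult_mono) simp_all
  finally show ?thesis by simp
qed

lemma bounded_linear_mult_both:
  fixes a b :: "'m::{real_normed_algebra_1,banach}"
  shows "bounded_linear (\<lambda>h. a * h * b)"
  by (rule bounded_linear_compose[OF bounded_linear_mult_left bounded_linear_mult_right])

lemma has_derivative_neumann:
  fixes x :: "'m::{real_normed_algebra_1,banach}"
  assumes "norm x < 1/2"
  shows "(neumann has_derivative (\<lambda>h. neumann x * h * neumann x)) (at x)"
proof (rule has_derivativeI_sandwich[where e = "1/2 - norm x" and H = "\<lambda>y. 8 * norm (y - x)"])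
  fix y assume y: "y \<noteq> x" "dist y x < 1/2 - norm x"
  have "norm y \<le> norm (y - x) + norm x" using norm_triangle_ineq[of "y - x" x] by simp
  with y have ny: "norm y \<le> 1/2" by (simp add: dist_norm)
  \<comment> \<open>Using the resolvent identity twice makes the remainder quadratic. On the ball of
    radius 1/2 the Lipschitz constant 4 and the bound 2 of \<open>neumann\<close> give the factor
    8.\<close>
  have "neumann y - neumann x - neumann x * (y - x) * neumann x
      = (neumann y - neumann x) * (y - x) * neumann x"
    using neumann_diff[of y x] ny assms by (simp add: algebra_simps)
  also have "norm \<dots> \<le> norm (neumann y - neumann x) * norm (y - x) * norm (neumann x)"
    by (rule norm_mult3_ineq)
  also have "\<dots> \<le> (4 * norm (y - x)) * norm (y - x) * 2"
    using norm_neumann_diff_le[OF ny, of x] norm_neumann_le[of x] assms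
    by (intro mult_mono) simp_all
  finally show "norm (neumann y - neumann x - neumann x * (y - x) * neumann x) / norm (y - x) \<le> 8 * norm (y - x)"
    using y by (simp add: divide_le_eq)
next
  have "((\<lambda>y. 8 * norm (y - x)) \<longlongrightarrow> 8 * norm (x - x)) (at x)" by (intro tendsto_intros)
  then show "((\<lambda>y. 8 * norm (y - x)) \<longlongrightarrow> 0) (at x)" by simp
qed (use assms in \<open>simp_all add: bounded_linear_mult_both\<close>)

text \<open>T x = y is the fixed point equation of the contraction y - (T x - x). The estimate ||h||
  \<le> 2 ||T h|| gives injectivity and the bound for the inverse.\<close>

lemma bounded_linear_inverse_near_id:
  fixes T :: "'m::banach \<Rightarrow> 'm"
  assumes T: "bounded_linear T" and near: "\<And>h. norm (T h - h) \<le> 1/2 * norm h"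
  obtains g where "bounded_linear g" "\<And>h. g (T h) = h" "\<And>h. T (g h) = h"
proof -
  interpret T: bounded_linear T by fact
  have lower: "norm h \<le> 2 * norm (T h)" for h
    using near[of h] norm_triangle_ineq2[of h "T h"] norm_minus_commute[of h "T h"]
      norm_triangle_ineq4[of "T h" "T h - h"] by simp
  have inj: "x = y" if "T x = T y" for x y
    using lower[of "x - y"] that by (simp add: T.diff)
  have "\<exists>!x. y - (T x - x) = x" for y
  proof (rule banach_fix_type[of "1/2"])
    show "\<forall>x x'. dist (y - (T x - x)) (y - (T x' - x')) \<le> 1/2 * dist x x'"
    proof (intro allI)
      fix x x'
      have "norm (T (x' - x) - (x' - x)) \<le> 1/2 * norm (x' - x)" by (rule near)
      then show "dist (y - (T x - x)) (y - (T x' - x')) \<le> 1/2 * dist x x'"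
        by (simp add: dist_norm T.diff norm_minus_commute algebra_simps)
    qed
  qed simp_all
  then have "\<exists>x. T x = y" for y by (metis add_diff_cancel_left' diff_add_cancel diff_diff_eq2 diff_eq_eq)
  then obtain g where g: "\<And>y. T (g y) = y" by metis
  have "bounded_linear g"
  proof (rule bounded_linear_intro)
    show "g (x + y) = g x + g y" "g (r *\<^sub>R x) = r *\<^sub>R g x" for x y r
      by (rule inj; simp add: g T.add T.scaleR)+
    show "norm (g x) \<le> norm x * 2" for x using lower[of "g x"] by (simp add: g)
  qed
  with g inj that show thesis by metis
qed

section \<open>The operator-valued Cauchy transform and its inverse\<close>

text \<open>The Banach-algebra content of a conditional expectation onto \<open>D\<close>. It is
  instantiated with families, where one norm estimate covers all matrix sizes; complex scalars are
  recovered through \<open>central\<close>.\<close>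

locale operator_valued =
  fixes D :: "'m::{real_normed_algebra_1,banach} set" and E :: "'m \<Rightarrow> 'm"
  assumes closed_D: "closed D" and one_D: "1 \<in> D"
    and add_D: "\<And>x y. x \<in> D \<Longrightarrow> y \<in> D \<Longrightarrow> x + y \<in> D"
    and mult_D: "\<And>x y. x \<in> D \<Longrightarrow> y \<in> D \<Longrightarrow> x * y \<in> D"
    and scaleR_D: "\<And>x r. x \<in> D \<Longrightarrow> r *\<^sub>R x \<in> D"
    and bounded_linear_E: "bounded_linear E"
    and E_one: "E 1 = 1"
    and E_in_D: "\<And>x. E x \<in> D"
    and E_left: "\<And>b x. b \<in> D \<Longrightarrow> E (b * x) = b * E x"
    and E_right: "\<And>b x. b \<in> D \<Longrightarrow> E (x * b) = E x * b"
begin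

lemma zero_D: "0 \<in> D" using scaleR_D[OF one_D, of 0] by simp
lemma minus_D: "x \<in> D \<Longrightarrow> - x \<in> D" using scaleR_D[of x "-1"] by simp
lemma diff_D: "x \<in> D \<Longrightarrow> y \<in> D \<Longrightarrow> x - y \<in> D" using add_D[of x "-y"] minus_D[of y] by simp

sublocale E: bounded_linear E by (rule bounded_linear_E)

lemma sum_D: "(\<And>i. i \<in> I \<Longrightarrow> f i \<in> D) \<Longrightarrow> sum f I \<in> D"
  by (induction I rule: infinite_finite_induct) (auto intro: zero_D add_D)

lemma power_D: "x \<in> D \<Longrightarrow> x ^ k \<in> D"
  by (induction k) (auto intro: one_D mult_D)

lemma neumann_D:
  assumes "x \<in> D" "norm x < 1"
  shows "neumann x \<in> D"
proof (rule closed_sequentially[OF closed_D])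
  show "(\<lambda>n. \<Sum>k<n. x ^ k) \<longlonglongrightarrow> neumann x"
    unfolding neumann_def by (intro summable_LIMSEQ complete_algebra_summable_geometric assms)
qed (auto intro: sum_D power_D assms)

definition bound_E :: real where "bound_E = onorm E"

lemma norm_E_le: "norm (E x) \<le> bound_E * norm x"
  unfolding bound_E_def by (rule onorm[OF bounded_linear_E])

lemma bound_E_nonneg: "0 \<le> bound_E"
  unfolding bound_E_def by (rule onorm_pos_le[OF bounded_linear_E])

text \<open>\<open>central j\<close> abstracts from multiplication with a complex scalar; derivatives below are
  shown to commute with it, which makes them complex linear.\<close>

definition central :: "'m \<Rightarrow> bool" where
  "central j \<longleftrightarrow> (\<forall>x. j * x = x * j) \<and> (\<forall>x. E (j * x) = j * E x)"

definition cdiff :: "('m \<Rightarrow> 'm) \<Rightarrow> 'm \<Rightarrow> bool" where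
  "cdiff f z \<longleftrightarrow> (\<exists>T. (f has_derivative T) (at z) \<and> (\<forall>j h. central j \<longrightarrow> T (j * h) = j * T h))"

lemma cdiffI: "(f has_derivative T) (at z) \<Longrightarrow> (\<And>j h. central j \<Longrightarrow> T (j * h) = j * T h) \<Longrightarrow> cdiff f z"
  by (auto simp: cdiff_def)

lemma central_commute: "central j \<Longrightarrow> a * (j * b) = j * (a * b)"
  unfolding central_def by (metis mult.assoc)

lemma central_E: "central j \<Longrightarrow> E (j * b) = j * E b"
  unfolding central_def by metis

lemma cdiff_mult:
  assumes "cdiff f z" "cdiff g z"
  shows "cdiff (\<lambda>x. f x * g x) z"
proof -
  obtain S T where ST: "(f has_derivative S) (at z)" "(g has_derivative T) (at z)"
    "\<And>j h. central j \<Longrightarrow> S (j * h) = j * S h" "\<And>j h. central j \<Longrightarrow> T (j * h) = j * T h"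
    using assms by (auto simp: cdiff_def)
  show ?thesis
    by (rule cdiffI[OF has_derivative_mult[OF ST(1,2)]])
      (simp add: ST(3,4) central_commute mult.assoc ring_distribs)
qed

lemma cdiff_minus: "cdiff f z \<Longrightarrow> cdiff (\<lambda>x. - f x) z"
  unfolding cdiff_def by (force intro: has_derivative_minus)

lemma cdiff_compose:
  assumes "cdiff f z" "cdiff g (f z)"
  shows "cdiff (\<lambda>x. g (f x)) z"
proof -
  obtain S T where ST: "(f has_derivative S) (at z)" "(g has_derivative T) (at (f z))"
    "\<And>j h. central j \<Longrightarrow> S (j * h) = j * S h" "\<And>j h. central j \<Longrightarrow> T (j * h) = j * T h"
    using assms by (auto simp: cdiff_def)
  show ?thesis
    by (rule cdiffI[OF has_derivative_compose[OF ST(1,2)]]) (simp add: ST(3,4))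
qed

lemma cdiff_neumann: "norm z < 1/2 \<Longrightarrow> cdiff neumann z"
  by (rule cdiffI[OF has_derivative_neumann]) (simp_all add: central_commute mult.assoc)

end

locale cauchy_setting = operator_valued D E for D :: "'m::{real_normed_algebra_1,banach} set" and E +
  fixes Y :: 'm
begin

definition F :: "'m \<Rightarrow> 'm" where "F w = E (Y * neumann (w * Y))"

text \<open>For \<open>w\<close> in \<open>D\<close> this is E[w (1 - Y w)^{-1}], after splitting
  off the constant term and pulling both outer factors out of \<open>E\<close>. The form makes
  \<open>G\<close> a perturbation of the identity, defined on the whole algebra.\<close>

definition G :: "'m \<Rightarrow> 'm" where "G w = w + w * F w * w"

definition L :: real where "L = bound_E * norm Y"

text \<open>Chosen so that \<open>rad * norm Y\<close> and \<open>rad * L\<close> are at most 1/12,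
  which makes w F(w) w Lipschitz with constant 1/2 on the ball of radius \<open>rad\<close>. The
  summands 1 avoid division by zero.\<close>

definition rad :: real where "rad = 1 / (12 * (bound_E + 1) * (norm Y + 1))"

lemma L_nonneg: "0 \<le> L" by (simp add: L_def bound_E_nonneg)

lemma rad_pos: "0 < rad"
  using bound_E_nonneg by (simp add: rad_def add_nonneg_pos)

lemma rad_bounds: "rad * norm Y \<le> 1/12" "rad * L \<le> 1/12"
proof -
  have *: "rad * ((bound_E + 1) * (norm Y + 1)) = 1/12"
    using bound_E_nonneg by (simp add: rad_def field_simps add_nonneg_eq_0_iff)
  have "norm Y \<le> (bound_E + 1) * (norm Y + 1)" "L \<le> (bound_E + 1) * (norm Y + 1)"
    using bound_E_nonneg by (simp_all add: L_def algebra_simps)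
  with * rad_pos show "rad * norm Y \<le> 1/12" "rad * L \<le> 1/12"
    by (metis less_imp_le mult_left_mono)+
qed

lemma norm_wY: "norm w \<le> rad \<Longrightarrow> norm (w * Y) \<le> 1/12"
  using rad_bounds(1) by (meson norm_mult_ineq mult_right_mono norm_ge_zero order_trans)

lemma norm_F_le:
  assumes "norm w \<le> rad"
  shows "norm (F w) \<le> 2 * L"
proof -
  have n: "norm (neumann (w * Y)) \<le> 2" by (rule norm_neumann_le) (use norm_wY[OF assms] in simp)
  have "norm (F w) \<le> bound_E * norm (Y * neumann (w * Y))" unfolding F_def by (rule norm_E_le)
  also have "\<dots> \<le> bound_E * (norm Y * norm (neumann (w * Y)))"
    by (intro mult_left_mono bound_E_nonneg norm_mult_ineq)
  also have "\<dots> \<le> bound_E * (norm Y * 2)" by (intro mult_left_mono bound_E_nonneg n) simp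
  finally show ?thesis by (simp add: L_def)
qed

lemma norm_wF:
  assumes "norm w \<le> rad"
  shows "norm (w * F w) \<le> 1/6" "norm (F w * w) \<le> 1/6"
proof -
  have "norm w * norm (F w) \<le> rad * (2 * L)"
    using assms norm_F_le[OF assms] rad_pos by (intro mult_mono) simp_all
  also have "\<dots> \<le> 1/6" using rad_bounds(2) by simp
  finally have "norm w * norm (F w) \<le> 1/6" .
  then show "norm (w * F w) \<le> 1/6" "norm (F w * w) \<le> 1/6"
    using norm_mult_ineq[of w "F w"] norm_mult_ineq[of "F w" w] by (simp_all add: mult.commute)
qed

lemma norm_F_diff_le:
  assumes "norm w \<le> rad" "norm w' \<le> rad"
  shows "norm (F w - F w') \<le> 4 * L * norm Y * norm (w - w')"
proof -
  have "F w - F w' = E (Y * (neumann (w * Y) - neumann (w' * Y)))"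
    by (simp add: F_def E.diff right_diff_distrib)
  also have "norm \<dots> \<le> bound_E * norm (Y * (neumann (w * Y) - neumann (w' * Y)))" by (rule norm_E_le)
  also have "\<dots> \<le> bound_E * (norm Y * norm (neumann (w * Y) - neumann (w' * Y)))"
    by (intro mult_left_mono bound_E_nonneg norm_mult_ineq)
  also have "\<dots> \<le> bound_E * (norm Y * (4 * norm (w * Y - w' * Y)))"
    by (intro mult_left_mono bound_E_nonneg norm_neumann_diff_le)
      (use norm_wY[OF assms(1)] norm_wY[OF assms(2)] in simp_all)
  also have "\<dots> \<le> bound_E * (norm Y * (4 * (norm (w - w') * norm Y)))"
    by (intro mult_left_mono bound_E_nonneg) (simp_all add: norm_mult_ineq flip: left_diff_distrib)
  finally show ?thesis by (simp add: L_def mult_ac)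
qed

text \<open>The three terms of the product rule for w F(w) w, which occur both as a difference
  (\<open>norm_G_diff\<close>) and as a derivative (\<open>cdiff_K\<close>). They contribute at most
  1/6, 1/36 and 1/6 times \<open>t\<close>.\<close>

lemma triple_bound:
  fixes w w' f f' g h :: 'm
  assumes "norm w \<le> rad" "norm f \<le> 2 * L" "norm w' \<le> rad"
    and "norm g \<le> 4 * L * norm Y * t" "norm h \<le> t" "norm f' \<le> 2 * L"
  shows "norm (h * f * w + w' * g * w + w' * f' * h) \<le> 1/2 * t"
proof -
  have t: "0 \<le> t" using assms(5) norm_ge_zero order_trans by blast
  have "norm h * norm f * norm w \<le> t * (2 * L) * rad"
    using assms L_nonneg t by (intro mult_mono mult_nonneg_nonneg) auto
  moreover have "norm w' * norm g * norm w \<le> rad * (4 * L * norm Y * t) * rad"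
    using assms L_nonneg t rad_pos by (intro mult_mono mult_nonneg_nonneg) auto
  moreover have "norm w' * norm f' * norm h \<le> rad * (2 * L) * t"
    using assms L_nonneg t rad_pos by (intro mult_mono mult_nonneg_nonneg) auto
  moreover note norm_mult3_ineq[of h f w] norm_mult3_ineq[of w' g w] norm_mult3_ineq[of w' f' h]
  moreover have "rad * (2 * L) * t \<le> 1/6 * t" using rad_bounds(2) t by (intro mult_right_mono) simp_all
  moreover have "(rad * L) * (rad * norm Y) \<le> 1/12 * (1/12)"
    using rad_bounds rad_pos L_nonneg by (intro mult_mono) simp_all
  then have "4 * ((rad * L) * (rad * norm Y)) * t \<le> 1/36 * t" using t by (intro mult_right_mono) simp_all
  then have "rad * (4 * L * norm Y * t) * rad \<le> 1/36 * t" by (simp add: mult_ac)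
  ultimately have "norm (h * f * w) + norm (w' * g * w) + norm (w' * f' * h) \<le> 1/2 * t"
    using t by (simp add: mult_ac)
  then show ?thesis by (intro order_trans[OF norm_triangle_le[OF add_mono[OF norm_triangle_ineq order_refl]]]) auto
qed

lemma norm_G_diff:
  assumes "norm w \<le> rad" "norm w' \<le> rad"
  shows "norm ((w * F w * w) - (w' * F w' * w')) \<le> 1/2 * norm (w - w')"
proof -
  have "(w * F w * w) - (w' * F w' * w')
      = (w - w') * F w * w + w' * (F w - F w') * w + w' * F w' * (w - w')"
    by (simp add: algebra_simps)
  then show ?thesis
    using triple_bound[OF assms(1) norm_F_le[OF assms(1)] assms(2) norm_F_diff_le[OF assms] order_refl norm_F_le[OF assms(2)]]
    by simp
qed

lemma G_lower:
  assumes "norm w \<le> rad" "norm w' \<le> rad"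
  shows "norm (w - w') \<le> 2 * norm (G w - G w')"
proof -
  have "w - w' = (G w - G w') - ((w * F w * w) - (w' * F w' * w'))" by (simp add: G_def)
  then have "norm (w - w') \<le> norm (G w - G w') + norm ((w * F w * w) - (w' * F w' * w'))"
    by (metis norm_triangle_ineq4)
  with norm_G_diff[OF assms] show ?thesis by simp
qed

lemma G_zero: "G 0 = 0" by (simp add: G_def)

text \<open>Banach's fixed point theorem for z - w F(w) w on the part of the ball in
  \<open>S\<close>. Taking \<open>S\<close> to be the whole algebra gives existence; taking it to be
  \<open>D\<close> shows that the inverse maps \<open>D\<close> into itself.\<close>

lemma G_surj:
  assumes z: "norm z \<le> rad / 2" and S: "closed S" "0 \<in> S" "z \<in> S"
    "\<And>w. w \<in> S \<Longrightarrow> norm w \<le> rad \<Longrightarrow> z - w * F w * w \<in> S"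
  shows "\<exists>w\<in>S. norm w \<le> rad \<and> G w = z"
proof -
  let ?S = "cball 0 rad \<inter> S"
  have "\<exists>!w\<in>?S. z - w * F w * w = w"
  proof (rule Banach_fix[of _ "1/2"])
    show "complete ?S" using S by (simp add: closed_Int complete_eq_closed)
    have "0 \<in> ?S" using S rad_pos by simp
    then show "?S \<noteq> {}" by blast
    show "(\<lambda>w. z - w * F w * w) ` ?S \<subseteq> ?S"
    proof (intro image_subsetI)
      fix w assume "w \<in> ?S"
      then have w: "norm w \<le> rad" "w \<in> S" by auto
      have "norm (z - w * F w * w) \<le> norm z + norm (w * F w * w)" by (rule norm_triangle_ineq4)
      also have "\<dots> \<le> rad / 2 + 1/2 * rad"
        using z w norm_G_diff[OF w(1), of 0] rad_pos by (intro add_mono) simp_all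
      finally show "z - w * F w * w \<in> ?S" using S w by simp
    qed
    show "dist (z - x * F x * x) (z - y * F y * y) \<le> 1/2 * dist x y" if "x \<in> ?S" "y \<in> ?S" for x y
      using norm_G_diff[of x y] that by (simp add: dist_norm norm_minus_commute)
  qed simp_all
  then obtain w where "w \<in> ?S" "z - w * F w * w = w" by blast
  then show ?thesis by (intro bexI[of _ w]) (auto simp: G_def algebra_simps)
qed

definition K :: "'m \<Rightarrow> 'm" where "K z = (THE w. norm w \<le> rad \<and> G w = z)"

lemma K_eqI:
  assumes "norm w \<le> rad" "G w = z"
  shows "K z = w"
  unfolding K_def
proof (rule the_equality)
  fix w' assume "norm w' \<le> rad \<and> G w' = z"
  with G_lower[of w' w] assms show "w' = w" by simp
qed (use assms in simp)

lemma K: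
  assumes "norm z \<le> rad / 2"
  shows "norm (K z) \<le> rad" "G (K z) = z" "norm (K z) \<le> 2 * norm z"
proof -
  obtain w where w: "norm w \<le> rad" "G w = z" using G_surj[OF assms, of UNIV] by auto
  with K_eqI show 1: "norm (K z) \<le> rad" "G (K z) = z" by metis+
  show "norm (K z) \<le> 2 * norm z" using G_lower[OF 1(1), of 0] 1 rad_pos by (simp add: G_zero)
qed

lemma F_D: "F w \<in> D" by (simp add: F_def E_in_D)

lemma K_D:
  assumes "norm z \<le> rad / 2" "z \<in> D"
  shows "K z \<in> D"
proof -
  obtain w where "norm w \<le> rad" "G w = z" "w \<in> D"
    using G_surj[OF assms(1) closed_D zero_D assms(2)] by (metis F_D diff_D mult_D assms(2))
  with K_eqI show ?thesis by metis
qed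

lemma K_lipschitz:
  assumes "norm z \<le> rad / 2" "norm z' \<le> rad / 2"
  shows "norm (K z - K z') \<le> 2 * norm (z - z')"
  using G_lower[OF K(1)[OF assms(1)] K(1)[OF assms(2)]]
  by (simp only: K(2)[OF assms(1)] K(2)[OF assms(2)])

text \<open>With w = K z and f = F w one has z = (1 + w f) w, and for invertible \<open>z\<close>
  the difference w^{-1} - z^{-1} equals f (1 + w f)^{-1}. The latter makes sense for all small
  \<open>z\<close>.\<close>

definition R :: "'m \<Rightarrow> 'm" where "R z = F (K z) * neumann (- (K z * F (K z)))"

lemma R_D:
  assumes "norm z \<le> rad / 2" "z \<in> D"
  shows "R z \<in> D"
  unfolding R_def using norm_wF(1)[OF K(1)[OF assms(1)]]
  by (intro mult_D F_D neumann_D minus_D K_D assms) simp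

lemma R_props:
  assumes z: "norm z \<le> rad / 2"
  shows "z * R z = K z * F (K z)" "R z * (1 + K z * F (K z)) = F (K z)"
    "(1 + z * R z) * K z = z" "norm (R z) \<le> 4 * L"
    "K z = neumann (- (K z * F (K z))) * z" "K z * (1 + F (K z) * K z) = z"
proof -
  define w f where "w = K z" and "f = F w"
  have w: "norm w \<le> rad" "G w = z" using K[OF z] by (simp_all add: w_def)
  have n: "norm (- (w * f)) < 1" using norm_wF(1)[OF w(1)] by (simp add: f_def)
  have inv: "(1 + w * f) * neumann (- (w * f)) = 1" "neumann (- (w * f)) * (1 + w * f) = 1"
    using neumann_inverse[OF n] by simp_all
  have zw: "z = (1 + w * f) * w" "w * (1 + f * w) = z"
    using w(2) by (simp_all add: G_def f_def algebra_simps)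
  have r: "R z = f * neumann (- (w * f))" by (simp add: R_def w_def f_def)
  have "z * R z = ((1 + w * f) * w) * (f * neumann (- (w * f)))"
    by (rule arg_cong2[of _ _ _ _ "(*)", OF zw(1) r])
  also have "\<dots> = (w * f) * ((1 + w * f) * neumann (- (w * f)))" by (simp add: algebra_simps)
  finally have zr: "z * R z = w * f" by (simp add: inv)
  then show "z * R z = K z * F (K z)" by (simp add: w_def f_def)
  show "R z * (1 + K z * F (K z)) = F (K z)"
    unfolding w_def[symmetric] f_def[symmetric] r by (simp add: mult.assoc inv)
  show "(1 + z * R z) * K z = z" unfolding zr w_def[symmetric] by (simp add: zw(1)[symmetric])
  show "K z = neumann (- (K z * F (K z))) * z"
  proof -
    have "neumann (- (w * f)) * z = neumann (- (w * f)) * ((1 + w * f) * w)"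
      by (rule arg_cong[OF zw(1)])
    also have "\<dots> = w" by (simp add: mult.assoc[symmetric] inv)
    finally show ?thesis by (simp add: w_def f_def)
  qed
  show "K z * (1 + F (K z) * K z) = z" using zw(2) by (simp add: w_def f_def)
  have "norm (R z) \<le> norm f * norm (neumann (- (w * f)))" unfolding r by (rule norm_mult_ineq)
  also have "\<dots> \<le> (2 * L) * 2"
    using norm_F_le[OF w(1)] norm_wF(1)[OF w(1)] L_nonneg
    by (intro mult_mono norm_neumann_le) (simp_all add: f_def)
  finally show "norm (R z) \<le> 4 * L" by simp
qed

lemma cdiff_F:
  assumes "norm w \<le> rad"
  shows "cdiff F w"
proof -
  have "cdiff (\<lambda>w. w * Y) w"
    by (rule cdiffI[of _ "\<lambda>h. h * Y"]) (auto intro!: derivative_eq_intros simp: mult.assoc)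
  then have "cdiff (\<lambda>w. neumann (w * Y)) w"
    by (rule cdiff_compose[where g = neumann]) (use norm_wY[OF assms] in \<open>simp add: cdiff_neumann\<close>)
  moreover have "cdiff (\<lambda>x. E (Y * x)) x" for x
    by (rule cdiffI[of _ "\<lambda>h. E (Y * h)"])
      (auto intro!: derivative_eq_intros E.has_derivative simp: central_commute central_E)
  ultimately show ?thesis unfolding F_def[abs_def] by (rule cdiff_compose[where g = "\<lambda>x. E (Y * x)"])
qed

text \<open>The derivative \<open>T\<close> of \<open>G\<close> is within 1/2 of the identity, hence
  invertible, and \<open>K\<close> is Lipschitz, so the inverse function rule applies. The inverse
  of a map commuting with central elements commutes with them too.\<close>

lemma cdiff_K:
  assumes z: "norm z < rad / 2"
  shows "cdiff K z"
proof -
  define w where "w = K z"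
  have w: "norm w \<le> rad" using K(1)[of z] z by (simp add: w_def)
  let ?n = "neumann (w * Y)"
  have dn: "((\<lambda>w. neumann (w * Y)) has_derivative (\<lambda>h. ?n * (h * Y) * ?n)) (at w)"
    by (rule has_derivative_compose[where f = "\<lambda>w. w * Y", OF _ has_derivative_neumann])
      (use norm_wY[OF w] in \<open>auto intro!: derivative_eq_intros\<close>)
  define DF where "DF h = E (Y * (?n * (h * Y) * ?n))" for h
  have DF: "(F has_derivative DF) (at w)"
    unfolding F_def[abs_def] DF_def
    by (rule E.has_derivative) (auto intro!: derivative_eq_intros dn)
  have DFj: "DF (j * h) = j * DF h" if "central j" for j h
    by (simp add: DF_def central_commute[OF that] central_E[OF that] mult.assoc)
  define T where "T h = h + (h * F w * w + w * DF h * w + w * F w * h)" for h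
  have T: "(G has_derivative T) (at w)"
    unfolding G_def[abs_def] T_def
    by (auto intro!: derivative_eq_intros DF simp: algebra_simps)
  have Tj: "T (j * h) = j * T h" if "central j" for j h
    by (simp add: T_def DFj[OF that] central_commute[OF that] mult.assoc ring_distribs)
  have DFn: "norm (DF h) \<le> 4 * L * norm Y * norm h" for h
  proof -
    have n: "norm ?n \<le> 2" using norm_wY[OF w] by (intro norm_neumann_le) simp
    have "norm (DF h) \<le> bound_E * norm (Y * (?n * (h * Y) * ?n))" unfolding DF_def by (rule norm_E_le)
    also have "\<dots> \<le> bound_E * (norm Y * (2 * (norm h * norm Y) * 2))"
      by (intro mult_left_mono bound_E_nonneg order_trans[OF norm_mult_ineq] mult_mono n mult_nonneg_nonneg norm_ge_zero) simp_all
    finally show ?thesis by (simp add: L_def mult_ac)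
  qed
  have near: "norm (T h - h) \<le> 1/2 * norm h" for h
    unfolding T_def add_diff_cancel_left'
    by (rule triple_bound[OF w norm_F_le[OF w] w DFn order_refl norm_F_le[OF w]])
  have bT: "bounded_linear T" using T by (rule has_derivative_bounded_linear)
  obtain g where g: "bounded_linear g" "\<And>h. g (T h) = h" "\<And>h. T (g h) = h"
    by (rule bounded_linear_inverse_near_id[OF bT near]) blast
  have "(K has_derivative g) (at z)"
  proof (rule has_derivative_inverse_basic[where f = G and T = "ball 0 (rad/2)"])
    show "(G has_derivative T) (at (K z))" using T by (simp add: w_def)
    show "g \<circ> T = id" using g by auto
    show "continuous (at z) K"
      unfolding isCont_def
    proof (rule LIM_zero_cancel, rule Lim_null_comparison)
      show "\<forall>\<^sub>F x in at z. norm (K x - K z) \<le> 2 * norm (x - z)"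
        unfolding eventually_at
      proof (intro exI[of _ "rad/2 - norm z"] conjI ballI impI)
        fix x assume "x \<noteq> z \<and> dist x z < rad / 2 - norm z"
        then have "norm x \<le> rad / 2" using norm_triangle_ineq[of "x - z" z] by (simp add: dist_norm)
        then show "norm (K x - K z) \<le> 2 * norm (x - z)" using K_lipschitz z by simp
      qed (use z in simp)
      have "((\<lambda>x. 2 * norm (x - z)) \<longlongrightarrow> 2 * norm (z - z)) (at z)" by (intro tendsto_intros)
      then show "((\<lambda>x. 2 * norm (x - z)) \<longlongrightarrow> 0) (at z)" by simp
    qed
  qed (use z K(2) g in auto)
  moreover have "g (j * h) = j * g h" if "central j" for j h
    by (metis Tj[OF that] g(2,3))
  ultimately show ?thesis by (rule cdiffI)
qed

lemma cdiff_R: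
  assumes z: "norm z < rad / 2"
  shows "cdiff R z"
proof -
  have w: "norm (K z) \<le> rad" using K(1) z by simp
  have FK: "cdiff (\<lambda>z. F (K z)) z" by (rule cdiff_compose[OF cdiff_K[OF z] cdiff_F[OF w]])
  have "cdiff (\<lambda>z. neumann (- (K z * F (K z)))) z"
    by (rule cdiff_compose[where g = neumann, OF cdiff_minus[OF cdiff_mult[OF cdiff_K[OF z] FK]] cdiff_neumann])
      (use norm_wF(1)[OF w] in simp)
  with FK show ?thesis unfolding R_def[abs_def] by (rule cdiff_mult)
qed

text \<open>Derivatives are taken in the ambient algebra, but analyticity on matrices over
  \<open>B\<close> asks for a derivative with values over \<open>B\<close>. It is a limit of
  difference quotients along h / (k + 1), and these lie in the closed set \<open>D\<close>.\<close>

lemma cdiff_derivative_D: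
  assumes "(f has_derivative T) (at z)" and f: "\<And>x. x \<in> D \<Longrightarrow> norm x < e \<Longrightarrow> f x \<in> D"
    and z: "z \<in> D" "norm z < e" and h: "h \<in> D"
  shows "T h \<in> D"
proof -
  interpret T: bounded_linear T using assms(1) by (rule has_derivative_bounded_linear)
  show ?thesis
  proof (cases "h = 0")
    case False
    define S where "S = (\<lambda>k. inverse (real (Suc k)) *\<^sub>R h)"
    have S0: "S \<longlonglongrightarrow> 0"
      unfolding S_def using tendsto_scaleR[OF LIMSEQ_inverse_real_of_nat tendsto_const[of h]] by simp
    have "(\<lambda>h. norm (f (z + h) - f z - T h) / norm h) \<midarrow>0\<rightarrow> 0"
      using assms(1) by (simp add: has_derivative_at)
    moreover have "\<And>k. S k \<noteq> 0" using False by (simp add: S_def)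
    then have "filterlim S (at 0) sequentially" using S0 by (simp add: filterlim_at)
    ultimately have "(\<lambda>k. norm (f (z + S k) - f z - T (S k)) / norm (S k)) \<longlonglongrightarrow> 0"
      by (rule filterlim_compose)
    from tendsto_mult_right[OF this, of "norm h"]
    have "(\<lambda>k. norm (f (z + S k) - f z - T (S k)) / norm (S k) * norm h) \<longlonglongrightarrow> 0" by simp
    moreover have "norm (f (z + S k) - f z - T (S k)) / norm (S k) * norm h
        = norm (real (Suc k) *\<^sub>R (f (z + S k) - f z) - T h)" for k
    proof -
      have "T h = real (Suc k) *\<^sub>R T (S k)" by (simp add: S_def T.scaleR)
      then have "norm (real (Suc k) *\<^sub>R (f (z + S k) - f z) - T h)
          = real (Suc k) * norm (f (z + S k) - f z - T (S k))"
        by (simp only: scaleR_right_diff_distrib[symmetric] norm_scaleR abs_of_nat)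
      then show ?thesis using False by (simp add: S_def field_simps)
    qed
    ultimately have "(\<lambda>k. norm (real (Suc k) *\<^sub>R (f (z + S k) - f z) - T h)) \<longlonglongrightarrow> 0" by simp
    then have lim: "(\<lambda>k. real (Suc k) *\<^sub>R (f (z + S k) - f z)) \<longlonglongrightarrow> T h"
      using LIM_zero_iff tendsto_norm_zero_iff by blast
    have "\<forall>\<^sub>F k in sequentially. dist (S k) 0 < e - norm z"
      using S0 z(2) by (intro tendstoD) simp_all
    then have "\<forall>\<^sub>F k in sequentially. real (Suc k) *\<^sub>R (f (z + S k) - f z) \<in> D"
    proof eventually_elim
      case (elim k)
      have "norm (z + S k) < e" using elim norm_triangle_ineq[of z "S k"] by simp
      then have "f (z + S k) \<in> D" using z h by (intro f add_D) (auto simp: S_def scaleR_D)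
      then show ?case using f[OF z] by (intro scaleR_D diff_D)
    qed
    then show ?thesis using Lim_in_closed_set[OF closed_D _ _ lim] by simp
  next
    case True
    then show ?thesis by (simp add: T.zero zero_D)
  qed
qed

end

section \<open>The free compression\<close>

context cauchy_setting
begin

text \<open>\<open>1 + a z\<close> is the inverse of \<open>1 - (Y - R z) z\<close>.\<close>

lemma centered_resolvent:
  assumes z: "norm z \<le> rad / 2" "z \<in> D" and small: "norm (z * (Y - R z)) < 1" "norm (R z * z) < 1"
  defines "a \<equiv> (Y - R z) * neumann (z * (Y - R z))"
  shows "E a = 0"
proof -
  define w r u where "w = K z" and "r = R z" and "u = neumann (z * (Y - r))"
  have wr: "norm w \<le> rad" using K(1)[OF z(1)] by (simp add: w_def)
  have rD: "r \<in> D" using R_D[OF z] by (simp add: r_def)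
  have zr: "z * r = w * F w" "r * (1 + w * F w) = F w" "(1 + z * r) * w = z"
    using R_props[OF z(1)] by (simp_all add: w_def r_def)
  have n1: "norm (z * (Y - r)) < 1" using small by (simp add: r_def)
  have u: "(1 - z * (Y - r)) * u = 1" "u * (1 - z * (Y - r)) = 1" "u = 1 + z * (Y - r) * u"
    using neumann_inverse[OF n1] neumann_eq(1)[OF n1] by (simp_all add: u_def mult.assoc)
  have "norm (w * Y) < 1" using norm_wY[OF wr] by simp
  \<comment> \<open>(1 + z r) w = z turns the product into 1 - z (Y - r), so the inverse of 1 - w Y
    is u (1 + z r). Comparing F w = E(Y u) (1 + z r) with r (1 + z r) = F w and cancelling the
    invertible factor gives E(Y u) = r.\<close>
  moreover have "(1 + z * r) * (1 - w * Y) = 1 + z * r - ((1 + z * r) * w) * Y" by (simp add: algebra_simps)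
  then have "(1 + z * r) * (1 - w * Y) = 1 - z * (Y - r)" unfolding zr(3) by (simp add: algebra_simps)
  then have "u * (1 + z * r) * (1 - w * Y) = 1" using u(2) by (simp add: mult.assoc)
  ultimately have nw: "neumann (w * Y) = u * (1 + z * r)"
    using neumann_inverse(1) by (metis mult.assoc mult.right_neutral mult_1)
  have zrD: "1 + z * r \<in> D" by (intro add_D mult_D one_D z rD)
  have "F w = E (Y * u) * (1 + z * r)"
    unfolding F_def nw by (simp only: mult.assoc[symmetric] E_right[OF zrD])
  moreover have "r * (1 + z * r) = F w" using zr by simp
  moreover have "norm (- (w * F w)) < 1" using norm_wF(1)[OF wr] by simp
  then have "(1 + z * r) * neumann (- (w * F w)) = 1"
    using neumann_inverse(1)[of "- (w * F w)"] by (simp add: zr(1))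
  ultimately have EYu: "E (Y * u) = r" by (metis mult.assoc mult.right_neutral)
  have a: "a = Y * u - r * u" by (simp add: a_def u_def r_def left_diff_distrib)
  have "u = 1 + z * a" using u(3) by (simp add: a algebra_simps)
  then have "E u = E 1 + E (z * a)" by (metis E.add)
  then have Eu: "E u = 1 + z * E a" by (simp add: E_left[OF z(2)] E_one)
  \<comment> \<open>Together with E u = 1 + z E a this is the homogeneous equation (1 + r z) E a =
    0, whose only solution is 0 as ||r z|| < 1.\<close>
  have "E a = r - r * E u" using E_left[OF rD, of u] by (simp add: a E.diff EYu)
  then have "E a = - (r * z * E a)" unfolding Eu by (simp add: algebra_simps)
  then have "E a + r * z * E a = 0" by (simp only: eq_neg_iff_add_eq_0)
  then have "(1 - - (r * z)) * E a = 0" by (simp add: algebra_simps)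
  then show ?thesis using neumann_unique[of "- (r * z)" "E a" 0] small by (simp add: r_def)
qed

lemma E_neumann_eq_0:
  assumes "norm c < 1" "\<And>k. E (x * c ^ k * y) = 0"
  shows "E (x * neumann c * y) = 0"
proof -
  have "(\<lambda>n. E (x * (\<Sum>k<n. c ^ k) * y)) \<longlonglongrightarrow> E (x * neumann c * y)"
    unfolding neumann_def
    by (intro E.tendsto tendsto_intros summable_LIMSEQ complete_algebra_summable_geometric assms)
  moreover have "E (x * (\<Sum>k<n. c ^ k) * y) = 0" for n
    by (simp add: sum_distrib_left sum_distrib_right E.sum assms)
  ultimately show ?thesis by (simp add: LIMSEQ_const_iff)
qed

text \<open>Freeness is available on the algebra \<open>P\<close>, which is not assumed closed,
  while the resolvent is only a limit of its elements. Partial sums lie in \<open>P\<close>, and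
  subtracting their expectations keeps them in \<open>P\<close> because \<open>P\<close> contains
  \<open>D\<close>. The limit does not change, since it is centered itself.\<close>

lemma free_words_closure:
  assumes P: "D \<subseteq> P" "Y \<in> P" "\<And>x y. x \<in> P \<Longrightarrow> y \<in> P \<Longrightarrow> x + y \<in> P"
      "\<And>x y. x \<in> P \<Longrightarrow> y \<in> P \<Longrightarrow> x - y \<in> P" "\<And>x y. x \<in> P \<Longrightarrow> y \<in> P \<Longrightarrow> x * y \<in> P"
    and word: "\<And>a. a \<in> P \<Longrightarrow> E a = 0 \<Longrightarrow> E (f a) = 0" "\<And>a. isCont f a"
    and z: "z \<in> D" "r \<in> D" "norm (z * (Y - r)) < 1"
    and a: "E ((Y - r) * neumann (z * (Y - r))) = 0"
  shows "E (f ((Y - r) * neumann (z * (Y - r)))) = 0"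
proof -
  define a where "a = (Y - r) * neumann (z * (Y - r))"
  define b where "b = (\<lambda>m. (Y - r) * (\<Sum>k<m. (z * (Y - r)) ^ k))"
  have YrP: "Y - r \<in> P" using P z by auto
  have powP: "(z * (Y - r)) ^ k \<in> P" for k
    by (induction k) (use P z YrP one_D in auto)
  have "(\<Sum>k<m. (z * (Y - r)) ^ k) \<in> P" for m
    by (induction m) (use P powP zero_D in auto)
  then have bP: "b m \<in> P" for m unfolding b_def by (intro P(5) YrP)
  define c where "c = (\<lambda>m. b m - E (b m))"
  have cP: "c m \<in> P" for m unfolding c_def using bP E_in_D P by blast
  have Ec: "E (c m) = 0" for m
    using E_left[OF E_in_D, of "b m" 1] by (simp add: c_def E.diff E_one)
  have "b \<longlonglongrightarrow> a"
    unfolding b_def a_def neumann_def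
    by (intro tendsto_intros summable_LIMSEQ complete_algebra_summable_geometric z)
  then have "c \<longlonglongrightarrow> a - E a" unfolding c_def by (intro tendsto_diff E.tendsto)
  then have "c \<longlonglongrightarrow> a" using a by (simp add: a_def)
  then have "(\<lambda>m. f (c m)) \<longlonglongrightarrow> f a" using word(2)[of a] by (rule isCont_tendsto_compose[rotated])
  then have "(\<lambda>m. E (f (c m))) \<longlonglongrightarrow> E (f a)" by (rule E.tendsto)
  then show ?thesis by (simp add: word(1)[OF cP Ec] LIMSEQ_const_iff a_def)
qed

lemma free_compression_at:
  fixes V V' z :: 'm and \<eta> :: "'m \<Rightarrow> 'm"
  assumes eta: "\<And>b. b \<in> D \<Longrightarrow> \<eta> b \<in> D"
    and VV: "\<And>b b'. b \<in> D \<Longrightarrow> b' \<in> D \<Longrightarrow> V * b * V' * b' * V = V * b * \<eta> b'"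
    and EV: "\<And>b. b \<in> D \<Longrightarrow> E (V * b * V') = b"
    and P: "D \<subseteq> P" "Y \<in> P" "\<And>x y. x \<in> P \<Longrightarrow> y \<in> P \<Longrightarrow> x + y \<in> P"
      "\<And>x y. x \<in> P \<Longrightarrow> y \<in> P \<Longrightarrow> x - y \<in> P" "\<And>x y. x \<in> P \<Longrightarrow> y \<in> P \<Longrightarrow> x * y \<in> P"
    and Q: "D \<subseteq> Q" "V \<in> Q" "V' \<in> Q" "\<And>x y. x \<in> Q \<Longrightarrow> y \<in> Q \<Longrightarrow> x - y \<in> Q"
      "\<And>x y. x \<in> Q \<Longrightarrow> y \<in> Q \<Longrightarrow> x * y \<in> Q"
    and free: "\<And>a s k. a \<in> P \<Longrightarrow> E a = 0 \<Longrightarrow> s \<in> Q \<Longrightarrow> E s = 0 \<Longrightarrow>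
      E (a * s * (a * s) ^ k) = 0 \<and> E ((a * s) ^ k * a) = 0 \<and> E (s * (a * s) ^ k) = 0 \<and> E (s * (a * s) ^ k * a) = 0"
    and z: "z \<in> D" "norm z \<le> rad / 2"
  defines "h \<equiv> \<eta> (R z)"
  defines "k \<equiv> z * neumann (- (h * z))"
  defines "T \<equiv> V * k * V'"
  defines "a \<equiv> (Y - R z) * neumann (z * (Y - R z))"
  assumes small: "norm (h * z) < 1" "norm (z * (Y - R z)) < 1" "norm (R z * z) < 1"
    "norm (a * (V * z * V' - z)) < 1" "norm (Y * T) < 1" "norm (T * Y) < 1" "norm (V' * Y * V * k) < 1"
  shows "E (V * (k * neumann (V' * Y * V * k)) * V') = z"
proof -
  define r S s u where "r = R z" and "S = V * z * V'" and "s = S - z" and "u = neumann (z * (Y - r))"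
  have rD: "r \<in> D" unfolding r_def by (rule R_D[OF z(2,1)])
  have hD: "h \<in> D" unfolding h_def by (intro eta R_D z)
  have nh: "norm (- (h * z)) < 1" using small by simp
  have kD: "k \<in> D" unfolding k_def by (intro mult_D neumann_D minus_D z hD nh)
  have inv: "(1 + h * z) * neumann (- (h * z)) = 1" "neumann (- (h * z)) * (1 + h * z) = 1"
    using neumann_inverse[OF nh] by simp_all
  have k1: "k + k * h * z = z"
  proof -
    have "k + k * h * z = z * (neumann (- (h * z)) * (1 + h * z))" by (simp add: k_def algebra_simps)
    then show ?thesis by (simp add: inv)
  qed
  \<comment> \<open>Here \<eta> enters: the relation for \<open>V\<close> absorbs
    \<open>V' * r * V\<close> into h = \<eta>(r), and k (1 + h z) = z does the rest.\<close>
  have "T * r * S = (V * k * V' * r * V) * z * V'" by (simp add: T_def S_def mult.assoc)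
  also have "\<dots> = V * (k * h * z) * V'" by (simp only: VV[OF kD rD]) (simp add: h_def r_def mult.assoc)
  finally have "T + T * r * S = V * (k + k * h * z) * V'" by (simp add: T_def algebra_simps)
  then have STS: "S = T + T * r * S" unfolding k1 by (simp add: S_def)
  have au: "a = (Y - r) * u" "u = 1 + z * a"
    using neumann_eq(1)[OF small(2)] by (simp_all add: a_def u_def r_def mult.assoc)
  have au3: "u * (z * (Y - r)) = u - 1"
    using neumann_eq(2)[OF small(2)] unfolding u_def r_def by (metis add_diff_cancel_left')
  have a1: "a = (Y - r) + (Y - r) * z * a"
  proof -
    have "a = (Y - r) * (1 + z * a)" using au(1,2) by metis
    then show ?thesis by (simp add: algebra_simps)
  qed
  have a2: "a = (1 + a * z) * (Y - r)"
  proof -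
    have "(1 + a * z) * (Y - r) = (Y - r) + (Y - r) * (u * (z * (Y - r)))"
      unfolding au(1) by (simp add: algebra_simps)
    also have "\<dots> = a" unfolding au3 by (simp add: au(1) algebra_simps)
    finally show ?thesis by simp
  qed
  have i1: "(1 - (Y - r) * z) * (1 + a * z) = 1"
  proof -
    have "(1 - (Y - r) * z) * (1 + a * z) = 1 + (a - ((Y - r) + (Y - r) * z * a)) * z"
      by (simp add: algebra_simps)
    then show ?thesis using a1 by simp
  qed
  \<comment> \<open>\<open>Z\<close> is the announced product. It is identified with T (1 - Y
    T)^{-1} by showing that it solves Z = T (1 + Y Z), an equation with a unique solution.\<close>
  define q Z where "q = neumann (a * s) * (1 + a * z)" and "Z = S * q"
  have nas: "norm (a * s) < 1" using small(4) by (simp add: s_def S_def)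
  have "(1 - a * s) * q = 1 + a * z"
    using neumann_inverse(1)[OF nas] by (simp add: q_def flip: mult.assoc)
  \<comment> \<open>As s = S - z, the element 1 - a s is (1 + a z) - a S. Multiplying by 1 - (Y - r)
    z, the inverse of 1 + a z, leaves q = 1 + (Y - r) Z.\<close>
  moreover have "(1 - a * s) * q = (1 + a * z) * q - a * Z" by (simp add: s_def Z_def algebra_simps)
  ultimately have "(1 + a * z) * q = (1 + a * z) + a * Z" by (simp add: algebra_simps)
  then have "(1 - (Y - r) * z) * ((1 + a * z) * q) = (1 - (Y - r) * z) * ((1 + a * z) + a * Z)" by simp
  moreover have "(1 - (Y - r) * z) * ((1 + a * z) * q) = q" by (simp add: i1 flip: mult.assoc)
  moreover have "(1 - (Y - r) * z) * a = Y - r"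
  proof -
    have "(1 - (Y - r) * z) * a = (1 - (Y - r) * z) * ((1 + a * z) * (Y - r))" using a2 by simp
    then show ?thesis by (simp add: i1 flip: mult.assoc)
  qed
  then have "(1 - (Y - r) * z) * ((1 + a * z) + a * Z) = 1 + (Y - r) * Z"
    by (simp add: ring_distribs(1) i1 flip: mult.assoc)
  ultimately have q: "q = 1 + (Y - r) * Z" by simp
  have Zeq: "Z = T * (1 + Y * Z)"
  proof -
    have "Z = S * (1 + (Y - r) * Z)" using Z_def q by simp
    then have Sr: "Z + S * r * Z = S * (1 + Y * Z)" by (simp add: algebra_simps)
    \<comment> \<open>Left multiplication by 1 - T r sends \<open>S\<close> to \<open>T\<close> and
      Z + S r Z to \<open>Z\<close>, which eliminates \<open>r\<close> from the equation for
      \<open>Z\<close>.\<close>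
    have TS: "S - T * r * S = T" using STS by (simp add: algebra_simps)
    have "Z + S * r * Z - T * r * (Z + S * r * Z) = Z + (S - T - T * r * S) * r * Z"
      by (simp add: algebra_simps)
    also have "\<dots> = Z" using TS by (simp add: algebra_simps)
    finally have "Z = S * (1 + Y * Z) - T * r * (S * (1 + Y * Z))" unfolding Sr by simp
    also have "\<dots> = (S - T * r * S) * (1 + Y * Z)" by (simp add: algebra_simps)
    finally show ?thesis unfolding TS .
  qed
  have "(1 - T * Y) * Z = T" using Zeq by (simp add: algebra_simps)
  then have "Z = neumann (T * Y) * T" by (rule neumann_unique[OF small(6)])
  also have "\<dots> = T * neumann (Y * T)" by (rule neumann_push[OF small(6,5)])
  finally have ZT: "Z = T * neumann (Y * T)" .
  have "V * (k * neumann (V' * Y * V * k)) * V' = V * k * (neumann (V' * (Y * V * k)) * V')"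
    by (simp add: mult.assoc)
  also have "neumann (V' * (Y * V * k)) * V' = V' * neumann (Y * V * k * V')"
    by (rule neumann_push) (use small(5,7) in \<open>simp_all add: T_def mult.assoc\<close>)
  finally have "V * (k * neumann (V' * Y * V * k)) * V' = Z"
    by (simp add: ZT T_def mult.assoc)
  moreover have "E Z = z"
  proof -
    have Ea: "E a = 0" unfolding a_def by (rule centered_resolvent[OF z(2,1) small(2,3)])
    have Ez: "E z = z" using E_left[OF z(1), of 1] by (simp add: E_one)
    have Es: "E s = 0" using EV[OF z(1)] by (simp add: s_def S_def E.diff Ez)
    have sQ: "s \<in> Q" unfolding s_def S_def using Q z by auto
    have cont: "isCont (\<lambda>a. a * s * (a * s) ^ n) b" "isCont (\<lambda>a. (a * s) ^ n * a) b"
      "isCont (\<lambda>a. s * (a * s) ^ n) b" "isCont (\<lambda>a. s * (a * s) ^ n * a) b" for n b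
      by (intro continuous_intros)+
    have words: "E (a * s * (a * s) ^ n) = 0" "E ((a * s) ^ n * a) = 0"
      "E (s * (a * s) ^ n) = 0" "E (s * (a * s) ^ n * a) = 0" for n
    proof -
      have ar: "a = (Y - r) * neumann (z * (Y - r))" by (simp add: a_def r_def)
      have closure: "E (f a) = 0" if "\<And>a. a \<in> P \<Longrightarrow> E a = 0 \<Longrightarrow> E (f a) = 0" "\<And>b. isCont f b" for f
        unfolding ar
        by (rule free_words_closure[where P = P])
          (fact P that z(1) rD small(2)[folded r_def] Ea[unfolded ar])+
      show "E (a * s * (a * s) ^ n) = 0"
        by (rule closure[where f = "\<lambda>a. a * s * (a * s) ^ n", OF _ cont(1)]) (use free[OF _ _ sQ Es] in blast)
      show "E ((a * s) ^ n * a) = 0"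
        by (rule closure[where f = "\<lambda>a. (a * s) ^ n * a", OF _ cont(2)]) (use free[OF _ _ sQ Es] in blast)
      show "E (s * (a * s) ^ n) = 0"
        by (rule closure[where f = "\<lambda>a. s * (a * s) ^ n", OF _ cont(3)]) (use free[OF _ _ sQ Es] in blast)
      show "E (s * (a * s) ^ n * a) = 0"
        by (rule closure[where f = "\<lambda>a. s * (a * s) ^ n * a", OF _ cont(4)]) (use free[OF _ _ sQ Es] in blast)
    qed
    let ?N = "neumann (a * s)"
    have "?N = 1 + a * s * ?N" by (rule neumann_eq(1)[OF nas])
    then have "E ?N = E 1 + E (a * s * ?N)" by (metis E.add)
    then have E1: "E ?N = 1" using E_neumann_eq_0[OF nas, of "a * s" 1] words(1) by (simp add: E_one)
    have E2: "E (?N * a) = 0" using E_neumann_eq_0[OF nas, of 1 a] words(2) by simp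
    have E3: "E (s * ?N) = 0" using E_neumann_eq_0[OF nas, of s 1] words(3) by simp
    have E4: "E (s * ?N * a) = 0" using E_neumann_eq_0[OF nas, of s a] words(4) by simp
    \<comment> \<open>Outer factors \<open>z\<close> leave the expectation by the bimodule property.
      All words in the last three series alternate and are centered; in the first, only the constant
      term 1 of \<open>?N\<close> contributes.\<close>
    have "Z = z * ?N + s * ?N + (z * (?N * a)) * z + (s * ?N * a) * z"
      by (simp add: Z_def q_def s_def algebra_simps)
    then have "E Z = z * E ?N + E (s * ?N) + z * E (?N * a) * z + E (s * ?N * a) * z"
      by (simp only: E.add E_left[OF z(1)] E_right[OF z(1)])
    then show ?thesis by (simp add: E1 E2 E3 E4)
  qed
  ultimately show ?thesis by simp
qed

lemma free_compression:
  fixes V V' :: 'm and \<eta> :: "'m \<Rightarrow> 'm"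
  assumes eta: "\<And>b. b \<in> D \<Longrightarrow> \<eta> b \<in> D" "\<And>b. b \<in> D \<Longrightarrow> norm (\<eta> b) \<le> M * norm b" "0 \<le> M"
    and VV: "\<And>b b'. b \<in> D \<Longrightarrow> b' \<in> D \<Longrightarrow> V * b * V' * b' * V = V * b * \<eta> b'"
    and EV: "\<And>b. b \<in> D \<Longrightarrow> E (V * b * V') = b"
    and P: "D \<subseteq> P" "Y \<in> P" "\<And>x y. x \<in> P \<Longrightarrow> y \<in> P \<Longrightarrow> x + y \<in> P"
      "\<And>x y. x \<in> P \<Longrightarrow> y \<in> P \<Longrightarrow> x - y \<in> P" "\<And>x y. x \<in> P \<Longrightarrow> y \<in> P \<Longrightarrow> x * y \<in> P"
    and Q: "D \<subseteq> Q" "V \<in> Q" "V' \<in> Q" "\<And>x y. x \<in> Q \<Longrightarrow> y \<in> Q \<Longrightarrow> x - y \<in> Q"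
      "\<And>x y. x \<in> Q \<Longrightarrow> y \<in> Q \<Longrightarrow> x * y \<in> Q"
    and free: "\<And>a s k. a \<in> P \<Longrightarrow> E a = 0 \<Longrightarrow> s \<in> Q \<Longrightarrow> E s = 0 \<Longrightarrow>
      E (a * s * (a * s) ^ k) = 0 \<and> E ((a * s) ^ k * a) = 0 \<and> E (s * (a * s) ^ k) = 0 \<and> E (s * (a * s) ^ k * a) = 0"
  obtains d where "0 < d" "d \<le> rad / 2"
    "\<And>z. z \<in> D \<Longrightarrow> norm z < d \<Longrightarrow> norm (\<eta> (R z) * z) \<le> 1/2 \<and>
      E (V * (z * neumann (- (\<eta> (R z) * z)) * neumann (V' * Y * V * (z * neumann (- (\<eta> (R z) * z))))) * V') = z"
proof -
  define v where "v = norm V * norm V'"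
  \<comment> \<open>Each norm that has to be small is at most 2 W ||z||: 4 L bounds
    \<open>R z\<close>, M (4 L) bounds its image under \<eta>, \<open>v\<close> bounds the sandwich
    between \<open>V\<close> and \<open>V'\<close>, and the factor 2 bounds a Neumann series. The
    radius 1 / (8 W) therefore leaves at most 1/4.\<close>
  define W where "W = (1 + norm Y + 4 * L + M * (4 * L)) * (1 + v)"
  have v: "0 \<le> v" by (simp add: v_def)
  have W1: "norm Y + 4 * L \<le> W" "M * (4 * L) \<le> W" "(norm Y + 4 * L) * (1 + v) \<le> W" "norm Y * v \<le> W" "4 * L \<le> W" "0 < W"
  proof -
    let ?c = "1 + norm Y + 4 * L + M * (4 * L)"
    have c: "norm Y + 4 * L \<le> ?c" "M * (4 * L) \<le> ?c" "0 < ?c" "norm Y \<le> ?c" "4 * L \<le> ?c"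
      using L_nonneg eta(3) by (simp_all add: add_nonneg_nonneg add_pos_nonneg)
    have "?c * 1 \<le> W" unfolding W_def using c v by (intro mult_left_mono) auto
    then have cW: "?c \<le> W" by simp
    show "norm Y + 4 * L \<le> W" by (rule order_trans[OF c(1) cW])
    show "M * (4 * L) \<le> W" by (rule order_trans[OF c(2) cW])
    show "4 * L \<le> W" by (rule order_trans[OF c(5) cW])
    show "0 < W" by (rule less_le_trans[OF c(3) cW])
    show "(norm Y + 4 * L) * (1 + v) \<le> W" unfolding W_def using c v by (intro mult_right_mono) auto
    show "norm Y * v \<le> W" unfolding W_def using c v by (intro mult_mono) auto
  qed
  define d where "d = min (rad / 2) (1 / (8 * W))"
  have d: "0 < d" "d \<le> rad / 2" "W * d \<le> 1/8"
    using rad_pos W1(6) by (auto simp: d_def min_def field_simps)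
  have Wt: "x * norm z \<le> 1/8" if "x \<le> W" "norm z < d" for x and z :: 'm
  proof -
    have "x * norm z \<le> W * d" using that W1(6) by (intro mult_mono) auto
    with d(3) show ?thesis by simp
  qed
  have "norm (\<eta> (R z) * z) \<le> 1/2 \<and>
      E (V * (z * neumann (- (\<eta> (R z) * z)) * neumann (V' * Y * V * (z * neumann (- (\<eta> (R z) * z))))) * V') = z"
    if zD: "z \<in> D" and nz: "norm z < d" for z
  proof
    have z: "norm z \<le> rad / 2" using nz d by simp
    have nr: "norm (R z) \<le> 4 * L" by (rule R_props(4)[OF z])
    have "norm (\<eta> (R z)) \<le> M * norm (R z)" by (rule eta(2)[OF R_D[OF z zD]])
    also have "\<dots> \<le> M * (4 * L)" by (rule mult_left_mono[OF nr eta(3)])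
    finally have nh: "norm (\<eta> (R z)) \<le> M * (4 * L)" .
    have hz: "norm (\<eta> (R z) * z) \<le> 1/8"
      using Wt[OF W1(2) nz] mult_right_mono[OF nh norm_ge_zero[of z]] norm_mult_ineq[of "\<eta> (R z)" z] by linarith
    then show "norm (\<eta> (R z) * z) \<le> 1/2" by simp
    let ?k = "z * neumann (- (\<eta> (R z) * z))"
    have nk: "norm ?k \<le> 2 * norm z"
    proof -
      have "norm ?k \<le> norm z * norm (neumann (- (\<eta> (R z) * z)))" by (rule norm_mult_ineq)
      also have "\<dots> \<le> norm z * 2" using hz by (intro mult_left_mono norm_neumann_le) simp_all
      finally show ?thesis by simp
    qed
    have nYr: "norm (Y - R z) \<le> norm Y + 4 * L" using norm_triangle_ineq4[of Y "R z"] nr by linarith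
    have zYr: "norm (z * (Y - R z)) \<le> 1/8"
      using Wt[OF W1(1) nz] mult_right_mono[OF nYr norm_ge_zero[of z]] norm_mult_ineq[of z "Y - R z"]
      by (simp add: mult.commute)
    have rz: "norm (R z * z) \<le> 1/8"
      using Wt[OF W1(5) nz] mult_right_mono[OF nr norm_ge_zero[of z]] norm_mult_ineq[of "R z" z] by linarith
    have nT: "norm (V * x * V') \<le> v * norm x" for x
      using norm_mult3_ineq[of V x V'] by (simp add: v_def mult_ac)
    have nTk: "norm (V * ?k * V') \<le> 2 * (v * norm z)"
      using nT[of ?k] mult_left_mono[OF nk v] by simp
    have YT: "norm Y * norm (V * ?k * V') \<le> 1/4"
      using mult_left_mono[OF nTk norm_ge_zero[of Y]] Wt[OF W1(4) nz] by (simp add: mult_ac)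
    have Vk: "norm (V' * Y * V * ?k) \<le> 1/4"
    proof -
      have "norm (V' * Y * V * ?k) \<le> norm V' * norm Y * norm V * norm ?k"
        by (intro order_trans[OF norm_mult_ineq] mult_right_mono norm_mult3_ineq) simp
      also have "\<dots> \<le> norm V' * norm Y * norm V * (2 * norm z)" by (intro mult_left_mono nk) simp
      also have "\<dots> = 2 * (norm Y * v * norm z)" by (simp add: v_def mult_ac)
      finally show ?thesis using Wt[OF W1(4) nz] by simp
    qed
    have nas: "norm ((Y - R z) * neumann (z * (Y - R z)) * (V * z * V' - z)) \<le> 1/4"
    proof -
      have "norm (V * z * V' - z) \<le> (1 + v) * norm z"
        using norm_triangle_ineq4[of "V * z * V'" z] nT[of z] by (simp add: algebra_simps)
      moreover have "norm (neumann (z * (Y - R z))) \<le> 2" using zYr by (intro norm_neumann_le) simp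
      ultimately have "norm (Y - R z) * norm (neumann (z * (Y - R z))) * norm (V * z * V' - z)
          \<le> (norm Y + 4 * L) * 2 * ((1 + v) * norm z)"
        using nYr L_nonneg by (intro mult_mono) auto
      then have "norm ((Y - R z) * neumann (z * (Y - R z)) * (V * z * V' - z)) \<le> 2 * (((norm Y + 4 * L) * (1 + v)) * norm z)"
        using norm_mult3_ineq[of "Y - R z" "neumann (z * (Y - R z))" "V * z * V' - z"] by (simp add: mult_ac)
      with Wt[OF W1(3) nz] show ?thesis by simp
    qed
    show "E (V * (?k * neumann (V' * Y * V * ?k)) * V') = z"
    proof (rule free_compression_at[where P = P and Q = Q and \<eta> = \<eta>])
      show "norm (\<eta> (R z) * z) < 1" "norm (z * (Y - R z)) < 1" "norm (R z * z) < 1"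
        "norm ((Y - R z) * neumann (z * (Y - R z)) * (V * z * V' - z)) < 1" "norm (V' * Y * V * ?k) < 1"
        using hz zYr rz nas Vk by simp_all
      show "norm (Y * (V * ?k * V')) < 1" "norm (V * ?k * V' * Y) < 1"
        using YT norm_mult_ineq[of Y "V * ?k * V'"] norm_mult_ineq[of "V * ?k * V'" Y] by (simp_all add: mult.commute)
    qed (fact eta VV EV P Q free zD z)+
  qed
  with d(1,2) show thesis by (rule that)
qed

end

section \<open>Separating functionals and an identity theorem\<close>

text \<open>Domination by the norm bounds the functional from below by -||x||. Hence infima over
  chains are finite, and a linear functional of this kind is automatically bounded.\<close>

definition sublinear :: "('a::real_normed_vector \<Rightarrow> real) \<Rightarrow> bool" where
  "sublinear q \<longleftrightarrow> (\<forall>x y. q (x + y) \<le> q x + q y) \<and> (\<forall>x. \<forall>t\<ge>0. q (t *\<^sub>R x) \<le> t * q x) \<and> (\<forall>x. q x \<le> norm x)"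

lemma sublinearD:
  assumes "sublinear q"
  shows "q (x + y) \<le> q x + q y" "0 \<le> t \<Longrightarrow> q (t *\<^sub>R x) \<le> t * q x" "q x \<le> norm x"
    "q 0 = 0" "- norm x \<le> q x" "- q (- x) \<le> q x"
proof -
  show *: "q (x + y) \<le> q x + q y" "0 \<le> t \<Longrightarrow> q (t *\<^sub>R x) \<le> t * q x" "q x \<le> norm x" for x y t
    using assms by (auto simp: sublinear_def)
  show z: "q 0 = 0" using *(1)[of 0 0] *(2)[of 0 0] by simp
  show "- q (- x) \<le> q x" using *(1)[of x "-x"] z by simp
  then show "- norm x \<le> q x" using *(3)[of "-x"] by simp
qed

text \<open>The two steps of the Hahn-Banach theorem: \<open>shift q y\<close> is a smaller sublinear functional unless
  \<open>q\<close> is additive in the direction \<open>y\<close>, and minimal sublinear functionals exist.\<close>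

definition shift :: "('a::real_normed_vector \<Rightarrow> real) \<Rightarrow> 'a \<Rightarrow> 'a \<Rightarrow> real" where
  "shift q y x = (INF t\<in>{0..}. q (x + t *\<^sub>R y) - t * q y)"

lemma shift:
  assumes q: "sublinear q"
  shows "sublinear (shift q y)" "shift q y x \<le> q x" "shift q y x \<le> q (x + y) - q y"
proof -
  have low: "- q (- x) \<le> q (x + t *\<^sub>R y) - t * q y" if "0 \<le> t" for x t
  proof -
    have "t * q y \<le> q (t *\<^sub>R y)"
    proof (cases "t = 0")
      case False
      with that have "q ((1/t) *\<^sub>R (t *\<^sub>R y)) \<le> (1/t) * q (t *\<^sub>R y)" by (intro sublinearD[OF q]) simp
      with False that show ?thesis by (simp add: field_simps)
    qed (simp add: sublinearD[OF q])
    also have "q (t *\<^sub>R y) \<le> q (x + t *\<^sub>R y) + q (- x)" using sublinearD(1)[OF q, of "x + t *\<^sub>R y" "-x"] by simp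
    finally show ?thesis by simp
  qed
  then have bdd: "bdd_below ((\<lambda>t. q (x + t *\<^sub>R y) - t * q y) ` {0..})" for x
    by (intro bdd_belowI2[where m = "- q (- x)"]) simp
  have upper: "shift q y x \<le> q (x + t *\<^sub>R y) - t * q y" if "0 \<le> t" for x t
    unfolding shift_def by (rule cINF_lower[OF bdd]) (use that in simp)
  have greatest: "m \<le> shift q y x" if "\<And>t. 0 \<le> t \<Longrightarrow> m \<le> q (x + t *\<^sub>R y) - t * q y" for m x
    unfolding shift_def by (rule cINF_greatest) (use that in auto)
  show le: "shift q y x \<le> q x" for x using upper[of 0 x] by simp
  show "shift q y x \<le> q (x + y) - q y" using upper[of 1 x] by simp
  show "sublinear (shift q y)"
    unfolding sublinear_def
  proof (intro conjI allI impI)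
    fix x x'
    have "shift q y (x + x') - (q (x' + t' *\<^sub>R y) - t' * q y) \<le> q (x + t *\<^sub>R y) - t * q y"
      if "0 \<le> t" "0 \<le> t'" for t t'
    proof -
      have "(x + x') + (t + t') *\<^sub>R y = (x + t *\<^sub>R y) + (x' + t' *\<^sub>R y)" by (simp add: algebra_simps)
      then have "q ((x + x') + (t + t') *\<^sub>R y) \<le> q (x + t *\<^sub>R y) + q (x' + t' *\<^sub>R y)"
        using sublinearD(1)[OF q] by metis
      then show ?thesis using upper[of "t + t'" "x + x'"] that by (simp add: algebra_simps)
    qed
    then have "shift q y (x + x') - (q (x' + t' *\<^sub>R y) - t' * q y) \<le> shift q y x" if "0 \<le> t'" for t'
      using that by (intro greatest)
    then have "shift q y (x + x') - shift q y x \<le> shift q y x'" by (intro greatest) (simp add: algebra_simps)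
    then show "shift q y (x + x') \<le> shift q y x + shift q y x'" by simp
  next
    fix x and s :: real assume s: "0 \<le> s"
    show "shift q y (s *\<^sub>R x) \<le> s * shift q y x"
    proof (cases "s = 0")
      case True
      then show ?thesis using le[of 0] sublinearD(4)[OF q] by simp
    next
      case False
      with s have s': "0 < s" by simp
      have "shift q y (s *\<^sub>R x) / s \<le> shift q y x"
      proof (rule greatest)
        fix t :: real assume t: "0 \<le> t"
        have "s *\<^sub>R x + (s * t) *\<^sub>R y = s *\<^sub>R (x + t *\<^sub>R y)" by (simp add: algebra_simps)
        then have "q (s *\<^sub>R x + (s * t) *\<^sub>R y) \<le> s * q (x + t *\<^sub>R y)" using sublinearD(2)[OF q s] by metis
        then have "shift q y (s *\<^sub>R x) \<le> s * (q (x + t *\<^sub>R y) - t * q y)"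
          using upper[of "s * t" "s *\<^sub>R x"] s t by (simp add: algebra_simps)
        then show "shift q y (s *\<^sub>R x) / s \<le> q (x + t *\<^sub>R y) - t * q y" using s' by (simp add: field_simps)
      qed
      then show ?thesis using s' by (simp add: field_simps)
    qed
  next
    fix x show "shift q y x \<le> norm x" using le[of x] sublinearD(3)[OF q, of x] by simp
  qed
qed

lemma ex_minimal_sublinear:
  assumes p: "sublinear p"
  obtains m where "sublinear m" "\<And>x. m x \<le> p x" "\<And>q. sublinear q \<Longrightarrow> (\<And>x. q x \<le> m x) \<Longrightarrow> q = m"
proof -
  define A where "A = {q. sublinear q \<and> (\<forall>x. q x \<le> p x)}"
  \<comment> \<open>The order is reversed, so that the upper bounds required by Zorn's lemma are
    pointwise infima of chains.\<close>
  define P where "P q q' \<longleftrightarrow> (\<forall>x. q' x \<le> q x)" for q q' :: "'a \<Rightarrow> real"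
  have po: "partial_order_on A (relation_of P A)"
    by (auto simp: partial_order_on_def preorder_on_def relation_of_def refl_on_def trans_def antisym_def P_def
        intro: order_trans intro!: ext antisym)
  have "\<exists>u\<in>A. \<forall>a\<in>C. P a u" if C: "C \<in> Chains (relation_of P A)" for C
  proof (cases "C = {}")
    case True
    then show ?thesis using p by (auto simp: A_def)
  next
    case False
    have CA: "q \<in> A" if "q \<in> C" for q
      using C that by (auto simp: Chains_def relation_of_def)
    then have Csub: "sublinear q" if "q \<in> C" for q using that by (auto simp: A_def)
    have comp: "(\<forall>x. q x \<le> q' x) \<or> (\<forall>x. q' x \<le> q x)" if "q \<in> C" "q' \<in> C" for q q'
      using C that by (auto simp: Chains_def relation_of_def P_def)
    define u where "u x = (INF q\<in>C. q x)" for x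
    have bdd: "bdd_below ((\<lambda>q. q x) ` C)" for x
      using sublinearD(5)[OF Csub] by (intro bdd_belowI2[where m = "- norm x"])
    have lower: "u x \<le> q x" if "q \<in> C" for q x unfolding u_def by (rule cINF_lower[OF bdd that])
    have greatest: "m \<le> u x" if "\<And>q. q \<in> C \<Longrightarrow> m \<le> q x" for m x
      unfolding u_def by (rule cINF_greatest[OF False that])
    have "sublinear u"
      unfolding sublinear_def
    proof (intro conjI allI impI)
      fix x y
      \<comment> \<open>Two members of a chain are comparable, and the smaller one is subadditive
        and lies below both summands.\<close>
      have le: "u (x + y) \<le> q x + q' y" if q: "q \<in> C" "q' \<in> C" for q q'
        using comp[OF q]
      proof
        assume "\<forall>x. q x \<le> q' x"
        then show ?thesis using lower[OF q(1), of "x + y"] sublinearD(1)[OF Csub[OF q(1)], of x y] by (smt (verit))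
      next
        assume "\<forall>x. q' x \<le> q x"
        then show ?thesis using lower[OF q(2), of "x + y"] sublinearD(1)[OF Csub[OF q(2)], of x y] by (smt (verit))
      qed
      have "u (x + y) - q' y \<le> u x" if "q' \<in> C" for q' by (rule greatest) (use le that in \<open>simp add: algebra_simps\<close>)
      then have "u (x + y) - u x \<le> u y" by (intro greatest) (simp add: algebra_simps)
      then show "u (x + y) \<le> u x + u y" by simp
    next
      fix x and t :: real assume t: "0 \<le> t"
      show "u (t *\<^sub>R x) \<le> t * u x"
      proof (cases "t = 0")
        case True
        obtain q where "q \<in> C" using False by blast
        from lower[OF this, of 0] True show ?thesis by (simp add: sublinearD(4)[OF Csub[OF \<open>q \<in> C\<close>]])
      next
        case False
        with t have t': "0 < t" by simp
        have "u (t *\<^sub>R x) / t \<le> u x"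
        proof (rule greatest)
          fix q assume q: "q \<in> C"
          have "u (t *\<^sub>R x) \<le> t * q x" using lower[OF q] sublinearD(2)[OF Csub[OF q] t] by (rule order_trans)
          then show "u (t *\<^sub>R x) / t \<le> q x" using t' by (simp add: field_simps)
        qed
        then show ?thesis using t' by (simp add: field_simps)
      qed
    next
      fix x
      obtain q where "q \<in> C" using False by blast
      then show "u x \<le> norm x" using lower sublinearD(3)[OF Csub] order_trans by blast
    qed
    moreover have "u x \<le> p x" for x
    proof -
      obtain q where "q \<in> C" using False by blast
      then show ?thesis using lower[of q x] CA[of q] by (auto simp: A_def intro: order_trans)
    qed
    ultimately show ?thesis using lower by (auto simp: A_def P_def)
  qed
  from predicate_Zorn[OF po this] obtain m where m: "m \<in> A" "\<And>a. a \<in> A \<Longrightarrow> P m a \<Longrightarrow> a = m" by blast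
  show thesis
  proof (rule that[of m])
    show "sublinear m" "\<And>x. m x \<le> p x" using m by (auto simp: A_def)
    fix q assume q: "sublinear q" "\<And>x. q x \<le> m x"
    have "q x \<le> p x" for x using q(2)[of x] m(1) unfolding A_def by (auto intro: order_trans)
    with q show "q = m" by (intro m(2)) (auto simp: A_def P_def)
  qed
qed

text \<open>A minimal \<open>m\<close> coincides with all its shifts and is thus additive. Starting
  the descent from \<open>shift norm a\<close> rather than from the norm forces m(-a) \<le> -||a||,
  hence m(a) \<noteq> 0.\<close>

lemma ex_functional_ne_0:
  fixes a :: "'a::real_normed_vector"
  assumes "a \<noteq> 0"
  obtains \<phi> :: "'a \<Rightarrow> real" where "bounded_linear \<phi>" "\<phi> a \<noteq> 0"
proof -
  have n: "sublinear (norm :: 'a \<Rightarrow> real)" by (auto simp: sublinear_def norm_triangle_ineq)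
  obtain m where m: "sublinear m" "\<And>x. m x \<le> shift norm a x" "\<And>q. sublinear q \<Longrightarrow> (\<And>x. q x \<le> m x) \<Longrightarrow> q = m"
    by (rule ex_minimal_sublinear[OF shift(1)[OF n, of a]]) blast
  have "shift m y = m" for y by (rule m(3)) (use shift[OF m(1)] in auto)
  then have "m x \<le> m (x + y) - m y" for x y using shift(3)[OF m(1), where x = x and y = y] by simp
  then have add: "m (x + y) = m x + m y" for x y
    using sublinearD(1)[OF m(1), of x y] by (smt (verit))
  have neg: "m (- x) = - m x" for x using add[of x "-x"] sublinearD(4)[OF m(1)] by simp
  have posr: "m (t *\<^sub>R x) = t * m x" if "0 \<le> t" for t x
    using sublinearD(2)[OF m(1) that, of x] sublinearD(2)[OF m(1) that, of "-x"] by (simp add: neg)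
  have "bounded_linear m"
  proof (rule bounded_linear_intro)
    show "m (x + y) = m x + m y" for x y by (rule add)
    show "m (t *\<^sub>R x) = t *\<^sub>R m x" for t x
    proof (cases "0 \<le> t")
      case False
      then have "m ((- t) *\<^sub>R x) = (- t) * m x" by (intro posr) simp
      then show ?thesis by (simp add: neg)
    qed (simp add: posr)
    show "norm (m x) \<le> norm x * 1" for x
      using sublinearD(3,5)[OF m(1), of x] by (simp add: abs_le_iff)
  qed
  moreover have "m a \<noteq> 0"
  proof -
    have "m (- a) \<le> - norm a" using m(2)[of "- a"] shift(3)[OF n, of a "- a"] by simp
    then show ?thesis using assms by (auto simp: neg)
  qed
  ultimately show thesis by (rule that)
qed

lemma ex_complex_functional_ne_0:
  fixes a :: "'a::unital_cstar_algebra"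
  assumes "a \<noteq> 0"
  obtains \<psi> :: "'a \<Rightarrow> complex" where "bounded_linear \<psi>" "\<And>c x. \<psi> (c *\<^sub>C x) = c * \<psi> x" "\<psi> a \<noteq> 0"
proof -
  obtain \<phi> :: "'a \<Rightarrow> real" where \<phi>: "bounded_linear \<phi>" "\<phi> a \<noteq> 0" using ex_functional_ne_0[OF assms] by blast
  interpret \<phi>: bounded_linear \<phi> by fact
  define \<psi> where "\<psi> x = complex_of_real (\<phi> x) - \<i> * complex_of_real (\<phi> (\<i> *\<^sub>C x))" for x
  have scR: "complex_of_real r *\<^sub>C x = r *\<^sub>R x" for r and x :: 'a by (rule scaleC_of_real)
  have comm: "\<i> *\<^sub>C r *\<^sub>R x = r *\<^sub>R \<i> *\<^sub>C x" for r and x :: 'a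
    by (simp add: scaleC_scaleC mult.commute flip: scR)
  have bl: "bounded_linear (\<lambda>x::'a. \<i> *\<^sub>C x)"
    by (rule bounded_linear_intro[where K = 1]) (simp_all add: scaleC_add_right comm norm_scaleC)
  have "bounded_linear \<psi>"
    unfolding \<psi>_def[abs_def]
    by (intro bounded_linear_sub bounded_linear_compose[OF bounded_linear_of_real \<phi>(1)]
        bounded_linear_const_mult bounded_linear_compose[OF bounded_linear_of_real bounded_linear_compose[OF \<phi>(1) bl]])
  moreover have "\<psi> (c *\<^sub>C x) = c * \<psi> x" for c x
  proof -
    have c: "c = complex_of_real (Re c) + \<i> * complex_of_real (Im c)" by (simp add: complex_eq_iff)
    have cx: "c *\<^sub>C x = Re c *\<^sub>R x + Im c *\<^sub>R \<i> *\<^sub>C x"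
      by (subst c, subst scaleC_add_left) (simp add: scR mult.commute flip: scaleC_scaleC, simp flip: scR add: scaleC_scaleC mult.commute)
    have icx: "\<i> *\<^sub>C c *\<^sub>C x = Re c *\<^sub>R \<i> *\<^sub>C x - Im c *\<^sub>R x"
      unfolding cx by (simp add: scaleC_add_right comm scaleC_scaleC scaleC_minus_left)
    show ?thesis
      unfolding \<psi>_def icx unfolding cx
      by (simp add: \<phi>.add \<phi>.diff \<phi>.scaleR complex_eq_iff algebra_simps)
  qed
  moreover have "\<psi> a \<noteq> 0" using \<phi>(2) by (auto simp: \<psi>_def complex_eq_iff)
  ultimately show thesis by (rule that)
qed

section \<open>Scalar perturbations and holomorphy along complex lines\<close>

lemma fam_const_one: "fam_const 1 = 1"
  by (rule fam_eqI, rule eq_matI) (auto simp: fam_at_const fam_at_simps amplify_index)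

lemma invertible_matI:
  assumes "M \<in> carrier_mat n n" "N \<in> carrier_mat n n" "M * N = 1\<^sub>m n" "N * M = 1\<^sub>m n"
  shows "invertible_mat M"
  using assms by (auto simp: invertible_mat_def inverts_mat_def intro!: exI[of _ N])

lemma invertible_mat_add_scalar:
  fixes z :: "'a::unital_cstar_algebra mat"
  assumes z: "z \<in> carrier_mat n n" and s: "mat_norm z < cmod s"
  shows "invertible_mat (z + map_mat (scaleC s) (1\<^sub>m n))"
proof -
  have s0: "s \<noteq> 0" using le_less_trans[OF mat_norm_nonneg s] by auto
  define x where "x = fam_single n z"
  define j where "j c = fam_const (c *\<^sub>C (1::'a))" for c
  have jj: "j s * j (1/s) = 1" "j (1/s) * j s = 1"
    using s0 by (simp_all add: j_def scaleC_mult_left scaleC_scaleC fam_const_one flip: fam_const_mult)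
  have jc: "j c * y = y * j c" for c y unfolding j_def by (rule fam_const_scaleC_central)
  define t where "t = - (j (1/s) * x)"
  have "norm t \<le> norm (j (1/s)) * norm x" unfolding t_def by (simp add: norm_mult_ineq)
  also have "\<dots> \<le> cmod (1/s) * mat_norm z"
    using norm_fam_const_le[of "(1/s) *\<^sub>C (1::'a)"] z
    by (intro mult_mono) (simp_all add: j_def norm_scaleC x_def norm_fam_single)
  also have "\<dots> < 1" using s s0 by (simp add: norm_divide field_simps)
  finally have t: "norm t < 1" .
  have y: "x + j s = j s * (1 - t)" by (simp add: t_def algebra_simps jj flip: mult.assoc)
  have inv: "(x + j s) * (neumann t * j (1/s)) = 1" "(neumann t * j (1/s)) * (x + j s) = 1"
  proof -
    have "(x + j s) * (neumann t * j (1/s)) = j s * ((1 - t) * neumann t) * j (1/s)"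
      unfolding y by (simp add: mult.assoc)
    then show "(x + j s) * (neumann t * j (1/s)) = 1" by (simp add: neumann_inverse[OF t] jj)
    have "(neumann t * j (1/s)) * (x + j s) = neumann t * (j (1/s) * j s) * (1 - t)"
      unfolding y by (simp add: mult.assoc)
    then show "(neumann t * j (1/s)) * (x + j s) = 1" by (simp add: neumann_inverse[OF t] jj)
  qed
  have at: "fam_at (x + j s) n = z + map_mat (scaleC s) (1\<^sub>m n)"
    using z fam_at_const_scaleC(1)[of "1\<^sub>m n :: 'a mat" n s]
    by (simp add: fam_at_simps x_def fam_at_single j_def fam_at_const)
  have "fam_at (x + j s) n * fam_at (neumann t * j (1/s)) n = 1\<^sub>m n"
    "fam_at (neumann t * j (1/s)) n * fam_at (x + j s) n = 1\<^sub>m n"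
    by (simp_all only: fam_at_mult[symmetric] inv fam_at_one)
  then show ?thesis unfolding at[symmetric] by (intro invertible_matI[OF fam_at_carrier fam_at_carrier])
qed

text \<open>Restricting to the line through \<open>z\<close> in direction 1 and applying a complex
  linear functional to one entry reduces the identity theorem for matrices to the classical one. The
  derivative is \<psi> of that entry of \<open>D (1\<^sub>m n)\<close>.\<close>

lemma analytic_on_mats_holomorphic:
  fixes \<psi> :: "'a::unital_cstar_algebra \<Rightarrow> complex"
  assumes f: "analytic_on_mats B n U f" and B: "unital_star_subalgebra B" and n: "n \<ge> 1"
    and \<psi>: "bounded_linear \<psi>" "\<And>c x. \<psi> (c *\<^sub>C x) = c * \<psi> x" and ij: "i < n" "j < n"
    and z: "z \<in> mats B n" and S: "open S" "\<And>s. s \<in> S \<Longrightarrow> z + map_mat (scaleC s) (1\<^sub>m n) \<in> U"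
  shows "(\<lambda>s. \<psi> (f (z + map_mat (scaleC s) (1\<^sub>m n)) $$ (i,j))) holomorphic_on S"
proof (rule holomorphic_onI)
  interpret \<psi>: bounded_linear \<psi> by fact
  fix s assume s: "s \<in> S"
  define l where "l = (\<lambda>s. z + map_mat (scaleC s) (1\<^sub>m n))"
  have lU: "l s \<in> U" if "s \<in> S" for s using S that by (simp add: l_def)
  have zc: "z \<in> carrier_mat n n" by (rule mats_carrier[OF z])
  obtain D C where D: "\<And>h. h \<in> mats B n \<Longrightarrow> D h \<in> mats B n"
    "\<And>h c. h \<in> mats B n \<Longrightarrow> D (map_mat (scaleC c) h) = map_mat (scaleC c) (D h)"
    "\<And>e. e > 0 \<Longrightarrow> \<exists>d>0. \<forall>h\<in>mats B n. mat_norm h < d \<longrightarrow> l s + h \<in> U \<longrightarrow> mat_norm (f (l s + h) - f (l s) - D h) \<le> e * mat_norm h"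
    using f lU[OF s] unfolding analytic_on_mats_def by metis
  note fB = conjunct1[OF f[unfolded analytic_on_mats_def], rule_format]
  have one: "1\<^sub>m n \<in> mats B n" by (rule mats_one[OF B])
  obtain Cp where Cp: "Cp > 0" "\<And>x. norm (\<psi> x) \<le> norm x * Cp" using \<psi>.pos_bounded by blast
  have "((\<lambda>s. \<psi> (f (l s) $$ (i,j))) has_derivative (*) (\<psi> (D (1\<^sub>m n) $$ (i,j)))) (at s)"
    unfolding has_derivative_at_alt
  proof (intro conjI allI impI)
    show "bounded_linear ((*) (\<psi> (D (1\<^sub>m n) $$ (i,j))))" by (rule bounded_linear_mult_right)
    fix e :: real assume e: "e > 0"
    obtain d where d: "d > 0" "\<And>h. h \<in> mats B n \<Longrightarrow> mat_norm h < d \<Longrightarrow> l s + h \<in> U \<Longrightarrow> mat_norm (f (l s + h) - f (l s) - D h) \<le> (e / Cp) * mat_norm h"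
      using D(3)[of "e / Cp"] e Cp by auto
    obtain d' where d': "d' > 0" "ball s d' \<subseteq> S" using S(1) s by (auto simp: open_contains_ball)
    show "\<exists>d>0. \<forall>y. norm (y - s) < d \<longrightarrow> norm (\<psi> (f (l y) $$ (i,j)) - \<psi> (f (l s) $$ (i,j)) - \<psi> (D (1\<^sub>m n) $$ (i,j)) * (y - s)) \<le> e * norm (y - s)"
    proof (intro exI[of _ "min d d'"] conjI allI impI)
      show "min d d' > 0" using d d' by simp
      fix y assume y: "norm (y - s) < min d d'"
      then have yS: "y \<in> S" using d'(2) by (auto simp: dist_norm norm_minus_commute)
      define h where "h = map_mat (scaleC (y - s)) (1\<^sub>m n :: 'a mat)"
      have hB: "h \<in> mats B n" unfolding h_def by (rule mats_scaleC[OF B one])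
      have nh: "mat_norm h \<le> norm (y - s)"
        using mat_norm_map_scaleC_le[of "y - s" "1\<^sub>m n :: 'a mat"] mat_norm_one[OF n, where 'a='a] by (simp add: h_def)
      have ly: "l y = l s + h"
        unfolding l_def h_def using zc by (intro eq_matI) (auto simp: scaleC_add_left[symmetric])
      have Dh: "D h = map_mat (scaleC (y - s)) (D (1\<^sub>m n))" unfolding h_def by (rule D(2)[OF one])
      have carr: "f (l y) \<in> carrier_mat n n" "f (l s) \<in> carrier_mat n n" "D (1\<^sub>m n) \<in> carrier_mat n n"
        using fB lU yS s D(1)[OF one] by (auto intro: mats_carrier)
      let ?M = "f (l s + h) - f (l s) - D h"
      have M: "?M $$ (i,j) = f (l y) $$ (i,j) - f (l s) $$ (i,j) - (y - s) *\<^sub>C D (1\<^sub>m n) $$ (i,j)"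
        using carr ij by (simp add: Dh flip: ly)
      have "norm (?M $$ (i,j)) \<le> mat_norm ?M"
        using carr ij by (intro norm_index_le_mat_norm) (simp_all add: Dh)
      also have "\<dots> \<le> (e / Cp) * mat_norm h"
        using d(2)[OF hB] nh y lU[OF yS] by (simp add: ly)
      also have "\<dots> \<le> (e / Cp) * norm (y - s)" using nh e Cp by (intro mult_left_mono) simp_all
      finally have bound: "norm (?M $$ (i,j)) \<le> (e / Cp) * norm (y - s)" .
      have "\<psi> (f (l y) $$ (i,j)) - \<psi> (f (l s) $$ (i,j)) - \<psi> (D (1\<^sub>m n) $$ (i,j)) * (y - s) = \<psi> (?M $$ (i,j))"
        unfolding M by (simp add: \<psi>.diff \<psi>(2))
      also have "norm \<dots> \<le> norm (?M $$ (i,j)) * Cp" by (rule Cp)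
      also have "\<dots> \<le> (e / Cp) * norm (y - s) * Cp" using bound Cp by (intro mult_right_mono) simp_all
      finally show "norm (\<psi> (f (l y) $$ (i,j)) - \<psi> (f (l s) $$ (i,j)) - \<psi> (D (1\<^sub>m n) $$ (i,j)) * (y - s)) \<le> e * norm (y - s)"
        using Cp by simp
    qed
  qed
  then show "(\<lambda>s. \<psi> (f (z + map_mat (scaleC s) (1\<^sub>m n)) $$ (i,j))) field_differentiable (at s within S)"
    unfolding l_def field_differentiable_def has_field_derivative_def
    using has_derivative_at_withinI by blast
qed

text \<open>Invertible elements need not be dense in \<open>M\<^sub>n(B)\<close>, but \<open>z + s1\<close> is invertible for \<open>|s| > \<parallel>z\<parallel>\<close>,
  and \<open>s = 0\<close> is reached by analytic continuation.\<close>

lemma analytic_on_mats_eq: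
  fixes B :: "'a::unital_cstar_algebra set"
  assumes f: "analytic_on_mats B n (mat_ball B n \<rho>) f" and g: "analytic_on_mats B n (mat_ball B n \<rho>) g"
    and B: "unital_star_subalgebra B" and n: "n \<ge> 1"
    and eq: "\<And>z. z \<in> mat_ball B n \<rho> \<Longrightarrow> invertible_mat z \<Longrightarrow> f z = g z"
    and z: "z \<in> mats B n" "mat_norm z < \<rho> / 3"
  shows "f z = g z"
proof -
  have \<rho>: "\<rho> > 0" using le_less_trans[OF mat_norm_nonneg z(2)] by simp
  have zc: "z \<in> carrier_mat n n" by (rule mats_carrier[OF z(1)])
  have z0: "z + map_mat (scaleC 0) (1\<^sub>m n) = z"
  proof -
    have "(0::complex) *\<^sub>C x = 0" for x :: 'a using scaleC_of_real[of 0 x] by simp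
    then show ?thesis using zc by (intro eq_matI) auto
  qed
  have lb: "z + map_mat (scaleC s) (1\<^sub>m n) \<in> mat_ball B n \<rho>" if "cmod s < 2 * \<rho> / 3" for s
  proof -
    have "mat_norm (z + map_mat (scaleC s) (1\<^sub>m n)) \<le> mat_norm z + mat_norm (map_mat (scaleC s) (1\<^sub>m n :: 'a mat))"
      using zc by (intro mat_norm_add[of _ n n]) simp_all
    also have "mat_norm (map_mat (scaleC s) (1\<^sub>m n :: 'a mat)) \<le> cmod s"
      using mat_norm_map_scaleC_le[of s "1\<^sub>m n :: 'a mat"] mat_norm_one[OF n, where 'a='a] by simp
    finally show ?thesis
      using that z mats_add[OF B z(1) mats_scaleC[OF B mats_one[OF B]]] by (simp add: mat_ball_def)
  qed
  have fg: "f z \<in> carrier_mat n n" "g z \<in> carrier_mat n n"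
    using f g lb[of 0] \<rho> unfolding z0 analytic_on_mats_def by (auto intro: mats_carrier)
  show ?thesis
  proof (rule eq_matI)
    fix i j assume "i < dim_row (g z)" "j < dim_col (g z)"
    with fg have ij: "i < n" "j < n" by auto
    show "f z $$ (i,j) = g z $$ (i,j)"
    proof (rule ccontr)
      assume "f z $$ (i,j) \<noteq> g z $$ (i,j)"
      then obtain \<psi> where \<psi>: "bounded_linear \<psi>" "\<And>c x. \<psi> (c *\<^sub>C x) = c * \<psi> x" "\<psi> (f z $$ (i,j) - g z $$ (i,j)) \<noteq> 0"
        using ex_complex_functional_ne_0[of "f z $$ (i,j) - g z $$ (i,j)"] by auto
      \<comment> \<open>||z|| < \<rho> / 3, so |s| < 2 \<rho> / 3 keeps z + s 1 in the ball of
        radius \<rho>, and |s| > \<rho> / 3 makes it invertible. The two functions thus agree on an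
        annulus inside a disc that contains 0.\<close>
      let ?S = "ball 0 (2 * \<rho> / 3) :: complex set"
      let ?s = "?S - cball 0 (\<rho> / 3)"
      let ?l = "\<lambda>s. z + map_mat (scaleC s) (1\<^sub>m n)"
      have "\<psi> (f (?l 0) $$ (i,j)) = \<psi> (g (?l 0) $$ (i,j))"
      proof (rule analytic_continuation_open[where s = ?s and s' = ?S and z = 0
            and f = "\<lambda>s. \<psi> (f (?l s) $$ (i,j))" and g = "\<lambda>s. \<psi> (g (?l s) $$ (i,j))"])
        have "complex_of_real (\<rho> / 2) \<in> ?s" using \<rho> by simp
        then show "?s \<noteq> {}" by blast
        show "open ?s" by (intro open_Diff) auto
        show "(\<lambda>s. \<psi> (f (?l s) $$ (i,j))) holomorphic_on ?S"
          by (rule analytic_on_mats_holomorphic[OF f B n \<psi>(1,2) ij z(1)]) (auto intro: lb)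
        show "(\<lambda>s. \<psi> (g (?l s) $$ (i,j))) holomorphic_on ?S"
          by (rule analytic_on_mats_holomorphic[OF g B n \<psi>(1,2) ij z(1)]) (auto intro: lb)
        show "\<psi> (f (?l s) $$ (i,j)) = \<psi> (g (?l s) $$ (i,j))" if "s \<in> ?s" for s
        proof -
          have "cmod s < 2 * \<rho> / 3" "mat_norm z < cmod s" using that z by auto
          then show ?thesis using eq[OF lb invertible_mat_add_scalar[OF zc]] by simp
        qed
      qed (use \<rho> in auto)
      then show False using \<psi>(3) by (simp add: z0 bounded_linear.linear[OF \<psi>(1)] linear_diff)
    qed
  qed (use fg in auto)
qed

section \<open>Freeness of matrix families\<close>

text \<open>The index records the algebra of the first factor, which decides what may be multiplied
  on the left. Closure under sums is included because an entry of a matrix product is a sum over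
  inner indices.\<close>

inductive alternating :: "('a::unital_cstar_algebra \<Rightarrow> 'a) \<Rightarrow> 'a set list \<Rightarrow> nat \<Rightarrow> 'a \<Rightarrow> bool"
  for E As where
  alternating_single: "i < length As \<Longrightarrow> x \<in> As ! i \<Longrightarrow> E x = 0 \<Longrightarrow> alternating E As i x"
| alternating_mult: "i < length As \<Longrightarrow> x \<in> As ! i \<Longrightarrow> E x = 0 \<Longrightarrow> alternating E As j y \<Longrightarrow> i \<noteq> j \<Longrightarrow>
    alternating E As i (x * y)"
| alternating_add: "alternating E As i x \<Longrightarrow> alternating E As i y \<Longrightarrow> alternating E As i (x + y)"
| alternating_zero: "alternating E As i 0"

text \<open>The statement is strengthened by an alternating prefix, which absorbs the factors one by one;
  sums then need not be expanded.\<close>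

lemma alternating_expectation_prefix:
  assumes free: "freely_independent E As" and E: "\<And>x y. E (x + y) = E x + E y"
    and x: "alternating E As i x"
  shows "(\<And>j. j < k \<Longrightarrow> idx j < length As \<and> a j \<in> As ! idx j \<and> E (a j) = 0) \<Longrightarrow>
    (\<And>j. Suc j < k \<Longrightarrow> idx j \<noteq> idx (Suc j)) \<Longrightarrow> (0 < k \<Longrightarrow> idx (k - 1) \<noteq> i) \<Longrightarrow>
    E (prod_list (map a [0..<k]) * x) = 0"
  using x
proof (induction arbitrary: k a idx rule: alternating.induct)
  case (alternating_single i x)
  define a' idx' where "a' = a(k := x)" and "idx' = idx(k := i)"
  have p: "prod_list (map a' [0..<Suc k]) = prod_list (map a [0..<k]) * x"
  proof -
    have "map a' [0..<k] = map a [0..<k]" by (simp add: a'_def)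
    then have "prod_list (map a' [0..<k]) = prod_list (map a [0..<k])" by (rule arg_cong)
    moreover have "a' k = x" by (simp add: a'_def)
    ultimately show ?thesis by simp
  qed
  have "E (prod_list (map a' [0..<Suc k])) = 0"
  proof (rule free[unfolded freely_independent_def, rule_format, of "Suc k" idx' a'])
    fix j assume "j < Suc k"
    then show "idx' j < length As \<and> a' j \<in> As ! idx' j \<and> E (a' j) = 0"
      using alternating_single by (cases "j = k") (simp_all add: a'_def idx'_def)
  next
    fix j assume "Suc j < Suc k"
    then show "idx' j \<noteq> idx' (Suc j)"
      using alternating_single by (cases "Suc j = k") (auto simp: idx'_def)
  qed simp
  then show ?case by (simp only: p)
next
  case (alternating_mult i x j y)
  define a' idx' where "a' = a(k := x)" and "idx' = idx(k := i)"
  have p: "prod_list (map a' [0..<Suc k]) = prod_list (map a [0..<k]) * x"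
  proof -
    have "map a' [0..<k] = map a [0..<k]" by (simp add: a'_def)
    then have "prod_list (map a' [0..<k]) = prod_list (map a [0..<k])" by (rule arg_cong)
    moreover have "a' k = x" by (simp add: a'_def)
    ultimately show ?thesis by simp
  qed
  have "E (prod_list (map a' [0..<Suc k]) * y) = 0"
  proof (rule alternating_mult.IH)
    fix l assume "l < Suc k"
    then show "idx' l < length As \<and> a' l \<in> As ! idx' l \<and> E (a' l) = 0"
      using alternating_mult by (cases "l = k") (simp_all add: a'_def idx'_def)
  next
    fix l assume "Suc l < Suc k"
    then show "idx' l \<noteq> idx' (Suc l)"
      using alternating_mult by (cases "Suc l = k") (auto simp: idx'_def)
  next
    show "idx' (Suc k - 1) \<noteq> j" using alternating_mult by (simp add: idx'_def)
  qed
  then show ?case by (simp only: p mult.assoc)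
next
  case (alternating_add i x y)
  have "E (prod_list (map a [0..<k]) * x) = 0" "E (prod_list (map a [0..<k]) * y) = 0"
    by (rule alternating_add.IH(1)[of k idx a], fact+, rule alternating_add.IH(2)[of k idx a], fact+)
  then show ?case by (simp add: ring_distribs E)
next
  case (alternating_zero i)
  then show ?case using E[of 0 0] by simp
qed

lemma alternating_expectation:
  assumes "freely_independent E As" "\<And>x y. E (x + y) = E x + E y" "alternating E As i x"
  shows "E x = 0"
  using alternating_expectation_prefix[OF assms, of 0] by simp

lemma alternating_sum: "(\<And>l. l \<in> I \<Longrightarrow> alternating E As i (f l)) \<Longrightarrow> alternating E As i (sum f I)"
  by (induction I rule: infinite_finite_induct) (auto intro: alternating_add alternating_zero)

definition fam_alternating :: "('a::unital_cstar_algebra \<Rightarrow> 'a) \<Rightarrow> 'a set list \<Rightarrow> nat \<Rightarrow> 'a mat_family \<Rightarrow> bool" where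
  "fam_alternating E As i x \<longleftrightarrow> (\<forall>n r c. r < n \<longrightarrow> c < n \<longrightarrow> alternating E As i (fam_at x n $$ (r,c)))"

lemma fam_centered_index:
  assumes "conditional_expectation B E" "fam_map E a = 0" "r < n" "c < n"
  shows "E (fam_at a n $$ (r,c)) = 0"
proof -
  have "map_mat E (fam_at a n) = 0\<^sub>m n n"
    using fam_at_cond_exp[OF assms(1), of a n] assms(2) by (simp add: fam_at_zero)
  then have "map_mat E (fam_at a n) $$ (r,c) = 0" using assms by simp
  then show ?thesis using assms by simp
qed

lemma fam_alternating_single:
  assumes "conditional_expectation B E" "i < length As" "a \<in> fam_entries (As ! i)" "fam_map E a = 0"
  shows "fam_alternating E As i a"
  unfolding fam_alternating_def
proof (intro allI impI)
  fix n r c :: nat assume rc: "r < n" "c < n"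
  show "alternating E As i (fam_at a n $$ (r, c))"
    by (rule alternating_single, rule assms, rule mats_index[OF fam_entriesD[OF assms(3)] rc],
        rule fam_centered_index[OF assms(1,4) rc])
qed

lemma fam_alternating_mult:
  assumes "conditional_expectation B E" "i < length As" "a \<in> fam_entries (As ! i)" "fam_map E a = 0"
    and "fam_alternating E As j y" "i \<noteq> j"
  shows "fam_alternating E As i (a * y)"
  unfolding fam_alternating_def
proof (intro allI impI)
  fix n r c :: nat assume rc: "r < n" "c < n"
  have "fam_at (a * y) n $$ (r,c) = (\<Sum>l=0..<n. fam_at a n $$ (r,l) * fam_at y n $$ (l,c))"
    using rc by (simp add: fam_at_mult scalar_prod_def)
  also have "alternating E As i \<dots>"
  proof (intro alternating_sum alternating_mult[OF assms(2) _ _ _ assms(6)])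
    fix l assume "l \<in> {0..<n}"
    then have l: "l < n" by simp
    show "fam_at a n $$ (r,l) \<in> As ! i" by (rule mats_index[OF fam_entriesD[OF assms(3)] rc(1) l])
    show "E (fam_at a n $$ (r,l)) = 0" by (rule fam_centered_index[OF assms(1,4) rc(1) l])
    show "alternating E As j (fam_at y n $$ (l,c))" using assms(5) l rc by (simp add: fam_alternating_def)
  qed
  finally show "alternating E As i (fam_at (a * y) n $$ (r,c))" .
qed

lemma fam_alternating_expectation:
  assumes E: "conditional_expectation B E" and "freely_independent E As" "fam_alternating E As i x"
  shows "fam_map E x = 0"
proof (rule fam_eqI, rule eq_matI)
  fix n r c assume "r < dim_row (fam_at (0 :: 'a mat_family) n)" "c < dim_col (fam_at (0 :: 'a mat_family) n)"
  then have rc: "r < n" "c < n" by simp_all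
  then have "E (fam_at x n $$ (r,c)) = 0"
    using assms(3) by (intro alternating_expectation[OF assms(2) cond_exp_linear(1)[OF E], of i]) (simp add: fam_alternating_def)
  then show "fam_at (fam_map E x) n $$ (r,c) = fam_at 0 n $$ (r,c)"
    using rc by (simp add: fam_at_cond_exp[OF E] fam_at_zero)
qed simp_all

text \<open>Freeness is assumed for elements of the algebra. It passes to matrices because a matrix
  is centered exactly when its entries are, and the entries of an alternating product are sums of
  alternating words.\<close>

lemma fam_free_words:
  assumes E: "conditional_expectation B E" and free: "freely_independent E [A1, A2]"
    and a: "a \<in> fam_entries A1" "fam_map E a = 0" and s: "s \<in> fam_entries A2" "fam_map E s = 0"
  shows "fam_map E (a * s * (a * s) ^ k) = 0" "fam_map E ((a * s) ^ k * a) = 0"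
    "fam_map E (s * (a * s) ^ k) = 0" "fam_map E (s * (a * s) ^ k * a) = 0"
proof -
  let ?As = "[A1, A2]"
  have a0: "a \<in> fam_entries (?As ! 0)" and s1: "s \<in> fam_entries (?As ! 1)" using a s by simp_all
  have A: "fam_alternating E ?As 0 (a * y)" if "fam_alternating E ?As 1 y" for y
    by (rule fam_alternating_mult[OF E _ a0 a(2) that]) simp_all
  have S: "fam_alternating E ?As 1 (s * y)" if "fam_alternating E ?As 0 y" for y
    by (rule fam_alternating_mult[OF E _ s1 s(2) that]) simp_all
  have w1: "fam_alternating E ?As 1 (s * (a * s) ^ k)" for k
  proof (induction k)
    case 0
    show ?case using fam_alternating_single[OF E _ s1 s(2)] by simp
  next
    case (Suc k)
    then show ?case using S[OF A[OF Suc]] by (simp add: mult.assoc)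
  qed
  have w0: "fam_alternating E ?As 0 ((a * s) ^ k * a)" for k
  proof (induction k)
    case 0
    show ?case using fam_alternating_single[OF E _ a0 a(2)] by simp
  next
    case (Suc k)
    then show ?case using A[OF S[OF Suc]] by (simp add: mult.assoc)
  qed
  note ex = fam_alternating_expectation[OF E free]
  show "fam_map E (a * s * (a * s) ^ k) = 0" using ex[OF A[OF w1[of k]]] by (simp add: mult.assoc)
  show "fam_map E ((a * s) ^ k * a) = 0" by (rule ex[OF w0])
  show "fam_map E (s * (a * s) ^ k) = 0" by (rule ex[OF w1])
  show "fam_map E (s * (a * s) ^ k * a) = 0" using ex[OF S[OF w0[of k]]] by (simp add: mult.assoc)
qed

lemma unital_star_subalgebra_generated:
  "unital_star_subalgebra (star_algebra_generated B a)" "insert a B \<subseteq> star_algebra_generated B a"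
proof -
  show "unital_star_subalgebra (star_algebra_generated B a)"
    unfolding star_algebra_generated_def by (rule hull_in) (auto simp: unital_star_subalgebra_def)
  show "insert a B \<subseteq> star_algebra_generated B a"
    unfolding star_algebra_generated_def by (rule hull_subset)
qed

section \<open>Laws and moments\<close>

lemma nc_eval_cong:
  assumes "nc_eq B p q" "adj Y = Y"
  shows "nc_eval Y p = nc_eval Y q"
  using assms(1)
proof induction
  case (add_commute p q)
  show ?case by (simp add: add.commute)
qed (simp_all add: add.assoc mult.assoc ring_distribs scaleC_add_right scaleC_add_left scaleC_scaleC
    scaleC_mult_left scaleC_mult_right scaleC_minus_left adj_add adj_scaleC adj_mult adj_adj assms(2))

lemma law_eqD:
  assumes law: "law B E Y = law B E' Y'" and Y: "adj Y = Y" "adj Y' = Y'" and p: "p \<in> nc_exprs B"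
  shows "E (nc_eval Y p) = E' (nc_eval Y' p)"
proof -
  define f where "f = {(p, q). nc_eq B p q} `` {p}"
  have f: "f \<in> nc_polys B" unfolding f_def nc_polys_def by (rule quotientI[OF p])
  have pf: "p \<in> f" using nc_eq.refl[OF p] by (simp add: f_def)
  have img: "nc_eval Z ` f = {nc_eval Z p}" if "adj Z = Z" for Z
  proof -
    have "nc_eval Z ` f \<subseteq> {nc_eval Z p}"
    proof (rule image_subsetI)
      fix q assume "q \<in> f"
      then have "nc_eq B p q" by (simp add: f_def)
      from nc_eval_cong[OF this that] show "nc_eval Z q \<in> {nc_eval Z p}" by (simp only: singleton_iff)
    qed
    moreover have "nc_eval Z p \<in> nc_eval Z ` f" by (rule imageI[OF pf])
    ultimately show ?thesis by blast
  qed
  have "law B E Y f = law B E' Y' f" by (simp only: law)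
  then show ?thesis using f by (simp add: law_def img Y)
qed

text \<open>Pairs of values of one polynomial at \<open>Y\<close> and at \<open>Y'\<close>. As a
  relation closed under sums and products it transfers equality of laws to matrix expressions
  without exhibiting the polynomials.\<close>

definition moment_rel :: "'a::unital_cstar_algebra set \<Rightarrow> 'a \<Rightarrow> 'a \<Rightarrow> 'a \<Rightarrow> 'a \<Rightarrow> bool" where
  "moment_rel B Y Y' x x' \<longleftrightarrow> (\<exists>p\<in>nc_exprs B. x = nc_eval Y p \<and> x' = nc_eval Y' p)"

lemma moment_rel_coeff: "b \<in> B \<Longrightarrow> moment_rel B Y Y' b b"
  unfolding moment_rel_def by (intro bexI[of _ "Coeff b"]) (auto simp: nc_exprs_def)

lemma moment_rel_indet: "moment_rel B Y Y' Y Y'"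
  unfolding moment_rel_def by (intro bexI[of _ Indet]) (auto simp: nc_exprs_def)

lemma moment_rel_add: "moment_rel B Y Y' x x' \<Longrightarrow> moment_rel B Y Y' y y' \<Longrightarrow> moment_rel B Y Y' (x + y) (x' + y')"
  unfolding moment_rel_def
proof (elim bexE conjE)
  fix p q assume "p \<in> nc_exprs B" "q \<in> nc_exprs B" "x = nc_eval Y p" "x' = nc_eval Y' p" "y = nc_eval Y q" "y' = nc_eval Y' q"
  then show "\<exists>p\<in>nc_exprs B. x + y = nc_eval Y p \<and> x' + y' = nc_eval Y' p"
    by (intro bexI[of _ "Add p q"]) (auto simp: nc_exprs_def)
qed

lemma moment_rel_mult: "moment_rel B Y Y' x x' \<Longrightarrow> moment_rel B Y Y' y y' \<Longrightarrow> moment_rel B Y Y' (x * y) (x' * y')"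
  unfolding moment_rel_def
proof (elim bexE conjE)
  fix p q assume "p \<in> nc_exprs B" "q \<in> nc_exprs B" "x = nc_eval Y p" "x' = nc_eval Y' p" "y = nc_eval Y q" "y' = nc_eval Y' q"
  then show "\<exists>p\<in>nc_exprs B. x * y = nc_eval Y p \<and> x' * y' = nc_eval Y' p"
    by (intro bexI[of _ "Mult p q"]) (auto simp: nc_exprs_def)
qed

lemma moment_rel_sum:
  assumes "0 \<in> B" "\<And>i. i \<in> I \<Longrightarrow> moment_rel B Y Y' (f i) (g i)"
  shows "moment_rel B Y Y' (sum f I) (sum g I)"
  using assms(2)
  by (induction I rule: infinite_finite_induct) (auto intro: moment_rel_add moment_rel_coeff[OF assms(1)])

definition fam_rel :: "('a::unital_cstar_algebra \<Rightarrow> 'a \<Rightarrow> bool) \<Rightarrow> 'a mat_family \<Rightarrow> 'a mat_family \<Rightarrow> bool" where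
  "fam_rel \<rho> x x' \<longleftrightarrow> (\<forall>n i j. i < n \<longrightarrow> j < n \<longrightarrow> \<rho> (fam_at x n $$ (i,j)) (fam_at x' n $$ (i,j)))"

lemma fam_rel_moment:
  assumes B: "unital_star_subalgebra B"
  shows "x \<in> fam_entries B \<Longrightarrow> fam_rel (moment_rel B Y Y') x x"
    "fam_rel (moment_rel B Y Y') (fam_const Y) (fam_const Y')"
    "fam_rel (moment_rel B Y Y') x x' \<Longrightarrow> fam_rel (moment_rel B Y Y') y y' \<Longrightarrow> fam_rel (moment_rel B Y Y') (x * y) (x' * y')"
    "fam_rel (moment_rel B Y Y') x x' \<Longrightarrow> fam_rel (moment_rel B Y Y') y y' \<Longrightarrow> fam_rel (moment_rel B Y Y') (x + y) (x' + y')"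
proof -
  note zero = star_subalgebra_zero[OF B]
  show "x \<in> fam_entries B \<Longrightarrow> fam_rel (moment_rel B Y Y') x x"
    by (auto simp: fam_rel_def intro!: moment_rel_coeff mats_index[OF fam_entriesD])
  show "fam_rel (moment_rel B Y Y') (fam_const Y) (fam_const Y')"
    by (auto simp: fam_rel_def fam_at_const amplify_index intro: moment_rel_coeff[OF zero] moment_rel_indet)
  show "fam_rel (moment_rel B Y Y') (x + y) (x' + y')"
    if "fam_rel (moment_rel B Y Y') x x'" "fam_rel (moment_rel B Y Y') y y'"
    using that by (auto simp: fam_rel_def fam_at_add intro: moment_rel_add)
  show "fam_rel (moment_rel B Y Y') (x * y) (x' * y')"
    if "fam_rel (moment_rel B Y Y') x x'" "fam_rel (moment_rel B Y Y') y y'"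
    using that by (auto simp: fam_rel_def fam_at_mult scalar_prod_def intro!: moment_rel_sum[OF zero] moment_rel_mult)
qed

lemma fam_rel_expectation:
  assumes E: "conditional_expectation B E" "conditional_expectation B E'"
    and law: "law B E Y = law B E' Y'" and Y: "adj Y = Y" "adj Y' = Y'" and r: "fam_rel (moment_rel B Y Y') x x'"
  shows "fam_map E x = fam_map E' x'"
proof (rule fam_eqI, rule eq_matI)
  fix n i j assume "i < dim_row (fam_at (fam_map E' x') n)" "j < dim_col (fam_at (fam_map E' x') n)"
  then have ij: "i < n" "j < n" by simp_all
  then have "moment_rel B Y Y' (fam_at x n $$ (i,j)) (fam_at x' n $$ (i,j))"
    using r by (simp add: fam_rel_def)
  then obtain p where "p \<in> nc_exprs B" "fam_at x n $$ (i,j) = nc_eval Y p" "fam_at x' n $$ (i,j) = nc_eval Y' p"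
    unfolding moment_rel_def by blast
  with law_eqD[OF law Y] ij
  show "fam_at (fam_map E x) n $$ (i,j) = fam_at (fam_map E' x') n $$ (i,j)"
    by (simp add: fam_at_cond_exp[OF E(1)] fam_at_cond_exp[OF E(2)])
qed simp_all

section \<open>Transfer to matrices\<close>

lemma mat_inv_eqI:
  fixes M N :: "'a::unital_cstar_algebra mat"
  assumes c: "M \<in> carrier_mat n n" "N \<in> carrier_mat n n" and inv: "M * N = 1\<^sub>m n" "N * M = 1\<^sub>m n"
  shows "mat_inv M = N"
  unfolding mat_inv_def
proof (rule the_equality)
  show "inverts_mat M N \<and> inverts_mat N M" using c inv by (simp add: inverts_mat_def)
  fix N' assume N': "inverts_mat M N' \<and> inverts_mat N' M"
  then have 1: "M * N' = 1\<^sub>m n" "N' * M = 1\<^sub>m (dim_row N')" using c by (auto simp: inverts_mat_def)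
  have "dim_col N' = n" using arg_cong[OF 1(1), of dim_col] by simp
  moreover have "dim_row N' = n" using arg_cong[OF 1(2), of dim_col] c by simp
  ultimately have c': "N' \<in> carrier_mat n n" by (intro carrier_matI)
  have "N' = (N * M) * N'" using c' by (simp add: inv)
  also have "\<dots> = N * (M * N')" by (rule assoc_mult_mat[OF c(2,1) c'])
  also have "\<dots> = N" using c by (simp add: 1)
  finally show "N' = N" .
qed

text \<open>With \<open>y\<close> inverse to \<open>z\<close> at size \<open>n\<close>, the first
  equation makes y + r a left inverse of \<open>w\<close> and the second makes (1 + g) y a right
  inverse; hence both are the inverse. Invertibility is stated at one size since the embedded family
  vanishes at all others.\<close>

lemma inverse_perturbation:
  fixes z w r g :: "'a::unital_cstar_algebra mat_family"
  assumes 1: "(1 + z * r) * w = z" and 2: "w * (1 + g) = z" and z: "invertible_mat (fam_at z n)"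
  shows "invertible_mat (fam_at w n)" "fam_at r n = mat_inv (fam_at w n) - mat_inv (fam_at z n)"
proof -
  obtain Zi where Zi: "fam_at z n * Zi = 1\<^sub>m n" "Zi * fam_at z n = 1\<^sub>m (dim_row Zi)"
    using z by (auto simp: invertible_mat_def inverts_mat_def)
  have "dim_col Zi = n" using arg_cong[OF Zi(1), of dim_col] by simp
  moreover have rZ: "dim_row Zi = n" using arg_cong[OF Zi(2), of dim_col] by simp
  ultimately have c: "Zi \<in> carrier_mat n n" by (intro carrier_matI)
  define y where "y = fam_single n Zi"
  have y: "fam_at y n = Zi" using c by (simp add: y_def fam_at_single)
  have zy: "fam_at (z * y) n = 1\<^sub>m n" "fam_at (y * z) n = 1\<^sub>m n"
    using Zi rZ by (simp_all add: fam_at_mult y)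
  have "fam_at (y * ((1 + z * r) * w)) n = fam_at (y * w + (y * z) * (r * w)) n"
    by (simp add: algebra_simps)
  also have "\<dots> = fam_at (y * w) n + fam_at (r * w) n"
    by (simp only: fam_at_add fam_at_mult[of "y * z"] zy left_mult_one_mat[OF fam_at_carrier])
  also have "\<dots> = fam_at ((y + r) * w) n" by (simp add: algebra_simps flip: fam_at_add)
  finally have l: "fam_at (y + r) n * fam_at w n = 1\<^sub>m n"
    unfolding 1 zy by (simp add: fam_at_mult)
  have "fam_at (w * (1 + g) * y) n = 1\<^sub>m n" unfolding 2 zy ..
  then have r: "fam_at w n * fam_at ((1 + g) * y) n = 1\<^sub>m n"
    by (simp only: mult.assoc fam_at_mult[of w])
  have "fam_at (y + r) n = fam_at (y + r) n * (fam_at w n * fam_at ((1 + g) * y) n)"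
    unfolding r by (rule right_mult_one_mat[OF fam_at_carrier, symmetric])
  also have "\<dots> = (fam_at (y + r) n * fam_at w n) * fam_at ((1 + g) * y) n"
    by (rule assoc_mult_mat[OF fam_at_carrier fam_at_carrier fam_at_carrier, symmetric])
  also have "\<dots> = fam_at ((1 + g) * y) n" unfolding l by (rule left_mult_one_mat[OF fam_at_carrier])
  finally have r': "fam_at w n * fam_at (y + r) n = 1\<^sub>m n" using r by simp
  show "invertible_mat (fam_at w n)" by (rule invertible_matI[OF fam_at_carrier fam_at_carrier r' l])
  have "mat_inv (fam_at w n) = fam_at (y + r) n" by (rule mat_inv_eqI[OF fam_at_carrier fam_at_carrier r' l])
  moreover have "mat_inv (fam_at z n) = Zi" by (rule mat_inv_eqI[OF fam_at_carrier c Zi(1)]) (simp add: Zi(2) rZ)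
  ultimately show "fam_at r n = mat_inv (fam_at w n) - mat_inv (fam_at z n)"
    by (simp add: fam_at_add flip: y) (rule eq_matI; simp)
qed

locale matrix_setting =
  fixes B :: "'a::unital_cstar_algebra set" and E :: "'a \<Rightarrow> 'a" and Y :: 'a
  assumes B: "unital_cstar_subalgebra B" and E: "conditional_expectation B E"
begin

lemma BS: "unital_star_subalgebra B" and closed_B: "closed B"
  using B by (auto simp: unital_cstar_subalgebra_def)

lemma operator_valued_fam: "operator_valued (fam_entries B) (fam_map E)"
proof (rule operator_valued.intro)
  show "closed (fam_entries B)" by (rule closed_fam_entries[OF closed_B])
  show "1 \<in> fam_entries B" by (rule fam_entries_one[OF BS])
  have "E 1 = 1" using E star_subalgebra_one[OF BS] by (auto simp: conditional_expectation_def)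
  then show "fam_map E 1 = 1"
    by (intro fam_eqI eq_matI) (auto simp: fam_at_cond_exp[OF E] fam_at_one cond_exp_linear[OF E])
  show "bounded_linear (fam_map E)" by (rule bounded_linear_fam_cond_exp[OF E])
qed (auto intro: fam_entries_add fam_entries_mult fam_entries_scaleR fam_cond_exp_entries fam_cond_exp_bimodule BS E)

sublocale cauchy_setting "fam_entries B" "fam_map E" "fam_const Y"
  by (rule cauchy_setting.intro[OF operator_valued_fam])

lemma cauchy_tilde_fam:
  assumes "norm (fam_const Y * x) < 1"
  shows "cauchy_tilde E Y n (fam_at x n) = fam_at (fam_map E (x * neumann (fam_const Y * x))) n"
proof -
  note inv = neumann_inverse[OF assms]
  have at: "1\<^sub>m n - amplify n Y * fam_at x n = fam_at (1 - fam_const Y * x) n"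
    by (simp add: fam_at_simps fam_at_const)
  have "mat_inv (1\<^sub>m n - amplify n Y * fam_at x n) = fam_at (neumann (fam_const Y * x)) n"
    unfolding at by (rule mat_inv_eqI[OF fam_at_carrier fam_at_carrier])
      (simp_all only: fam_at_mult[symmetric] inv fam_at_one)
  then show ?thesis unfolding cauchy_tilde_def by (simp add: fam_at_cond_exp[OF E] fam_at_mult)
qed

lemma cauchy_tilde_G:
  assumes x: "x \<in> fam_entries B" "norm x \<le> rad"
  shows "cauchy_tilde E Y n (fam_at x n) = fam_at (G x) n"
proof -
  let ?Y = "fam_const Y"
  have n1: "norm (x * ?Y) < 1" using norm_wY[OF x(2)] by simp
  have "norm (?Y * x) \<le> norm ?Y * rad"
    by (rule order_trans[OF norm_mult_ineq mult_left_mono[OF x(2) norm_ge_zero]])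
  with rad_bounds(1) have n2: "norm (?Y * x) < 1" by (simp add: mult.commute)
  have "neumann (?Y * x) = 1 + ?Y * (x * neumann (?Y * x))"
    using neumann_eq(1)[OF n2] by (simp add: mult.assoc)
  also have "x * neumann (?Y * x) = neumann (x * ?Y) * x" by (rule neumann_push[OF n1 n2, symmetric])
  finally have "x * neumann (?Y * x) = x * 1 + x * (?Y * neumann (x * ?Y)) * x"
    by (simp only: ring_distribs mult.assoc)
  then have "fam_map E (x * neumann (?Y * x)) = G x"
    by (simp only: E.add E_left[OF x(1)] E_right[OF x(1)] mult.assoc)
      (simp add: G_def F_def E_one E_right[OF x(1)] flip: mult.assoc)
  then show ?thesis using cauchy_tilde_fam[OF n2] by simp
qed

lemma fam_at_single_self: "z \<in> mats B n \<Longrightarrow> fam_at (fam_single n z) n = z"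
  by (simp add: fam_at_single mats_carrier)

lemma norm_fam_single_mats: "z \<in> mats B n \<Longrightarrow> norm (fam_single n z) = mat_norm z"
  by (rule norm_fam_single[OF mats_carrier])

lemma fam_single_entries: "z \<in> mats B n \<Longrightarrow> fam_single n z \<in> fam_entries B"
  by (rule fam_entries_single[OF BS])

lemma inj_on_cauchy_tilde: "inj_on (cauchy_tilde E Y n) (mat_ball B n rad)"
proof (rule inj_onI)
  fix z z' assume z: "z \<in> mat_ball B n rad" "z' \<in> mat_ball B n rad"
    and eq: "cauchy_tilde E Y n z = cauchy_tilde E Y n z'"
  define x x' where "x = fam_single n z" and "x' = fam_single n z'"
  have zm: "z \<in> mats B n" "z' \<in> mats B n" using z by (auto simp: mat_ball_def)
  have x: "x \<in> fam_entries B" "norm x \<le> rad" "fam_at x n = z" "x' \<in> fam_entries B" "norm x' \<le> rad" "fam_at x' n = z'"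
    using z zm by (auto simp: mat_ball_def x_def x'_def fam_single_entries norm_fam_single_mats fam_at_single_self)
  have "fam_at (G x) m = fam_at (G x') m" for m
  proof (cases "m = n")
    case True
    then show ?thesis using cauchy_tilde_G[OF x(1,2), of n] cauchy_tilde_G[OF x(4,5), of n] eq x by simp
  next
    case False
    then have "fam_at x m = 0\<^sub>m m m" "fam_at x' m = 0\<^sub>m m m"
      using zm by (simp_all add: x_def x'_def fam_at_single mats_carrier)
    then show ?thesis by (simp add: G_def fam_at_simps left_mult_zero_mat[OF fam_at_carrier])
  qed
  then have "G x = G x'" by (rule fam_eqI)
  with G_lower[OF x(2,5)] have "x = x'" by simp
  then show "z = z'" using x by simp
qed

definition K_mat :: "nat \<Rightarrow> 'a mat \<Rightarrow> 'a mat" where "K_mat n z = fam_at (K (fam_single n z)) n"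

definition R_mat :: "nat \<Rightarrow> 'a mat \<Rightarrow> 'a mat" where "R_mat n z = fam_at (R (fam_single n z)) n"

lemma K_mat:
  assumes z: "z \<in> mats B n" "mat_norm z \<le> rad / 2"
  shows "K_mat n z \<in> mats B n" "mat_norm (K_mat n z) \<le> 2 * mat_norm z" "cauchy_tilde E Y n (K_mat n z) = z"
proof -
  define x where "x = fam_single n z"
  have x: "x \<in> fam_entries B" "norm x = mat_norm z" "fam_at x n = z"
    using z by (simp_all add: x_def fam_single_entries norm_fam_single_mats fam_at_single_self)
  then have nx: "norm x \<le> rad / 2" using z by simp
  have KD: "K x \<in> fam_entries B" by (rule K_D[OF nx x(1)])
  then show "K_mat n z \<in> mats B n" unfolding K_mat_def x_def[symmetric] by (rule fam_entriesD)
  show "mat_norm (K_mat n z) \<le> 2 * mat_norm z"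
    unfolding K_mat_def x_def[symmetric] using order_trans[OF mat_norm_fam_at_le K(3)[OF nx]] x by simp
  show "cauchy_tilde E Y n (K_mat n z) = z"
    unfolding K_mat_def x_def[symmetric] using cauchy_tilde_G[OF KD K(1)[OF nx]] K(2)[OF nx] x by simp
qed

lemma norm_Y_rad: "rad * norm Y \<le> 1"
proof -
  have "norm Y = norm (fam_const Y)"
  proof (rule antisym[OF _ norm_fam_const_le])
    show "norm Y \<le> norm (fam_const Y)"
      using norm_fam_index_le[of 0 1 0 "fam_const Y"] by (simp add: fam_at_const amplify_index)
  qed
  with rad_bounds(1) show ?thesis by simp
qed

lemma cauchy_tilde_inverse_K_mat:
  assumes "0 < \<rho>" "\<rho> \<le> rad / 2"
  shows "cauchy_tilde_inverse B E Y \<rho> K_mat"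
  unfolding cauchy_tilde_inverse_def
proof (intro conjI exI[of _ rad] allI impI ballI)
  fix n z assume z: "z \<in> mat_ball B n \<rho>"
  then have z': "z \<in> mats B n" "mat_norm z \<le> rad / 2" "mat_norm z < rad / 2" using assms by (auto simp: mat_ball_def)
  show "K_mat n z \<in> mat_ball B n rad" using K_mat(1,2)[OF z'(1,2)] z' by (simp add: mat_ball_def)
  show "cauchy_tilde E Y n (K_mat n z) = z" by (rule K_mat(3)[OF z'(1,2)])
qed (use assms rad_pos norm_Y_rad inj_on_cauchy_tilde in auto)

lemma fam_const_central: "central (fam_const (c *\<^sub>C 1))"
  unfolding central_def using fam_const_scaleC_central fam_cond_exp_scaleC[OF E] by blast

text \<open>The derivative is that of \<open>R\<close> on families, restricted to one size.
  Commutation with central elements becomes complex homogeneity, and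
  \<open>cdiff_derivative_D\<close> keeps the values over \<open>B\<close>.\<close>

lemma analytic_R_mat: "analytic_on_mats B n (mat_ball B n (rad / 2)) (R_mat n)"
  unfolding analytic_on_mats_def
proof (intro conjI ballI)
  fix z assume "z \<in> mat_ball B n (rad / 2)"
  then have z: "z \<in> mats B n" "mat_norm z < rad / 2" by (auto simp: mat_ball_def)
  define x where "x = fam_single n z"
  have x: "x \<in> fam_entries B" "norm x < rad / 2"
    using z by (simp_all add: x_def fam_single_entries norm_fam_single_mats)
  show "R_mat n z \<in> mats B n"
    unfolding R_mat_def x_def[symmetric] using x by (intro fam_entriesD R_D) simp_all
  obtain T where T: "(R has_derivative T) (at x)" "\<And>j h. central j \<Longrightarrow> T (j * h) = j * T h"
    using cdiff_R[OF x(2)] by (auto simp: cdiff_def)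
  interpret T: bounded_linear T using T(1) by (rule has_derivative_bounded_linear)
  have TD: "T h \<in> fam_entries B" if "h \<in> fam_entries B" for h
    by (rule cdiff_derivative_D[OF T(1) _ x that]) (simp add: R_D)
  define D where "D h = fam_at (T (fam_single n h)) n" for h
  have nT: "norm (T h) \<le> onorm T * norm h" for h by (rule onorm[OF T.bounded_linear_axioms])
  show "\<exists>D C.
        (\<forall>h\<in>mats B n. D h \<in> mats B n \<and> mat_norm (D h) \<le> C * mat_norm h) \<and>
        (\<forall>h\<in>mats B n. \<forall>k\<in>mats B n. D (h + k) = D h + D k) \<and>
        (\<forall>h\<in>mats B n. \<forall>c. D (map_mat (scaleC c) h) = map_mat (scaleC c) (D h)) \<and>
        (\<forall>e>0. \<exists>d>0. \<forall>h\<in>mats B n. mat_norm h < d \<longrightarrow> z + h \<in> mat_ball B n (rad / 2) \<longrightarrow>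
            mat_norm (R_mat n (z + h) - R_mat n z - D h) \<le> e * mat_norm h)"
  proof (rule exI[of _ D], rule exI[of _ "onorm T"], intro conjI ballI allI impI)
    fix h assume h: "h \<in> mats B n"
    show "D h \<in> mats B n" unfolding D_def by (intro fam_entriesD TD fam_single_entries h)
    show "mat_norm (D h) \<le> onorm T * mat_norm h"
      unfolding D_def using order_trans[OF mat_norm_fam_at_le nT[of "fam_single n h"]] by (simp add: norm_fam_single_mats h)
    show "D (h + k) = D h + D k" if "k \<in> mats B n" for k
      using h that by (simp add: D_def fam_single_add mats_carrier T.add fam_at_add)
    show "D (map_mat (scaleC c) h) = map_mat (scaleC c) (D h)" for c
      by (simp add: D_def fam_single_scaleC[OF mats_carrier[OF h]] T(2)[OF fam_const_central] fam_at_mult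
          fam_at_const fam_at_const_scaleC)
  next
    fix e :: real assume "0 < e"
    then obtain d where d: "0 < d" "\<And>y. norm (y - x) < d \<Longrightarrow> norm (R y - R x - T (y - x)) \<le> e * norm (y - x)"
      using T(1) unfolding has_derivative_at_alt by blast
    show "\<exists>d>0. \<forall>h\<in>mats B n. mat_norm h < d \<longrightarrow> z + h \<in> mat_ball B n (rad / 2) \<longrightarrow>
        mat_norm (R_mat n (z + h) - R_mat n z - D h) \<le> e * mat_norm h"
    proof (intro exI[of _ d] conjI ballI impI d(1))
      fix h assume h: "h \<in> mats B n" "mat_norm h < d"
      define y where "y = fam_single n h"
      have s: "fam_single n (z + h) = x + y"
        using z h by (simp add: x_def y_def fam_single_add mats_carrier)
      have "R_mat n (z + h) - R_mat n z - D h = fam_at (R (x + y) - R x - T y) n"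
        by (simp add: R_mat_def D_def s fam_at_diff flip: x_def y_def)
      also have "mat_norm \<dots> \<le> norm (R (x + y) - R x - T y)" by (rule mat_norm_fam_at_le)
      also have "\<dots> \<le> e * norm y"
        using d(2)[of "x + y"] h by (simp add: y_def norm_fam_single_mats)
      finally show "mat_norm (R_mat n (z + h) - R_mat n z - D h) \<le> e * mat_norm h"
        using h by (simp add: y_def norm_fam_single_mats)
    qed
  qed
qed

lemma is_R_transform_R_mat:
  assumes "adj Y = Y"
  shows "is_R_transform B (law B E Y) R_mat"
  unfolding is_R_transform_def
proof (intro exI conjI allI impI ballI)
  show "cauchy_tilde_inverse B E Y (rad / 2) K_mat"
    by (rule cauchy_tilde_inverse_K_mat) (use rad_pos in simp_all)
  fix n
  show "analytic_on_mats B n (mat_ball B n (rad / 2)) (R_mat n)" by (rule analytic_R_mat)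
  fix z assume "z \<in> mat_ball B n (rad / 2)" and inv: "invertible_mat z"
  then have z: "z \<in> mats B n" "mat_norm z \<le> rad / 2" by (auto simp: mat_ball_def)
  define x where "x = fam_single n z"
  have x: "fam_at x n = z" "norm x \<le> rad / 2" using z by (simp_all add: x_def fam_at_single_self norm_fam_single_mats)
  have inv': "invertible_mat (fam_at x n)" using inv x by simp
  note p = inverse_perturbation[OF R_props(3,6)[OF x(2)] inv']
  show "invertible_mat (K_mat n z)" "R_mat n z = mat_inv (K_mat n z) - mat_inv z"
    using p x(1) by (simp_all add: K_mat_def R_mat_def flip: x_def)
qed (use E assms in simp_all)

lemma cauchy_tilde_inverse_unique:
  assumes "cauchy_tilde_inverse B E Y \<rho> K'"
  shows "\<exists>\<delta>>0. \<forall>n\<ge>1. \<forall>z\<in>mats B n. mat_norm z < \<delta> \<longrightarrow> K' n z = K_mat n z"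
proof -
  obtain \<epsilon> where \<rho>: "0 < \<rho>" and \<epsilon>: "0 < \<epsilon>" "\<And>n. n \<ge> 1 \<Longrightarrow> inj_on (cauchy_tilde E Y n) (mat_ball B n \<epsilon>)"
    "\<And>n z. n \<ge> 1 \<Longrightarrow> z \<in> mat_ball B n \<rho> \<Longrightarrow> K' n z \<in> mat_ball B n \<epsilon> \<and> cauchy_tilde E Y n (K' n z) = z"
    using assms unfolding cauchy_tilde_inverse_def by blast
  \<comment> \<open>\<open>K_mat\<close> at most doubles the norm, so \<epsilon> / 2 places its
    values in the ball on which injectivity is assumed for the other inverse.\<close>
  define \<delta> where "\<delta> = min \<rho> (min (\<epsilon> / 2) (rad / 2))"
  have "K' n z = K_mat n z" if n: "n \<ge> 1" and z: "z \<in> mats B n" "mat_norm z < \<delta>" for n z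
  proof (rule inj_onD[OF \<epsilon>(2)[OF n]])
    have z': "z \<in> mat_ball B n \<rho>" "mat_norm z \<le> rad / 2" using z by (auto simp: \<delta>_def mat_ball_def)
    show "K' n z \<in> mat_ball B n \<epsilon>" using \<epsilon>(3)[OF n z'(1)] by simp
    show "K_mat n z \<in> mat_ball B n \<epsilon>" using K_mat(1,2)[OF z(1) z'(2)] z by (auto simp: \<delta>_def mat_ball_def)
    show "cauchy_tilde E Y n (K' n z) = cauchy_tilde E Y n (K_mat n z)"
      using \<epsilon>(3)[OF n z'(1)] K_mat(3)[OF z(1) z'(2)] by simp
  qed
  moreover have "0 < \<delta>" using \<rho> \<epsilon> rad_pos by (simp add: \<delta>_def)
  ultimately show ?thesis by blast
qed

end

text \<open>Partial sums of the two Neumann series are values of the same matrix polynomial at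
  \<open>Y\<close> and \<open>Y'\<close>, so their expectations agree; continuity of the
  expectations gives the claim.\<close>

lemma cauchy_tilde_law:
  assumes B: "unital_cstar_subalgebra B" and E: "conditional_expectation B E" "conditional_expectation B E'"
    and law: "law B E Y = law B E' Y'" and Y: "adj Y = Y" "adj Y' = Y'"
    and z: "z \<in> mats B n" "norm Y * mat_norm z < 1" "norm Y' * mat_norm z < 1"
  shows "cauchy_tilde E Y n z = cauchy_tilde E' Y' n z"
proof -
  interpret s: matrix_setting B E Y using B E by unfold_locales
  interpret s': matrix_setting B E' Y' using B E by unfold_locales
  define x where "x = fam_single n z"
  have x: "x \<in> fam_entries B" "norm x = mat_norm z" "fam_at x n = z"
    using z by (simp_all add: x_def s.fam_single_entries s.norm_fam_single_mats s.fam_at_single_self)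
  have n: "norm (fam_const Z * x) < 1" if "norm Z * mat_norm z < 1" for Z
  proof -
    have "norm (fam_const Z * x) \<le> norm (fam_const Z) * norm x" by (rule norm_mult_ineq)
    also have "\<dots> \<le> norm Z * mat_norm z" using x by (intro mult_mono norm_fam_const_le) simp_all
    finally show ?thesis using that by simp
  qed
  let ?c = "fam_const Y * x" and ?c' = "fam_const Y' * x"
  note rel = fam_rel_moment[OF s.BS, where Y = Y and Y' = Y']
  have c: "fam_rel (moment_rel B Y Y') ?c ?c'" by (intro rel x)
  have ck: "fam_rel (moment_rel B Y Y') (?c ^ k) (?c' ^ k)" for k
  proof (induction k)
    case 0
    show ?case using rel(1)[OF fam_entries_one[OF s.BS]] by simp
  next
    case (Suc k)
    then show ?case unfolding power_Suc by (rule rel(3)[OF c])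
  qed
  have cs: "fam_rel (moment_rel B Y Y') (\<Sum>k<m. ?c ^ k) (\<Sum>k<m. ?c' ^ k)" for m
  proof (induction m)
    case 0
    show ?case using rel(1)[OF fam_entries_zero[OF s.BS]] by simp
  next
    case (Suc m)
    then show ?case unfolding sum.lessThan_Suc by (rule rel(4)[OF _ ck])
  qed
  have eq: "fam_map E (x * (\<Sum>k<m. ?c ^ k)) = fam_map E' (x * (\<Sum>k<m. ?c' ^ k))" for m
    by (rule fam_rel_expectation[OF E law Y rel(3)[OF rel(1)[OF x(1)] cs]])
  have "(\<lambda>m. fam_map E (x * (\<Sum>k<m. ?c ^ k))) \<longlonglongrightarrow> fam_map E (x * neumann ?c)"
    unfolding neumann_def
    by (intro s.E.tendsto tendsto_intros summable_LIMSEQ complete_algebra_summable_geometric n z)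
  moreover have "(\<lambda>m. fam_map E' (x * (\<Sum>k<m. ?c' ^ k))) \<longlonglongrightarrow> fam_map E' (x * neumann ?c')"
    unfolding neumann_def
    by (intro s'.E.tendsto tendsto_intros summable_LIMSEQ complete_algebra_summable_geometric n z)
  ultimately have "fam_map E (x * neumann ?c) = fam_map E' (x * neumann ?c')"
    unfolding eq by (rule LIMSEQ_unique)
  then show ?thesis
    using s.cauchy_tilde_fam[OF n[OF z(2)], of n] s'.cauchy_tilde_fam[OF n[OF z(3)], of n] x by simp
qed

lemma analytic_on_mats_subset:
  assumes f: "analytic_on_mats B n U f" and S: "S \<subseteq> U"
  shows "analytic_on_mats B n S f"
  unfolding analytic_on_mats_def
proof (intro conjI ballI)
  fix z assume "z \<in> S"
  then have z: "z \<in> U" using S by blast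
  then show "f z \<in> mats B n" using f unfolding analytic_on_mats_def by blast
  obtain D C where D:
    "\<forall>h\<in>mats B n. D h \<in> mats B n \<and> mat_norm (D h) \<le> C * mat_norm h"
    "\<forall>h\<in>mats B n. \<forall>k\<in>mats B n. D (h + k) = D h + D k"
    "\<forall>h\<in>mats B n. \<forall>c. D (map_mat (scaleC c) h) = map_mat (scaleC c) (D h)"
    "\<forall>e>0. \<exists>d>0. \<forall>h\<in>mats B n. mat_norm h < d \<longrightarrow> z + h \<in> U \<longrightarrow>
        mat_norm (f (z + h) - f z - D h) \<le> e * mat_norm h"
    using bspec[OF conjunct2[OF f[unfolded analytic_on_mats_def]] z] by (elim exE conjE) (rule that)
  have "\<forall>e>0. \<exists>d>0. \<forall>h\<in>mats B n. mat_norm h < d \<longrightarrow> z + h \<in> S \<longrightarrow>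
        mat_norm (f (z + h) - f z - D h) \<le> e * mat_norm h"
    using D(4) S by (meson subsetD)
  with D(1-3) show "\<exists>D C.
      (\<forall>h\<in>mats B n. D h \<in> mats B n \<and> mat_norm (D h) \<le> C * mat_norm h) \<and>
      (\<forall>h\<in>mats B n. \<forall>k\<in>mats B n. D (h + k) = D h + D k) \<and>
      (\<forall>h\<in>mats B n. \<forall>c. D (map_mat (scaleC c) h) = map_mat (scaleC c) (D h)) \<and>
      (\<forall>e>0. \<exists>d>0. \<forall>h\<in>mats B n. mat_norm h < d \<longrightarrow> z + h \<in> S \<longrightarrow>
          mat_norm (f (z + h) - f z - D h) \<le> e * mat_norm h)"
    by (intro exI[of _ D] exI[of _ C] conjI)
qed

text \<open>The two functions may come with different expectations, elements and inverse functions.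
  Near 0 each inverse equals the one constructed by the fixed point argument; the transforms agree
  because the laws do, hence so do the inverses. This fixes the values at invertible arguments, and
  analyticity the rest.\<close>

lemma is_R_transform_unique:
  assumes B: "unital_cstar_subalgebra B" and R: "is_R_transform B \<mu> R1" "is_R_transform B \<mu> R2"
  shows "\<exists>\<delta>>0. \<forall>n\<ge>1. \<forall>z\<in>mats B n. mat_norm z < \<delta> \<longrightarrow> R1 n z = R2 n z"
proof -
  have BS: "unital_star_subalgebra B" using B by (simp add: unital_cstar_subalgebra_def)
  obtain E1 Y1 \<rho>1 K1 where 1: "conditional_expectation B E1" "adj Y1 = Y1" "law B E1 Y1 = \<mu>"
      "cauchy_tilde_inverse B E1 Y1 \<rho>1 K1"
      "\<And>n. n \<ge> 1 \<Longrightarrow> analytic_on_mats B n (mat_ball B n \<rho>1) (R1 n)"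
      "\<And>n z. n \<ge> 1 \<Longrightarrow> z \<in> mat_ball B n \<rho>1 \<Longrightarrow> invertible_mat z \<Longrightarrow> R1 n z = mat_inv (K1 n z) - mat_inv z"
    using R(1) unfolding is_R_transform_def by blast
  obtain E2 Y2 \<rho>2 K2 where 2: "conditional_expectation B E2" "adj Y2 = Y2" "law B E2 Y2 = \<mu>"
      "cauchy_tilde_inverse B E2 Y2 \<rho>2 K2"
      "\<And>n. n \<ge> 1 \<Longrightarrow> analytic_on_mats B n (mat_ball B n \<rho>2) (R2 n)"
      "\<And>n z. n \<ge> 1 \<Longrightarrow> z \<in> mat_ball B n \<rho>2 \<Longrightarrow> invertible_mat z \<Longrightarrow> R2 n z = mat_inv (K2 n z) - mat_inv z"
    using R(2) unfolding is_R_transform_def by blast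
  interpret s1: matrix_setting B E1 Y1 using B 1 by unfold_locales
  interpret s2: matrix_setting B E2 Y2 using B 2 by unfold_locales
  obtain \<delta>1 where \<delta>1: "\<delta>1 > 0" "\<And>n z. n \<ge> 1 \<Longrightarrow> z \<in> mats B n \<Longrightarrow> mat_norm z < \<delta>1 \<Longrightarrow> K1 n z = s1.K_mat n z"
    using s1.cauchy_tilde_inverse_unique[OF 1(4)] by blast
  obtain \<delta>2 where \<delta>2: "\<delta>2 > 0" "\<And>n z. n \<ge> 1 \<Longrightarrow> z \<in> mats B n \<Longrightarrow> mat_norm z < \<delta>2 \<Longrightarrow> K2 n z = s2.K_mat n z"
    using s2.cauchy_tilde_inverse_unique[OF 2(4)] by blast
  have \<rho>: "\<rho>1 > 0" "\<rho>2 > 0" using 1(4) 2(4) by (auto simp: cauchy_tilde_inverse_def)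
  \<comment> \<open>The inverse ?w supplied by the second realization has norm at most
    \<open>c\<close>. The first bound keeps it where the first transform is injective, the second
    one where both Neumann series converge; \<rho> contains c / 2 because ||?w|| \<le> 2
    ||z||.\<close>
  define c where "c = min s1.rad (1 / (norm Y1 + norm Y2 + 1))"
  have Ypos: "norm Y1 + norm Y2 + 1 > 0" using norm_ge_zero[of Y1] norm_ge_zero[of Y2] by linarith
  then have c: "c > 0" "c \<le> s1.rad" using s1.rad_pos by (simp_all add: c_def)
  have "c \<le> 1 / (norm Y1 + norm Y2 + 1)" by (simp add: c_def)
  with Ypos have c1: "(norm Y1 + norm Y2 + 1) * c \<le> 1" by (simp add: pos_le_divide_eq mult.commute)
  define \<rho> where "\<rho> = min (min \<rho>1 \<rho>2) (min (min \<delta>1 \<delta>2) (min (min (s1.rad / 2) (s2.rad / 2)) (c / 2)))"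
  have \<rho>_pos: "\<rho> > 0" using \<rho> \<delta>1 \<delta>2 s1.rad_pos s2.rad_pos c by (simp add: \<rho>_def)
  have KK: "K1 n z = K2 n z" if n: "n \<ge> 1" and z: "z \<in> mats B n" "mat_norm z < \<rho>" for n z
  proof -
    have zs: "mat_norm z < \<delta>1" "mat_norm z < \<delta>2" "mat_norm z \<le> s1.rad / 2" "mat_norm z \<le> s2.rad / 2" "2 * mat_norm z < c"
      using z(2) by (auto simp: \<rho>_def)
    let ?w = "s2.K_mat n z"
    note w = s2.K_mat[OF z(1) zs(4)]
    have wc: "mat_norm ?w \<le> c" using w(2) zs(5) by simp
    have "norm Y1 * mat_norm ?w < 1" "norm Y2 * mat_norm ?w < 1"
    proof -
      have lt: "a * mat_norm ?w < 1" if "a < norm Y1 + norm Y2 + 1" "0 \<le> a" for a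
      proof -
        have "a * mat_norm ?w \<le> a * c" by (rule mult_left_mono[OF wc that(2)])
        also have "\<dots> < (norm Y1 + norm Y2 + 1) * c" using that c(1) by (intro mult_strict_right_mono)
        finally show ?thesis using c1 by simp
      qed
      show "norm Y1 * mat_norm ?w < 1" "norm Y2 * mat_norm ?w < 1"
        by (rule lt; simp add: add_nonneg_pos add_pos_nonneg add.commute add.left_commute)+
    qed
    from cauchy_tilde_law[OF B 1(1) 2(1) _ 1(2) 2(2) w(1) this]
    have ct: "cauchy_tilde E1 Y1 n ?w = z" using 1(3) 2(3) w(3) by simp
    note w1 = s1.K_mat[OF z(1) zs(3)]
    have "s1.K_mat n z = ?w"
    proof (rule inj_onD[OF s1.inj_on_cauchy_tilde])
      show "cauchy_tilde E1 Y1 n (s1.K_mat n z) = cauchy_tilde E1 Y1 n ?w" unfolding ct w1(3) ..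
      have "mat_norm (s1.K_mat n z) < s1.rad" using w1(2) zs(5) c(2) by linarith
      then show "s1.K_mat n z \<in> mat_ball B n s1.rad" using w1(1) unfolding mat_ball_def by blast
      have "mat_norm ?w < s1.rad" using w(2) zs(5) c(2) by linarith
      then show "?w \<in> mat_ball B n s1.rad" using w(1) unfolding mat_ball_def by blast
    qed
    then show ?thesis using \<delta>1(2)[OF n z(1) zs(1)] \<delta>2(2)[OF n z(1) zs(2)] by simp
  qed
  have sub: "mat_ball B n \<rho> \<subseteq> mat_ball B n \<rho>1" "mat_ball B n \<rho> \<subseteq> mat_ball B n \<rho>2" for n
    by (auto simp: mat_ball_def \<rho>_def)
  have "R1 n z = R2 n z" if n: "n \<ge> 1" and z: "z \<in> mats B n" "mat_norm z < \<rho> / 3" for n z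
  proof (rule analytic_on_mats_eq[OF analytic_on_mats_subset[OF 1(5)[OF n] sub(1)] analytic_on_mats_subset[OF 2(5)[OF n] sub(2)] BS n _ z])
    fix y assume y: "y \<in> mat_ball B n \<rho>" "invertible_mat y"
    have y12: "y \<in> mat_ball B n \<rho>1" "y \<in> mat_ball B n \<rho>2" using y(1) sub by blast+
    have "K1 n y = K2 n y" using y(1) by (intro KK[OF n]) (simp_all add: mat_ball_def)
    then show "R1 n y = R2 n y" by (simp only: 1(6)[OF n y12(1) y(2)] 2(6)[OF n y12(2) y(2)])
  qed
  with \<rho>_pos show ?thesis by (intro exI[of _ "\<rho> / 3"]) simp
qed

lemma is_R_transform_R_transform:
  "is_R_transform B \<mu> R \<Longrightarrow> is_R_transform B \<mu> (R_transform B \<mu>)"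
  unfolding R_transform_def by (rule someI[of "is_R_transform B \<mu>"])

section \<open>Composition with the map \<eta>\<close>

lemma analytic_on_mats_map:
  assumes f: "analytic_on_mats B n U f" and B: "unital_star_subalgebra B"
    and lin: "linear_map_on B B \<eta>" and M: "0 \<le> M" "\<And>w. w \<in> mats B n \<Longrightarrow> mat_norm (map_mat \<eta> w) \<le> M * mat_norm w"
    and U: "U \<subseteq> mats B n"
  shows "analytic_on_mats B n U (\<lambda>z. map_mat \<eta> (f z))"
proof -
  have eadd: "\<eta> (x + y) = \<eta> x + \<eta> y" if "x \<in> B" "y \<in> B" for x y
    using lin that by (auto simp: linear_map_on_def)
  have eB: "\<eta> x \<in> B" and esc: "\<eta> (c *\<^sub>C x) = c *\<^sub>C \<eta> x" if "x \<in> B" for x c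
    using lin that by (auto simp: linear_map_on_def)
  have ediff: "\<eta> (x - y) = \<eta> x - \<eta> y" if "x \<in> B" "y \<in> B" for x y
    using eadd[OF star_subalgebra_diff[OF B that] that(2)] by simp
  have mB: "map_mat \<eta> w \<in> mats B n" if "w \<in> mats B n" for w
    by (rule mats_map[OF that]) (rule eB, assumption+)
  have fB: "f z \<in> mats B n" if "z \<in> U" for z using f that by (simp add: analytic_on_mats_def)
  show ?thesis
    unfolding analytic_on_mats_def
  proof (intro conjI ballI mB fB)
    fix z assume z: "z \<in> U"
    obtain D C where D':
      "\<forall>h\<in>mats B n. D h \<in> mats B n \<and> mat_norm (D h) \<le> C * mat_norm h"
      "\<forall>h\<in>mats B n. \<forall>k\<in>mats B n. D (h + k) = D h + D k"
      "\<forall>h\<in>mats B n. \<forall>c. D (map_mat (scaleC c) h) = map_mat (scaleC c) (D h)"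
      "\<forall>e>0. \<exists>d>0. \<forall>h\<in>mats B n. mat_norm h < d \<longrightarrow> z + h \<in> U \<longrightarrow>
          mat_norm (f (z + h) - f z - D h) \<le> e * mat_norm h"
      using bspec[OF conjunct2[OF f[unfolded analytic_on_mats_def]] z] by (elim exE conjE) (rule that)
    note D = bspec[OF D'(1)] bspec[OF bspec[OF D'(2)]] spec[OF bspec[OF D'(3)]]
    show "\<exists>D C.
        (\<forall>h\<in>mats B n. D h \<in> mats B n \<and> mat_norm (D h) \<le> C * mat_norm h) \<and>
        (\<forall>h\<in>mats B n. \<forall>k\<in>mats B n. D (h + k) = D h + D k) \<and>
        (\<forall>h\<in>mats B n. \<forall>c. D (map_mat (scaleC c) h) = map_mat (scaleC c) (D h)) \<and>
        (\<forall>e>0. \<exists>d>0. \<forall>h\<in>mats B n. mat_norm h < d \<longrightarrow> z + h \<in> U \<longrightarrow>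
            mat_norm (map_mat \<eta> (f (z + h)) - map_mat \<eta> (f z) - D h) \<le> e * mat_norm h)"
    proof (rule exI[of _ "\<lambda>h. map_mat \<eta> (D h)"], rule exI[of _ "M * C"], intro conjI ballI allI impI)
      fix h assume h: "h \<in> mats B n"
      note Dh = conjunct1[OF D(1)[OF h]] and Dn = conjunct2[OF D(1)[OF h]]
      show "map_mat \<eta> (D h) \<in> mats B n" by (rule mB[OF Dh])
      show "mat_norm (map_mat \<eta> (D h)) \<le> M * C * mat_norm h"
        using order_trans[OF M(2)[OF Dh] mult_left_mono[OF Dn M(1)]] by (simp add: mult.assoc)
      show "map_mat \<eta> (D (h + k)) = map_mat \<eta> (D h) + map_mat \<eta> (D k)" if k: "k \<in> mats B n" for k
        using Dh conjunct1[OF D(1)[OF k]] unfolding D(2)[OF h k]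
        by (intro eq_matI) (auto simp: mats_iff eadd)
      show "map_mat \<eta> (D (map_mat (scaleC c) h)) = map_mat (scaleC c) (map_mat \<eta> (D h))" for c
        using Dh unfolding D(3)[OF h] by (intro eq_matI) (auto simp: mats_iff esc)
    next
      fix e :: real assume e: "0 < e"
      \<comment> \<open>M + 1 instead of \<open>M\<close>, since \<open>M\<close> may be 0.\<close>
      then have "e / (M + 1) > 0" using M(1) by simp
      with D'(4) obtain d where d: "d > 0" "\<And>h. h \<in> mats B n \<Longrightarrow> mat_norm h < d \<Longrightarrow> z + h \<in> U \<Longrightarrow>
          mat_norm (f (z + h) - f z - D h) \<le> e / (M + 1) * mat_norm h" by blast
      show "\<exists>d>0. \<forall>h\<in>mats B n. mat_norm h < d \<longrightarrow> z + h \<in> U \<longrightarrow>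
          mat_norm (map_mat \<eta> (f (z + h)) - map_mat \<eta> (f z) - map_mat \<eta> (D h)) \<le> e * mat_norm h"
      proof (intro exI[of _ d] conjI ballI impI d(1))
        fix h assume h: "h \<in> mats B n" "mat_norm h < d" "z + h \<in> U"
        note m = fB[OF h(3)] fB[OF z] conjunct1[OF D(1)[OF h(1)]]
        let ?w = "f (z + h) - f z - D h"
        have w: "?w \<in> mats B n" by (intro mats_diff[OF B] m)
        have "map_mat \<eta> (f (z + h)) - map_mat \<eta> (f z) - map_mat \<eta> (D h) = map_mat \<eta> ?w"
          using m by (intro eq_matI) (auto simp: mats_iff ediff star_subalgebra_diff[OF B])
        also have "mat_norm \<dots> \<le> M * mat_norm ?w" by (rule M(2)[OF w])
        also have "\<dots> \<le> (M + 1) * (e / (M + 1) * mat_norm h)"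
          using d(2)[OF h] M(1) by (intro mult_mono) simp_all
        finally show "mat_norm (map_mat \<eta> (f (z + h)) - map_mat \<eta> (f z) - map_mat \<eta> (D h)) \<le> e * mat_norm h"
          using M(1) by simp
      qed
    qed
  qed
qed

text \<open>Positivity of \<eta> - id enters here: \<eta> is the identity plus a completely positive
  map, whose amplifications have a common bound.\<close>

lemma linear_map_completely_bounded:
  assumes B: "unital_cstar_subalgebra B" and lin: "linear_map_on B B \<eta>"
    and cp: "completely_positive B B (\<lambda>b. \<eta> b - b)" and w: "w \<in> mats B n"
  shows "mat_norm (map_mat \<eta> w) \<le> (1 + norm (\<eta> 1 - 1)) * mat_norm w"
proof -
  have wc: "w \<in> carrier_mat n n" by (rule mats_carrier[OF w])
  have "map_mat \<eta> w = w + map_mat (\<lambda>b. \<eta> b - b) w" using wc by (intro eq_matI) auto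
  also have "mat_norm \<dots> \<le> mat_norm w + mat_norm (map_mat (\<lambda>b. \<eta> b - b) w)"
    using wc by (intro mat_norm_add[of _ n n]) simp_all
  also have "\<dots> \<le> mat_norm w + norm (\<eta> 1 - 1) * mat_norm w"
    using completely_positive_completely_bounded[OF B cp w] by simp
  finally show ?thesis by (simp add: algebra_simps)
qed

theorem theorem3p1:
  fixes B :: "'a::unital_cstar_algebra set"
    and E Etilde \<eta> :: "'a \<Rightarrow> 'a"
    and X V :: 'a
    and \<mu> \<nu> :: "'a nc_expr set \<Rightarrow> 'a"
  assumes "valued_probability_space B E"
    and "linear_map_on B B \<eta>"
    and "completely_positive B B (\<lambda>b. \<eta> b - b)"
    and "freely_independent E [star_algebra_generated B X, star_algebra_generated B V]"
    and "adj X = X"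
    and "\<mu> = law B E X"
    and "\<And>b1 b2. b1 \<in> B \<Longrightarrow> b2 \<in> B \<Longrightarrow> V * b1 * adj V * b2 * V = V * b1 * \<eta> b2"
    and "\<And>b. b \<in> B \<Longrightarrow> E (V * b * adj V) = b"
    and "Etilde = (\<lambda>T. E (V * T * adj V))"
    and "\<nu> = law B Etilde (adj V * X * V)"
  shows "conditional_expectation B Etilde \<and> is_convolution_power B \<eta> \<mu> \<nu>"
proof
  have B: "unital_cstar_subalgebra B" and E: "conditional_expectation B E"
    using assms(1) by (auto simp: valued_probability_space_def)
  then have BS: "unital_star_subalgebra B" by (simp add: unital_cstar_subalgebra_def)
  show Et: "conditional_expectation B Etilde"
    unfolding assms(9) by (rule conditional_expectation_compression[OF E BS assms(8)])
  define Y where "Y = adj V * X * V"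
  have Ysa: "adj Y = Y" by (simp add: Y_def adj_mult adj_adj assms(5) mult.assoc)
  interpret s: matrix_setting B E X using B E by unfold_locales
  interpret t: matrix_setting B Etilde Y using B Et by unfold_locales
  let ?D = "fam_entries B"
  let ?E = "fam_map E"
  let ?V = "fam_const V" and ?V' = "fam_const (adj V)"
  let ?\<eta> = "fam_map \<eta>"
  have \<eta>: "\<eta> x \<in> B" "\<eta> (x + y) = \<eta> x + \<eta> y" if "x \<in> B" "y \<in> B" for x y
    using assms(2) that by (auto simp: linear_map_on_def)
  have \<eta>0: "\<eta> 0 = 0" using \<eta>(2)[of 0 0] star_subalgebra_zero[OF BS] by simp
  define M where "M = 1 + norm (\<eta> 1 - 1)"
  have M: "0 \<le> M" by (simp add: M_def)
  have \<eta>M: "mat_norm (map_mat \<eta> w) \<le> M * mat_norm w" if "w \<in> mats B n" for n w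
    unfolding M_def by (rule linear_map_completely_bounded[OF B assms(2,3) that])
  have at\<eta>: "fam_at (?\<eta> x) n = map_mat \<eta> (fam_at x n)" if "x \<in> ?D" for x n
  proof (rule fam_at_map)
    fix n
    show "mat_norm (map_mat \<eta> (fam_at x n)) \<le> M * norm x"
      using order_trans[OF \<eta>M[OF fam_entriesD[OF that]] mult_left_mono[OF mat_norm_fam_at_le M]] .
  qed
  have \<eta>D: "?\<eta> x \<in> ?D" if "x \<in> ?D" for x
    unfolding fam_entries_def mem_Collect_eq at\<eta>[OF that]
    by (intro allI mats_map[OF fam_entriesD[OF that]]) (rule \<eta>, assumption+)
  have \<eta>n: "norm (?\<eta> x) \<le> M * norm x" if "x \<in> ?D" for x
    by (rule norm_fam_le, unfold at\<eta>[OF that])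
      (rule order_trans[OF \<eta>M[OF fam_entriesD[OF that]] mult_left_mono[OF mat_norm_fam_at_le M]])
  have mult_index: "fam_at (x * y) n $$ (i,j) = (\<Sum>k=0..<n. fam_at x n $$ (i,k) * fam_at y n $$ (k,j))"
    if "i < n" "j < n" for x y :: "'a mat_family" and n i j
    using that by (simp add: fam_at_mult scalar_prod_def)
  have VxV: "fam_at (?V * x * ?V') n $$ (i,j) = V * fam_at x n $$ (i,j) * adj V" if "i < n" "j < n" for x n i j
    using that by (simp add: fam_const_mult_index)
  have VV: "?V * b * ?V' * b' * ?V = ?V * b * ?\<eta> b'" if b: "b \<in> ?D" "b' \<in> ?D" for b b'
  proof (rule fam_eqI, rule eq_matI)
    fix n i j assume "i < dim_row (fam_at (?V * b * ?\<eta> b') n)" "j < dim_col (fam_at (?V * b * ?\<eta> b') n)"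
    then have ij: "i < n" "j < n" by simp_all
    have "fam_at (?V * b * ?V' * b' * ?V) n $$ (i,j)
        = (\<Sum>k=0..<n. V * fam_at b n $$ (i,k) * adj V * fam_at b' n $$ (k,j)) * V"
      unfolding fam_const_mult_index(2)[OF ij] unfolding mult_index[OF ij] using ij by (simp add: VxV)
    also have "\<dots> = (\<Sum>k=0..<n. V * fam_at b n $$ (i,k) * adj V * fam_at b' n $$ (k,j) * V)"
      by (simp add: sum_distrib_right)
    also have "\<dots> = (\<Sum>k=0..<n. V * fam_at b n $$ (i,k) * \<eta> (fam_at b' n $$ (k,j)))"
    proof (rule sum.cong)
      fix k assume "k \<in> {0..<n}"
      then have "fam_at b n $$ (i,k) \<in> B" "fam_at b' n $$ (k,j) \<in> B"
        using b ij by (auto intro: mats_index[OF fam_entriesD])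
      then show "V * fam_at b n $$ (i,k) * adj V * fam_at b' n $$ (k,j) * V = V * fam_at b n $$ (i,k) * \<eta> (fam_at b' n $$ (k,j))"
        by (rule assms(7))
    qed simp
    also have "\<dots> = fam_at (?V * b * ?\<eta> b') n $$ (i,j)"
      unfolding mult_index[OF ij] using ij by (simp add: fam_const_mult_index at\<eta>[OF b(2)])
    finally show "fam_at (?V * b * ?V' * b' * ?V) n $$ (i,j) = fam_at (?V * b * ?\<eta> b') n $$ (i,j)" .
  qed simp_all
  have EV: "?E (?V * b * ?V') = b" if "b \<in> ?D" for b
    by (rule fam_eqI, rule eq_matI)
      (simp_all add: fam_at_cond_exp[OF E] VxV assms(8) mats_index[OF fam_entriesD[OF that]])
  have Et_apply: "Etilde a = E (V * a * adj V)" for a by (simp add: assms(9))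
  have Etil: "fam_map Etilde x = ?E (?V * x * ?V')" for x
    by (rule fam_eqI, rule eq_matI) (simp_all add: fam_at_cond_exp[OF E] fam_at_cond_exp[OF Et] VxV Et_apply)
  have cY: "fam_const Y = ?V' * fam_const X * ?V" by (simp add: Y_def fam_const_mult)
  note AX = unital_star_subalgebra_generated[where B = B and a = X] and AV = unital_star_subalgebra_generated[where B = B and a = V]
  let ?P = "fam_entries (star_algebra_generated B X)" and ?Q = "fam_entries (star_algebra_generated B V)"
  have mono: "fam_entries C \<subseteq> fam_entries C'" if "C \<subseteq> C'" for C C' :: "'a set"
    using that by (auto simp: fam_entries_def mats_iff)
  have P: "?D \<subseteq> ?P" "fam_const X \<in> ?P" and Q: "?D \<subseteq> ?Q" "?V \<in> ?Q" "?V' \<in> ?Q"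
    using AX AV star_subalgebra_adj[OF AV(1), of V] by (auto intro!: mono fam_entries_const)
  obtain d where d: "0 < d" "d \<le> s.rad / 2"
    "\<And>z. z \<in> ?D \<Longrightarrow> norm z < d \<Longrightarrow> norm (?\<eta> (s.R z) * z) \<le> 1/2 \<and>
      ?E (?V * (z * neumann (- (?\<eta> (s.R z) * z)) *
        neumann (?V' * fam_const X * ?V * (z * neumann (- (?\<eta> (s.R z) * z))))) * ?V') = z"
  proof (rule s.free_compression[where V = ?V and V' = ?V' and \<eta> = ?\<eta> and M = M and P = ?P and Q = ?Q])
    show "?E (a * s * (a * s) ^ k) = 0 \<and> ?E ((a * s) ^ k * a) = 0 \<and> ?E (s * (a * s) ^ k) = 0 \<and> ?E (s * (a * s) ^ k * a) = 0"
      if "a \<in> ?P" "?E a = 0" "s \<in> ?Q" "?E s = 0" for a s k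
      using fam_free_words[OF E assms(4) that] by blast
  qed (use \<eta>D \<eta>n M VV EV P Q in \<open>auto intro: fam_entries_add fam_entries_diff fam_entries_mult AX AV\<close>)
  define k where "k z = z * neumann (- (?\<eta> (s.R z) * z))" for z
  define K where "K n z = fam_at (k (fam_single n z)) n" for n z
  define Rn where "Rn n z = map_mat \<eta> (s.R_mat n z)" for n z
  \<comment> \<open>\<open>k\<close> at most doubles the norm, so t.rad / 2 keeps its values in the
    ball on which the transform of \<open>Y\<close> is injective.\<close>
  define \<rho> where "\<rho> = min d (t.rad / 2)"
  have \<rho>: "0 < \<rho>" "\<rho> \<le> d" "\<rho> \<le> t.rad / 2" "\<rho> \<le> s.rad / 2" using d t.rad_pos by (auto simp: \<rho>_def)
  have k: "k z \<in> ?D" "norm (k z) \<le> 2 * norm z" "(1 + z * ?\<eta> (s.R z)) * k z = z" "k z * (1 + ?\<eta> (s.R z) * z) = z"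
    if z: "z \<in> ?D" "norm z < \<rho>" for z
  proof -
    let ?h = "?\<eta> (s.R z)"
    have nz: "norm z \<le> s.rad / 2" "norm z < d" using z \<rho> by simp_all
    have hD: "?h \<in> ?D" by (rule \<eta>D[OF s.R_D[OF nz(1) z(1)]])
    have h: "norm (- (?h * z)) \<le> 1/2" using d(3)[OF z(1) nz(2)] by simp
    then have h1: "norm (- (?h * z)) < 1" by linarith
    note inv = neumann_inverse[OF h1]
    show "k z \<in> ?D" unfolding k_def by (intro s.mult_D s.neumann_D s.minus_D z hD h1)
    have "norm (k z) \<le> norm z * norm (neumann (- (?h * z)))" unfolding k_def by (rule norm_mult_ineq)
    also have "\<dots> \<le> norm z * 2" by (intro mult_left_mono norm_neumann_le h) simp
    finally show "norm (k z) \<le> 2 * norm z" by simp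
    have "(1 + z * ?h) * k z = z * ((1 - - (?h * z)) * neumann (- (?h * z)))"
      by (simp add: k_def algebra_simps)
    then show "(1 + z * ?h) * k z = z" by (simp only: inv mult_1_right)
    have "k z * (1 + ?h * z) = z * (neumann (- (?h * z)) * (1 - - (?h * z)))"
      by (simp add: k_def algebra_simps)
    then show "k z * (1 + ?h * z) = z" by (simp only: inv mult_1_right)
  qed
  have single: "fam_single n z \<in> ?D" "norm (fam_single n z) < \<rho>" "fam_at (fam_single n z) n = z"
    if "z \<in> mat_ball B n \<rho>" for n z
    using that by (auto simp: mat_ball_def s.fam_single_entries s.norm_fam_single_mats s.fam_at_single_self)
  have "is_R_transform B \<nu> Rn"
    unfolding is_R_transform_def
  proof (intro exI conjI allI impI ballI)
    show "conditional_expectation B Etilde" by (rule Et)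
    show "adj Y = Y" by (rule Ysa)
    show "law B Etilde Y = \<nu>" by (simp add: assms(10) Y_def)
    \<comment> \<open>The inverse is given by the explicit \<open>k\<close>: injectivity of the
      transform comes from the general theory for \<open>Y\<close>, and the value at
      \<open>k\<close> from the free compression.\<close>
    show "cauchy_tilde_inverse B Etilde Y \<rho> K"
      unfolding cauchy_tilde_inverse_def
    proof (intro conjI exI[of _ t.rad] allI impI ballI)
      fix n z assume "z \<in> mat_ball B n \<rho>"
      note x = single[OF this]
      let ?x = "fam_single n z"
      note kx = k[OF x(1,2)]
      have nk: "norm (k ?x) < t.rad" using kx(2) x(2) \<rho>(3) by linarith
      have "mat_norm (K n z) < t.rad"
        unfolding K_def by (rule le_less_trans[OF mat_norm_fam_at_le nk])
      moreover have "K n z \<in> mats B n" unfolding K_def by (rule fam_entriesD[OF kx(1)])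
      ultimately show "K n z \<in> mat_ball B n t.rad" unfolding mat_ball_def by blast
      have "norm (fam_const Y * k ?x) \<le> norm (fam_const Y) * t.rad"
        by (rule order_trans[OF norm_mult_ineq mult_left_mono]) (use nk in simp_all)
      also have "\<dots> < 1" using t.rad_bounds(1) by (simp add: mult.commute)
      finally have "cauchy_tilde Etilde Y n (K n z) = fam_at (fam_map Etilde (k ?x * neumann (fam_const Y * k ?x))) n"
        unfolding K_def by (rule t.cauchy_tilde_fam)
      also have "fam_map Etilde (k ?x * neumann (fam_const Y * k ?x)) = ?x"
        unfolding Etil cY k_def using d(3)[OF x(1)] x(2) \<rho>(2) by simp
      finally show "cauchy_tilde Etilde Y n (K n z) = z" by (simp add: x(3))
    qed (use \<rho> t.rad_pos t.norm_Y_rad t.inj_on_cauchy_tilde in auto)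
    fix n
    show "analytic_on_mats B n (mat_ball B n \<rho>) (Rn n)"
      unfolding Rn_def[abs_def]
    proof (rule analytic_on_mats_map[OF _ BS assms(2) M \<eta>M])
      show "analytic_on_mats B n (mat_ball B n \<rho>) (s.R_mat n)"
        by (rule analytic_on_mats_subset[OF s.analytic_R_mat]) (use \<rho> in \<open>auto simp: mat_ball_def\<close>)
    qed (auto simp: mat_ball_def)
    fix z assume zb: "z \<in> mat_ball B n \<rho>" and inv: "invertible_mat z"
    note x = single[OF zb]
    let ?x = "fam_single n z"
    have "norm ?x \<le> s.rad / 2" using x(2) \<rho>(4) by simp
    then have RD: "s.R ?x \<in> ?D" by (rule s.R_D[OF _ x(1)])
    have inv': "invertible_mat (fam_at ?x n)" using inv by (simp add: x(3))
    \<comment> \<open>\<open>k z\<close> and \<eta>(R z) satisfy the two equations that link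
      \<open>K z\<close> and \<open>R z\<close> in the general theory, so \<eta>(R z) is the
      difference of inverses demanded of an R-transform.\<close>
    note p = inverse_perturbation[OF k(3,4)[OF x(1,2)] inv']
    show "invertible_mat (K n z)" unfolding K_def by (rule p(1))
    show "Rn n z = mat_inv (K n z) - mat_inv z"
      using p(2) unfolding K_def Rn_def s.R_mat_def at\<eta>[OF RD] x(3) .
  qed
  \<comment> \<open>\<open>R_transform\<close> is an arbitrary choice, so for both laws it is
    replaced near 0 by the explicit function, on a ball common to all sizes.\<close>
  note \<nu> = this is_R_transform_R_transform[OF this]
  have "is_R_transform B \<mu> s.R_mat" unfolding assms(6) by (rule s.is_R_transform_R_mat[OF assms(5)])
  note \<mu> = this is_R_transform_R_transform[OF this]
  obtain \<delta>1 where \<delta>1: "\<delta>1 > 0" "\<And>n z. n \<ge> 1 \<Longrightarrow> z \<in> mats B n \<Longrightarrow> mat_norm z < \<delta>1 \<Longrightarrow> R_transform B \<nu> n z = Rn n z"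
    using is_R_transform_unique[OF B \<nu>(2,1)] by blast
  obtain \<delta>2 where \<delta>2: "\<delta>2 > 0" "\<And>n z. n \<ge> 1 \<Longrightarrow> z \<in> mats B n \<Longrightarrow> mat_norm z < \<delta>2 \<Longrightarrow> R_transform B \<mu> n z = s.R_mat n z"
    using is_R_transform_unique[OF B \<mu>(2,1)] by blast
  show "is_convolution_power B \<eta> \<mu> \<nu>"
    unfolding is_convolution_power_def
    by (rule exI[of _ "min \<delta>1 \<delta>2"]) (simp add: \<delta>1 \<delta>2 Rn_def)
qed

end
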